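(* Let $\mathsf{Map}_c$ be the category of map-graded categories and cartesian graded functors, endowed with the pretopology of $\infty$-covers. The contravariant functor $$\mathbf{C}:\mathsf{Map}_c\longrightarrow B_\infty,\qquad (\mathcal U,\mathfrak a)\longmapsto \mathbf{C}_{\mathcal U}(\mathfrak a)$$ is a sheaf; that is, for every $\infty$-cover $((\varphi_i,F_i):(\mathcal V_i,\mathfrak b_i)\to(\mathcal U,\mathfrak a))_{i\in I}$ in $\mathsf{Map}_c$ the canonical diagram $$\mathbf{C}_{\mathcal U}(\mathfrak a)\to\prod_{i}\mathbf{C}_{\mathcal V_i}(\mathfrak b_i)\rightrightarrows\prod_{i,j}\mathbf{C}_{\mathcal V_i\times_{\mathcal U}\mathcal V_j}(\mathfrak b_i\times_{\mathfrak a}\mathfrak b_j)$$ is an equalizer.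
   Context: Fix a commutative ring $k$. For a small category $\mathcal U$, a ($k$-linear) $\mathcal U$-graded category $\mathfrak a$ consists of a set $\mathfrak a_U$ for each object $U$; a $k$-module $\mathfrak a_u(A,A')$ for each $u:U\to U'$, $A\in\mathfrak a_U$, $A'\in\mathfrak a_{U'}$; compositions $\mathfrak a_{u'}(A',A'')\otimes_k\mathfrak a_u(A,A')\to\mathfrak a_{u'u}(A,A'')$ and identities $1_A\in\mathfrak a_{1_U}(A,A)$, associative and unital. The pair $(\mathcal U,\mathfrak a)$ is a map-graded category. A graded functor $(\varphi,F):(\mathcal V,\mathfrak b)\to(\mathcal U,\mathfrak a)$ is a functor $\varphi:\mathcal V\to\mathcal U$ with maps $\mathfrak b_V\to\mathfrak a_{\varphi(V)}$ and $k$-linear maps $\mathfrak b_v(B,B')\to\mathfrak a_{\varphi(v)}(F(B),F(B'))$ respecting compositions and identities. It is cartesian if all these maps (on object sets and on the modules) are bijective. $\mathsf{Map}$ is the category of map-graded categories and graded functors; it has pullbacks, computed componentwise: $(\mathcal V_1\times_{\mathcal U}\mathcal V_2,\mathfrak b_1\times_{\mathfrak a}\mathfrak b_2)$ with object sets and morphism modules given by the pullbacks of object sets and morphism modules. $\mathsf{Map}_c\subseteq\mathsf{Map}$ has the same objects and the cartesian graded functors as morphisms. A collection $((\varphi_i,F_i):(\mathcal V_i,\mathfrak b_i)\to(\mathcal U,\mathfrak a))_i$ in $\mathsf{Map}_c$ is an $\infty$-cover if for every $m\ge0$ the maps $\mathcal N_m(\varphi_i):\mathcal N_m(\mathcal V_i)\to\mathcal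 N_m(\mathcal U)$ between $m$-simplices of nerves are jointly surjective. Hochschild complex: an $n$-simplex $(u,A)$ of $\mathfrak a$ consists of $U_0\xrightarrow{u_0}U_1\to\cdots\xrightarrow{u_{n-1}}U_n$ in $\mathcal U$ and $A_i\in\mathfrak a_{U_i}$; $|u|=u_{n-1}\cdots u_0$ (identity if $n=0$). Then $$\mathbf{C}^n_{\mathcal U}(\mathfrak a)=\prod_{(u,A)}\mathrm{Hom}_k(\mathfrak a_{u_{n-1}}(A_{n-1},A_n)\otimes\cdots\otimes\mathfrak a_{u_0}(A_0,A_1),\mathfrak a_{|u|}(A_0,A_n))$$ with the usual Hochschild differential. It is a $B_\infty$-algebra via the usual brace operations (inserting cochains into a cochain on consecutive arguments, contracting the corresponding edges of the simplex) and cup product. For a cartesian graded functor $(\varphi,F)$, the map $F^*:\mathbf{C}_{\mathcal U}(\mathfrak a)\to\mathbf{C}_{\mathcal V}(\mathfrak b)$, $F^*(\phi)_{(v,B)}=F^{-1}\circ\phi_{(\varphi(v),F(B))}\circ F^{\otimes n}$, strictly preserves all the $B_\infty$-operations; this defines the contravariant functor $\mathbf C$ to the category $B_\infty$ of $B_\infty$-algebras. The equalizer may be computed on underlying graded $k$-modules. *)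

theory Defs
  imports "HOL-Algebra.Module" "HOL-Library.FuncSet"
begin

section \<open>Modules over a commutative ring\<close>

text \<open>
  The ground ring and all modules are HOL-Algebra structures.  The record type
  \<^term>\<open>M :: ('k, 'x) module\<close> extends the ring record, but the locale \<^locale>\<open>module\<close>
  ignores the fields \<^const>\<open>mult\<close> and \<^const>\<open>one\<close> of the module; they are left
  undefined below.
\<close>

definition mod_hom :: "'k ring \<Rightarrow> ('k, 'x) module \<Rightarrow> ('k, 'y) module \<Rightarrow> ('x \<Rightarrow> 'y) \<Rightarrow> bool" where
  "mod_hom R M N f \<longleftrightarrow>
     f \<in> carrier M \<rightarrow> carrier N \<and>
     (\<forall>x\<in>carrier M. \<forall>y\<in>carrier M. f (x \<oplus>\<^bsub>M\<^esub> y) = f x \<oplus>\<^bsub>N\<^esub> f y) \<and>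
     (\<forall>c\<in>carrier R. \<forall>x\<in>carrier M. f (c \<odot>\<^bsub>M\<^esub> x) = c \<odot>\<^bsub>N\<^esub> f x)"

definition tuples :: "('k, 'x) module list \<Rightarrow> 'x list set" where
  "tuples Ms = {xs. list_all2 (\<lambda>x M. x \<in> carrier M) xs Ms}"

text \<open>
  Linear maps out of a tensor product \<open>M\<^sub>0 \<otimes> \<dots> \<otimes> M\<^sub>r\<close> are represented by multilinear maps
  on lists \<open>[x\<^sub>0, \<dots>, x\<^sub>r]\<close>; for the empty tensor product \<open>k\<close> this is an element of the target.
\<close>

definition multilinear :: "'k ring \<Rightarrow> ('k, 'x) module list \<Rightarrow> ('k, 'y) module \<Rightarrow> ('x list \<Rightarrow> 'y) \<Rightarrow> bool" where
  "multilinear R Ms N f \<longleftrightarrow>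
     f \<in> tuples Ms \<rightarrow> carrier N \<and>
     (\<forall>xs\<in>tuples Ms. \<forall>i<length Ms. mod_hom R (Ms ! i) N (\<lambda>x. f (xs[i := x])))"

definition signed :: "('k, 'x) module \<Rightarrow> int \<Rightarrow> 'x \<Rightarrow> 'x" where
  "signed M e x = (if even e then x else \<ominus>\<^bsub>M\<^esub> x)"


section \<open>Small categories, map-graded categories, graded functors\<close>

record ('o, 'm) cat =
  Ob :: "'o set"
  Arr :: "'m set"
  Dom :: "'m \<Rightarrow> 'o"
  Cod :: "'m \<Rightarrow> 'o"
  Id :: "'o \<Rightarrow> 'm"
  Comp :: "'m \<Rightarrow> 'm \<Rightarrow> 'm"   \<comment> \<open>\<open>Comp C v u\<close> is \<open>v \<circ> u\<close>\<close>

locale category =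
  fixes C :: "('o, 'm) cat"
  assumes dom_cod: "u \<in> Arr C \<Longrightarrow> Dom C u \<in> Ob C \<and> Cod C u \<in> Ob C"
    and id_arr: "U \<in> Ob C \<Longrightarrow> Id C U \<in> Arr C \<and> Dom C (Id C U) = U \<and> Cod C (Id C U) = U"
    and comp_arr: "\<lbrakk>u \<in> Arr C; v \<in> Arr C; Cod C u = Dom C v\<rbrakk> \<Longrightarrow>
      Comp C v u \<in> Arr C \<and> Dom C (Comp C v u) = Dom C u \<and> Cod C (Comp C v u) = Cod C v"
    and comp_id: "u \<in> Arr C \<Longrightarrow>
      Comp C u (Id C (Dom C u)) = u \<and> Comp C (Id C (Cod C u)) u = u"
    and comp_assoc: "\<lbrakk>u \<in> Arr C; v \<in> Arr C; w \<in> Arr C; Cod C u = Dom C v; Cod C v = Dom C w\<rbrakk> \<Longrightarrow>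
      Comp C w (Comp C v u) = Comp C (Comp C w v) u"

text \<open>
  \<open>gobj \<aa> U\<close> is \<open>\<aa>\<^sub>U\<close>, \<open>gmor \<aa> u A A'\<close> is \<open>\<aa>\<^sub>u(A, A')\<close>, and \<open>gcmp \<aa> u' u A A' A'' g f\<close> is the
  composite of \<open>g \<in> \<aa>\<^sub>u'(A', A'')\<close> and \<open>f \<in> \<aa>\<^sub>u(A, A')\<close>.  The indices are arguments because neither
  the sets \<open>\<aa>\<^sub>U\<close> nor the carriers of the modules are assumed to be disjoint.
\<close>

record ('k, 'o, 'm, 'a, 'x) mgcat =
  base :: "('o, 'm) cat"
  gobj :: "'o \<Rightarrow> 'a set"
  gmor :: "'m \<Rightarrow> 'a \<Rightarrow> 'a \<Rightarrow> ('k, 'x) module"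
  gcmp :: "'m \<Rightarrow> 'm \<Rightarrow> 'a \<Rightarrow> 'a \<Rightarrow> 'a \<Rightarrow> 'x \<Rightarrow> 'x \<Rightarrow> 'x"
  gone :: "'o \<Rightarrow> 'a \<Rightarrow> 'x"

locale map_graded =
  fixes R :: "'k ring" and \<aa> :: "('k, 'o, 'm, 'a, 'x) mgcat"
  assumes ground: "cring R"
    and base: "category (base \<aa>)"
    and gmor_module: "\<lbrakk>u \<in> Arr (base \<aa>); A \<in> gobj \<aa> (Dom (base \<aa>) u); A' \<in> gobj \<aa> (Cod (base \<aa>) u)\<rbrakk> \<Longrightarrow>
      module R (gmor \<aa> u A A')"
    and gcmp_left: "\<lbrakk>u \<in> Arr (base \<aa>); u' \<in> Arr (base \<aa>); Cod (base \<aa>) u = Dom (base \<aa>) u';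
        A \<in> gobj \<aa> (Dom (base \<aa>) u); A' \<in> gobj \<aa> (Cod (base \<aa>) u); A'' \<in> gobj \<aa> (Cod (base \<aa>) u');
        f \<in> carrier (gmor \<aa> u A A')\<rbrakk> \<Longrightarrow>
      mod_hom R (gmor \<aa> u' A' A'') (gmor \<aa> (Comp (base \<aa>) u' u) A A'')
        (\<lambda>g. gcmp \<aa> u' u A A' A'' g f)"
    and gcmp_right: "\<lbrakk>u \<in> Arr (base \<aa>); u' \<in> Arr (base \<aa>); Cod (base \<aa>) u = Dom (base \<aa>) u';
        A \<in> gobj \<aa> (Dom (base \<aa>) u); A' \<in> gobj \<aa> (Cod (base \<aa>) u); A'' \<in> gobj \<aa> (Cod (base \<aa>) u');
        g \<in> carrier (gmor \<aa> u' A' A'')\<rbrakk> \<Longrightarrow>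
      mod_hom R (gmor \<aa> u A A') (gmor \<aa> (Comp (base \<aa>) u' u) A A'')
        (\<lambda>f. gcmp \<aa> u' u A A' A'' g f)"
    and gone_mor: "\<lbrakk>U \<in> Ob (base \<aa>); A \<in> gobj \<aa> U\<rbrakk> \<Longrightarrow>
      gone \<aa> U A \<in> carrier (gmor \<aa> (Id (base \<aa>) U) A A)"
    and gcmp_one: "\<lbrakk>u \<in> Arr (base \<aa>); A \<in> gobj \<aa> (Dom (base \<aa>) u); A' \<in> gobj \<aa> (Cod (base \<aa>) u);
        f \<in> carrier (gmor \<aa> u A A')\<rbrakk> \<Longrightarrow>
      gcmp \<aa> u (Id (base \<aa>) (Dom (base \<aa>) u)) A A A' f (gone \<aa> (Dom (base \<aa>) u) A) = f \<and>
      gcmp \<aa> (Id (base \<aa>) (Cod (base \<aa>) u)) u A A' A' (gone \<aa> (Cod (base \<aa>) u) A') f = f"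
    and gcmp_assoc: "\<lbrakk>u \<in> Arr (base \<aa>); u' \<in> Arr (base \<aa>); u'' \<in> Arr (base \<aa>);
        Cod (base \<aa>) u = Dom (base \<aa>) u'; Cod (base \<aa>) u' = Dom (base \<aa>) u'';
        A \<in> gobj \<aa> (Dom (base \<aa>) u); A' \<in> gobj \<aa> (Cod (base \<aa>) u);
        A'' \<in> gobj \<aa> (Cod (base \<aa>) u'); A''' \<in> gobj \<aa> (Cod (base \<aa>) u'');
        f \<in> carrier (gmor \<aa> u A A'); g \<in> carrier (gmor \<aa> u' A' A''); h \<in> carrier (gmor \<aa> u'' A'' A''')\<rbrakk> \<Longrightarrow>
      gcmp \<aa> u'' (Comp (base \<aa>) u' u) A A'' A''' h (gcmp \<aa> u' u A A' A'' g f) =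
      gcmp \<aa> (Comp (base \<aa>) u'' u') u A A' A''' (gcmp \<aa> u'' u' A' A'' A''' h g) f"

text \<open>A graded functor \<open>(\<phi>, F)\<close>: \<open>fob\<close> and \<open>farr\<close> are \<open>\<phi>\<close>, \<open>fobj\<close> and \<open>fmor\<close> are \<open>F\<close>.\<close>

record ('o, 'm, 'a, 'x, 'o', 'm', 'a', 'x') gfun =
  fob :: "'o \<Rightarrow> 'o'"
  farr :: "'m \<Rightarrow> 'm'"
  fobj :: "'o \<Rightarrow> 'a \<Rightarrow> 'a'"
  fmor :: "'m \<Rightarrow> 'a \<Rightarrow> 'a \<Rightarrow> 'x \<Rightarrow> 'x'"

definition is_functor :: "('o, 'm) cat \<Rightarrow> ('o', 'm') cat \<Rightarrow> ('o \<Rightarrow> 'o') \<Rightarrow> ('m \<Rightarrow> 'm') \<Rightarrow> bool" where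
  "is_functor C D fo fa \<longleftrightarrow>
     fo \<in> Ob C \<rightarrow> Ob D \<and> fa \<in> Arr C \<rightarrow> Arr D \<and>
     (\<forall>u\<in>Arr C. Dom D (fa u) = fo (Dom C u) \<and> Cod D (fa u) = fo (Cod C u)) \<and>
     (\<forall>U\<in>Ob C. fa (Id C U) = Id D (fo U)) \<and>
     (\<forall>u\<in>Arr C. \<forall>v\<in>Arr C. Cod C u = Dom C v \<longrightarrow> fa (Comp C v u) = Comp D (fa v) (fa u))"

definition graded_functor ::
  "'k ring \<Rightarrow> ('k, 'o, 'm, 'a, 'x) mgcat \<Rightarrow> ('k, 'o', 'm', 'a', 'x') mgcat \<Rightarrow>
    ('o, 'm, 'a, 'x, 'o', 'm', 'a', 'x') gfun \<Rightarrow> bool" where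
  "graded_functor R \<bb> \<aa> F \<longleftrightarrow>
     is_functor (base \<bb>) (base \<aa>) (fob F) (farr F) \<and>
     (\<forall>V\<in>Ob (base \<bb>). fobj F V \<in> gobj \<bb> V \<rightarrow> gobj \<aa> (fob F V)) \<and>
     (\<forall>v\<in>Arr (base \<bb>). \<forall>B\<in>gobj \<bb> (Dom (base \<bb>) v). \<forall>B'\<in>gobj \<bb> (Cod (base \<bb>) v).
        mod_hom R (gmor \<bb> v B B')
          (gmor \<aa> (farr F v) (fobj F (Dom (base \<bb>) v) B) (fobj F (Cod (base \<bb>) v) B'))
          (fmor F v B B')) \<and>
     (\<forall>V\<in>Ob (base \<bb>). \<forall>B\<in>gobj \<bb> V.
        fmor F (Id (base \<bb>) V) B B (gone \<bb> V B) = gone \<aa> (fob F V) (fobj F V B)) \<and>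
     (\<forall>v\<in>Arr (base \<bb>). \<forall>v'\<in>Arr (base \<bb>). Cod (base \<bb>) v = Dom (base \<bb>) v' \<longrightarrow>
        (\<forall>B\<in>gobj \<bb> (Dom (base \<bb>) v). \<forall>B'\<in>gobj \<bb> (Cod (base \<bb>) v). \<forall>B''\<in>gobj \<bb> (Cod (base \<bb>) v').
         \<forall>f\<in>carrier (gmor \<bb> v B B'). \<forall>g\<in>carrier (gmor \<bb> v' B' B'').
           fmor F (Comp (base \<bb>) v' v) B B'' (gcmp \<bb> v' v B B' B'' g f) =
           gcmp \<aa> (farr F v') (farr F v) (fobj F (Dom (base \<bb>) v) B)
             (fobj F (Cod (base \<bb>) v) B') (fobj F (Cod (base \<bb>) v') B'')
             (fmor F v' B' B'' g) (fmor F v B B' f)))"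

definition cartesian ::
  "'k ring \<Rightarrow> ('k, 'o, 'm, 'a, 'x) mgcat \<Rightarrow> ('k, 'o', 'm', 'a', 'x') mgcat \<Rightarrow>
    ('o, 'm, 'a, 'x, 'o', 'm', 'a', 'x') gfun \<Rightarrow> bool" where
  "cartesian R \<bb> \<aa> F \<longleftrightarrow>
     graded_functor R \<bb> \<aa> F \<and>
     (\<forall>V\<in>Ob (base \<bb>). bij_betw (fobj F V) (gobj \<bb> V) (gobj \<aa> (fob F V))) \<and>
     (\<forall>v\<in>Arr (base \<bb>). \<forall>B\<in>gobj \<bb> (Dom (base \<bb>) v). \<forall>B'\<in>gobj \<bb> (Cod (base \<bb>) v).
        bij_betw (fmor F v B B') (carrier (gmor \<bb> v B B'))
          (carrier (gmor \<aa> (farr F v) (fobj F (Dom (base \<bb>) v) B) (fobj F (Cod (base \<bb>) v) B'))))"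


subsection \<open>Pullbacks\<close>

definition pullback_cat ::
  "('o1, 'm1) cat \<Rightarrow> ('o2, 'm2) cat \<Rightarrow> ('o1 \<Rightarrow> 'o) \<Rightarrow> ('m1 \<Rightarrow> 'm) \<Rightarrow> ('o2 \<Rightarrow> 'o) \<Rightarrow> ('m2 \<Rightarrow> 'm) \<Rightarrow>
    ('o1 \<times> 'o2, 'm1 \<times> 'm2) cat" where
  "pullback_cat C1 C2 fo1 fa1 fo2 fa2 =
    \<lparr>Ob = {(V, W). V \<in> Ob C1 \<and> W \<in> Ob C2 \<and> fo1 V = fo2 W},
     Arr = {(v, w). v \<in> Arr C1 \<and> w \<in> Arr C2 \<and> fa1 v = fa2 w},
     Dom = (\<lambda>(v, w). (Dom C1 v, Dom C2 w)),
     Cod = (\<lambda>(v, w). (Cod C1 v, Cod C2 w)),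
     Id = (\<lambda>(V, W). (Id C1 V, Id C2 W)),
     Comp = (\<lambda>(v', w') (v, w). (Comp C1 v' v, Comp C2 w' w))\<rparr>"

definition pullback_module ::
  "('k, 'x1) module \<Rightarrow> ('k, 'x2) module \<Rightarrow> ('x1 \<Rightarrow> 'x) \<Rightarrow> ('x2 \<Rightarrow> 'x) \<Rightarrow> ('k, 'x1 \<times> 'x2) module" where
  "pullback_module M1 M2 f1 f2 =
    \<lparr>carrier = {(x, y). x \<in> carrier M1 \<and> y \<in> carrier M2 \<and> f1 x = f2 y},
     mult = undefined, one = undefined,
     zero = (\<zero>\<^bsub>M1\<^esub>, \<zero>\<^bsub>M2\<^esub>),
     add = (\<lambda>(x, y) (x', y'). (x \<oplus>\<^bsub>M1\<^esub> x', y \<oplus>\<^bsub>M2\<^esub> y')),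
     smult = (\<lambda>c (x, y). (c \<odot>\<^bsub>M1\<^esub> x, c \<odot>\<^bsub>M2\<^esub> y))\<rparr>"

definition pullback ::
  "('k, 'o1, 'm1, 'a1, 'x1) mgcat \<Rightarrow> ('o1, 'm1, 'a1, 'x1, 'o, 'm, 'a, 'x) gfun \<Rightarrow>
    ('k, 'o2, 'm2, 'a2, 'x2) mgcat \<Rightarrow> ('o2, 'm2, 'a2, 'x2, 'o, 'm, 'a, 'x) gfun \<Rightarrow>
    ('k, 'o1 \<times> 'o2, 'm1 \<times> 'm2, 'a1 \<times> 'a2, 'x1 \<times> 'x2) mgcat" where
  "pullback \<bb>1 F1 \<bb>2 F2 =
    \<lparr>base = pullback_cat (base \<bb>1) (base \<bb>2) (fob F1) (farr F1) (fob F2) (farr F2),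
     gobj = (\<lambda>(V, W). {(B, C). B \<in> gobj \<bb>1 V \<and> C \<in> gobj \<bb>2 W \<and> fobj F1 V B = fobj F2 W C}),
     gmor = (\<lambda>(v, w) (B, C) (B', C').
       pullback_module (gmor \<bb>1 v B B') (gmor \<bb>2 w C C') (fmor F1 v B B') (fmor F2 w C C')),
     gcmp = (\<lambda>(v', w') (v, w) (B, C) (B', C') (B'', C'') (g, h) (g', h').
       (gcmp \<bb>1 v' v B B' B'' g g', gcmp \<bb>2 w' w C C' C'' h h')),
     gone = (\<lambda>(V, W) (B, C). (gone \<bb>1 V B, gone \<bb>2 W C))\<rparr>"

definition proj1 :: "('o1 \<times> 'o2, 'm1 \<times> 'm2, 'a1 \<times> 'a2, 'x1 \<times> 'x2, 'o1, 'm1, 'a1, 'x1) gfun" where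
  "proj1 = \<lparr>fob = fst, farr = fst, fobj = (\<lambda>_. fst), fmor = (\<lambda>_ _ _. fst)\<rparr>"

definition proj2 :: "('o1 \<times> 'o2, 'm1 \<times> 'm2, 'a1 \<times> 'a2, 'x1 \<times> 'x2, 'o2, 'm2, 'a2, 'x2) gfun" where
  "proj2 = \<lparr>fob = snd, farr = snd, fobj = (\<lambda>_. snd), fmor = (\<lambda>_ _ _. snd)\<rparr>"


subsection \<open>Nerves and covers\<close>

text \<open>
  All lists run in the order of composition: the \<open>m\<close>-simplex
  \<open>U\<^sub>0 \<rightarrow> U\<^sub>1 \<rightarrow> \<dots> \<rightarrow> U\<^sub>m\<close> with arrows \<open>u\<^sub>0, \<dots>, u\<^sub>m\<^sub>-\<^sub>1\<close> is the pair
  \<open>([U\<^sub>m, \<dots>, U\<^sub>0], [u\<^sub>m\<^sub>-\<^sub>1, \<dots>, u\<^sub>0])\<close>.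
\<close>

definition nerve :: "('o, 'm) cat \<Rightarrow> nat \<Rightarrow> ('o list \<times> 'm list) set" where
  "nerve C m = {(Us, us). length Us = Suc m \<and> length us = m \<and> set Us \<subseteq> Ob C \<and>
     (\<forall>i<m. us ! i \<in> Arr C \<and> Dom C (us ! i) = Us ! Suc i \<and> Cod C (us ! i) = Us ! i)}"

definition nerve_map :: "('o \<Rightarrow> 'o') \<Rightarrow> ('m \<Rightarrow> 'm') \<Rightarrow> 'o list \<times> 'm list \<Rightarrow> 'o' list \<times> 'm' list" where
  "nerve_map fo fa = (\<lambda>(Us, us). (map fo Us, map fa us))"

definition infinity_cover ::
  "'k ring \<Rightarrow> 'i set \<Rightarrow> ('i \<Rightarrow> ('k, 'o', 'm', 'a', 'x') mgcat) \<Rightarrow> ('k, 'o, 'm, 'a, 'x) mgcat \<Rightarrow>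
    ('i \<Rightarrow> ('o', 'm', 'a', 'x', 'o, 'm, 'a, 'x) gfun) \<Rightarrow> bool" where
  "infinity_cover R I \<bb> \<aa> F \<longleftrightarrow>
     (\<forall>i\<in>I. cartesian R (\<bb> i) \<aa> (F i)) \<and>
     (\<forall>m. (\<Union>i\<in>I. nerve_map (fob (F i)) (farr (F i)) ` nerve (base (\<bb> i)) m) = nerve (base \<aa>) m)"


section \<open>\<open>B\<^sub>\<infinity>\<close>-algebras\<close>

text \<open>
  A \<open>B\<^sub>\<infinity>\<close>-algebra is a \<open>\<int>\<close>-graded module \<open>V\<close> with a dg bialgebra structure on the tensor
  coalgebra \<open>T(V[1])\<close> (with unit the empty word).  The codifferential is given by its components
  \<open>b\<^sub>r : V[1]\<^sup>\<otimes>\<^sup>r \<rightarrow> V[1]\<close> of degree 1 (field \<open>bop\<close>) and the multiplication by its components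
  \<open>m\<^sub>p\<^sub>,\<^sub>q : V[1]\<^sup>\<otimes>\<^sup>p \<otimes> V[1]\<^sup>\<otimes>\<^sup>q \<rightarrow> V[1]\<close> of degree 0 (field \<open>mop\<close>), as functions of words
  of homogeneous elements, each letter being an element paired with its (unshifted) degree in \<open>V\<close>.
\<close>

record ('k, 'v) binf =
  grd :: "int \<Rightarrow> ('k, 'v) module"
  bop :: "(int \<times> 'v) list \<Rightarrow> 'v"
  mop :: "(int \<times> 'v) list \<Rightarrow> (int \<times> 'v) list \<Rightarrow> 'v"

definition words :: "('k, 'v) binf \<Rightarrow> (int \<times> 'v) list set" where
  "words V = {w. \<forall>(n, x)\<in>set w. x \<in> carrier (grd V n)}"

definition sdeg :: "(int \<times> 'v) list \<Rightarrow> int" where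
  "sdeg w = (\<Sum>(n, x)\<leftarrow>w. n - 1)"

definition bdeg :: "(int \<times> 'v) list \<Rightarrow> int" where
  "bdeg w = sdeg w + 2"

definition mdeg :: "(int \<times> 'v) list \<Rightarrow> (int \<times> 'v) list \<Rightarrow> int" where
  "mdeg v w = sdeg v + sdeg w + 1"

text \<open>
  The next two functions extend \<open>bop\<close> to a coderivation and \<open>mop\<close> to a coalgebra morphism, with
  Koszul signs.  A linear combination of words is a list of pairs \<open>(e, w)\<close> standing for the sum
  of the \<open>(-1)\<^sup>e w\<close>.
\<close>

definition bcoder :: "('k, 'v) binf \<Rightarrow> (int \<times> 'v) list \<Rightarrow> (int \<times> (int \<times> 'v) list) list" where
  "bcoder V w =
     [(sdeg (take i w),
       take i w @ (let s = take (j - i) (drop i w) in (bdeg s, bop V s)) # drop j w).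
      i \<leftarrow> [0..<length w], j \<leftarrow> [Suc i..<Suc (length w)]]"

function bmult :: "('k, 'v) binf \<Rightarrow> (int \<times> 'v) list \<Rightarrow> (int \<times> 'v) list \<Rightarrow>
    (int \<times> (int \<times> 'v) list) list" where
  "bmult V v w =
     (if v = [] \<and> w = [] then [(0, [])]
      else [(e + sdeg (drop p v) * sdeg (take q w),
             (mdeg (take p v) (take q w), mop V (take p v) (take q w)) # z).
            p \<leftarrow> [0..<Suc (length v)], q \<leftarrow> [0..<Suc (length w)], (p, q) \<noteq> (0, 0),
            (e, z) \<leftarrow> bmult V (drop p v) (drop q w)])"
  by pat_completeness auto
termination
  by (relation "measure (\<lambda>(V, v, w). length v + length w)") (auto simp flip: length_greater_0_conv)

declare bmult.simps [simp del]

definition lincomb :: "('k, 'v) module \<Rightarrow> ((int \<times> 'v) list \<Rightarrow> 'v) \<Rightarrow>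
    (int \<times> (int \<times> 'v) list) list \<Rightarrow> 'v" where
  "lincomb M f L = foldr (\<lambda>(e, w) s. signed M e (f w) \<oplus>\<^bsub>M\<^esub> s) L \<zero>\<^bsub>M\<^esub>"

text \<open>
  The three identities at the end are associativity of the multiplication, the fact that the
  codifferential squares to zero, and the fact that it is a derivation for the multiplication.
  Both sides of each are determined by their projections to \<open>V[1]\<close>, which is what is stated.
\<close>

locale binf_algebra =
  fixes R :: "'k ring" and V :: "('k, 'v) binf"
  assumes ground: "cring R"
    and grd_module: "module R (grd V n)"
    and bop_multilinear: "multilinear R (map (grd V) ds) (grd V (sum_list ds - int (length ds) + 2))
          (\<lambda>xs. bop V (zip ds xs))"
    and mop_multilinear: "multilinear R (map (grd V) (ds @ es))
          (grd V (sum_list (ds @ es) - int (length (ds @ es)) + 1))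
          (\<lambda>xs. mop V (zip ds (take (length ds) xs)) (zip es (drop (length ds) xs)))"
    and bop_Nil: "bop V [] = \<zero>\<^bsub>grd V 2\<^esub>"
    and mop_unit: "x \<in> carrier (grd V n) \<Longrightarrow> mop V [] [(n, x)] = x \<and> mop V [(n, x)] [] = x"
    and mop_counit: "\<lbrakk>w \<in> words V; length w \<noteq> 1\<rbrakk> \<Longrightarrow>
          mop V [] w = \<zero>\<^bsub>grd V (mdeg [] w)\<^esub> \<and> mop V w [] = \<zero>\<^bsub>grd V (mdeg w [])\<^esub>"
    and mult_assoc: "\<lbrakk>u \<in> words V; v \<in> words V; w \<in> words V\<rbrakk> \<Longrightarrow>
          lincomb (grd V (sdeg u + sdeg v + sdeg w + 1)) (\<lambda>z. mop V z w) (bmult V u v) =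
          lincomb (grd V (sdeg u + sdeg v + sdeg w + 1)) (\<lambda>z. mop V u z) (bmult V v w)"
    and codiff_square: "w \<in> words V \<Longrightarrow>
          lincomb (grd V (sdeg w + 3)) (bop V) (bcoder V w) = \<zero>\<^bsub>grd V (sdeg w + 3)\<^esub>"
    and codiff_derivation: "\<lbrakk>v \<in> words V; w \<in> words V\<rbrakk> \<Longrightarrow>
          lincomb (grd V (sdeg v + sdeg w + 2)) (bop V) (bmult V v w) =
          lincomb (grd V (sdeg v + sdeg w + 2)) (\<lambda>z. mop V z w) (bcoder V v)
          \<oplus>\<^bsub>grd V (sdeg v + sdeg w + 2)\<^esub>
          signed (grd V (sdeg v + sdeg w + 2)) (sdeg v)
            (lincomb (grd V (sdeg v + sdeg w + 2)) (\<lambda>z. mop V v z) (bcoder V w))"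

text \<open>Morphisms of \<open>B\<^sub>\<infinity>\<close>-algebras are strict.\<close>

definition map_word :: "(int \<Rightarrow> 'v \<Rightarrow> 'w) \<Rightarrow> (int \<times> 'v) list \<Rightarrow> (int \<times> 'w) list" where
  "map_word f = map (\<lambda>(n, x). (n, f n x))"

definition binf_hom :: "'k ring \<Rightarrow> ('k, 'v) binf \<Rightarrow> ('k, 'w) binf \<Rightarrow> (int \<Rightarrow> 'v \<Rightarrow> 'w) \<Rightarrow> bool" where
  "binf_hom R V W f \<longleftrightarrow>
     (\<forall>n. mod_hom R (grd V n) (grd W n) (f n)) \<and>
     (\<forall>w\<in>words V. f (bdeg w) (bop V w) = bop W (map_word f w)) \<and>
     (\<forall>v\<in>words V. \<forall>w\<in>words V. f (mdeg v w) (mop V v w) = mop W (map_word f v) (map_word f w))"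

definition binf_prod :: "'i set \<Rightarrow> ('i \<Rightarrow> ('k, 'v) binf) \<Rightarrow> ('k, 'i \<Rightarrow> 'v) binf" where
  "binf_prod I V =
    \<lparr>grd = (\<lambda>n.
       \<lparr>carrier = (\<Pi>\<^sub>E i\<in>I. carrier (grd (V i) n)),
        mult = undefined, one = undefined,
        zero = (\<lambda>i\<in>I. \<zero>\<^bsub>grd (V i) n\<^esub>),
        add = (\<lambda>x y. \<lambda>i\<in>I. x i \<oplus>\<^bsub>grd (V i) n\<^esub> y i),
        smult = (\<lambda>c x. \<lambda>i\<in>I. c \<odot>\<^bsub>grd (V i) n\<^esub> x i)\<rparr>),
     bop = (\<lambda>w. \<lambda>i\<in>I. bop (V i) (map_word (\<lambda>_ x. x i) w)),
     mop = (\<lambda>v w. \<lambda>i\<in>I. mop (V i) (map_word (\<lambda>_ x. x i) v) (map_word (\<lambda>_ x. x i) w))\<rparr>"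

text \<open>
  \<open>e : E \<rightarrow> P\<close> is an equalizer of \<open>f, g : P \<rightarrow> Q\<close> in the category of \<open>B\<^sub>\<infinity>\<close>-algebras.  The test
  objects range over all \<open>B\<^sub>\<infinity>\<close>-algebras with elements in the type \<open>'t\<close>; a statement using this
  notion is meant for every type \<open>'t\<close>.  The predicate is meant for \<open>B\<^sub>\<infinity>\<close>-algebras
  \<open>E\<close>, \<open>P\<close>, \<open>Q\<close> and does not restate their identities.
\<close>

definition binf_equalizer ::
  "'t itself \<Rightarrow> 'k ring \<Rightarrow> ('k, 'u) binf \<Rightarrow> ('k, 'v) binf \<Rightarrow> ('k, 'w) binf \<Rightarrow>
    (int \<Rightarrow> 'u \<Rightarrow> 'v) \<Rightarrow> (int \<Rightarrow> 'v \<Rightarrow> 'w) \<Rightarrow> (int \<Rightarrow> 'v \<Rightarrow> 'w) \<Rightarrow> bool" where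
  "binf_equalizer _ R E P Q e f g \<longleftrightarrow>
     binf_hom R E P e \<and> binf_hom R P Q f \<and> binf_hom R P Q g \<and>
     (\<forall>n. \<forall>x\<in>carrier (grd E n). f n (e n x) = g n (e n x)) \<and>
     (\<forall>(T :: ('k, 't) binf) h.
        binf_algebra R T \<and> binf_hom R T P h \<and>
        (\<forall>n. \<forall>x\<in>carrier (grd T n). f n (h n x) = g n (h n x)) \<longrightarrow>
        (\<exists>t. binf_hom R T E t \<and> (\<forall>n. \<forall>x\<in>carrier (grd T n). e n (t n x) = h n x) \<and>
             (\<forall>t'. binf_hom R T E t' \<and> (\<forall>n. \<forall>x\<in>carrier (grd T n). e n (t' n x) = h n x) \<longrightarrow>
                   (\<forall>n. \<forall>x\<in>carrier (grd T n). t' n x = t n x))))"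


section \<open>The Hochschild complex\<close>

text \<open>
  A simplex \<open>(u, A)\<close> is the triple \<open>([U\<^sub>n, \<dots>, U\<^sub>0], [u\<^sub>n\<^sub>-\<^sub>1, \<dots>, u\<^sub>0], [A\<^sub>n, \<dots>, A\<^sub>0])\<close>.  The
  arguments of a cochain are listed in the order of the tensor product
  \<open>\<aa>(A\<^sub>n\<^sub>-\<^sub>1, A\<^sub>n) \<otimes> \<dots> \<otimes> \<aa>(A\<^sub>0, A\<^sub>1)\<close>.  There are no simplices of negative
  dimension, so that the cochain module of negative degree is zero.
\<close>

type_synonym ('o, 'm, 'a) simplex = "'o list \<times> 'm list \<times> 'a list"
type_synonym ('o, 'm, 'a, 'x) cochain = "('o, 'm, 'a) simplex \<Rightarrow> 'x list \<Rightarrow> 'x"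

definition simplices :: "('k, 'o, 'm, 'a, 'x) mgcat \<Rightarrow> int \<Rightarrow> ('o, 'm, 'a) simplex set" where
  "simplices \<aa> n = {(Us, us, As). int (length us) = n \<and> (Us, us) \<in> nerve (base \<aa>) (length us) \<and>
     list_all2 (\<lambda>A U. A \<in> gobj \<aa> U) As Us}"

definition path :: "('o, 'm) cat \<Rightarrow> ('o, 'm, 'a) simplex \<Rightarrow> 'm" where
  "path C = (\<lambda>(Us, us, As). foldr (Comp C) us (Id C (last Us)))"

definition vert :: "('o, 'm, 'a) simplex \<Rightarrow> nat \<Rightarrow> 'a" where
  "vert = (\<lambda>(Us, us, As) i. As ! i)"

definition edge :: "('o, 'm, 'a) simplex \<Rightarrow> nat \<Rightarrow> 'm" where
  "edge = (\<lambda>(Us, us, As) i. us ! i)"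

definition sources :: "('k, 'o, 'm, 'a, 'x) mgcat \<Rightarrow> ('o, 'm, 'a) simplex \<Rightarrow> ('k, 'x) module list" where
  "sources \<aa> = (\<lambda>(Us, us, As). map (\<lambda>i. gmor \<aa> (us ! i) (As ! Suc i) (As ! i)) [0..<length us])"

definition target :: "('k, 'o, 'm, 'a, 'x) mgcat \<Rightarrow> ('o, 'm, 'a) simplex \<Rightarrow> ('k, 'x) module" where
  "target \<aa> = (\<lambda>(Us, us, As). gmor \<aa> (path (base \<aa>) (Us, us, As)) (last As) (hd As))"

definition cochains :: "'k ring \<Rightarrow> ('k, 'o, 'm, 'a, 'x) mgcat \<Rightarrow> int \<Rightarrow> ('k, ('o, 'm, 'a, 'x) cochain) module" where
  "cochains R \<aa> n =
    \<lparr>carrier = (\<Pi>\<^sub>E \<sigma>\<in>simplices \<aa> n.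
        {f \<in> extensional (tuples (sources \<aa> \<sigma>)). multilinear R (sources \<aa> \<sigma>) (target \<aa> \<sigma>) f}),
     mult = undefined, one = undefined,
     zero = (\<lambda>\<sigma>\<in>simplices \<aa> n. \<lambda>fs\<in>tuples (sources \<aa> \<sigma>). \<zero>\<^bsub>target \<aa> \<sigma>\<^esub>),
     add = (\<lambda>\<phi> \<psi>. \<lambda>\<sigma>\<in>simplices \<aa> n. \<lambda>fs\<in>tuples (sources \<aa> \<sigma>). \<phi> \<sigma> fs \<oplus>\<^bsub>target \<aa> \<sigma>\<^esub> \<psi> \<sigma> fs),
     smult = (\<lambda>c \<phi>. \<lambda>\<sigma>\<in>simplices \<aa> n. \<lambda>fs\<in>tuples (sources \<aa> \<sigma>). c \<odot>\<^bsub>target \<aa> \<sigma>\<^esub> \<phi> \<sigma> fs)\<rparr>"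

text \<open>
  For \<open>i \<le> j\<close>, \<open>seg i j \<sigma>\<close> is the part of \<open>\<sigma>\<close> between the vertices at list positions \<open>i\<close> and \<open>j\<close>,
  and \<open>contract C i j \<sigma>\<close> replaces this part by the single edge which is its composite (an identity
  if \<open>i = j\<close>, so that the vertex is doubled).
\<close>

definition seg :: "nat \<Rightarrow> nat \<Rightarrow> ('o, 'm, 'a) simplex \<Rightarrow> ('o, 'm, 'a) simplex" where
  "seg i j = (\<lambda>(Us, us, As).
     (take (Suc (j - i)) (drop i Us), take (j - i) (drop i us), take (Suc (j - i)) (drop i As)))"

definition contract :: "('o, 'm) cat \<Rightarrow> nat \<Rightarrow> nat \<Rightarrow> ('o, 'm, 'a) simplex \<Rightarrow> ('o, 'm, 'a) simplex" where
  "contract C i j = (\<lambda>(Us, us, As).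
     (take (Suc i) Us @ drop j Us,
      take i us @ path C (seg i j (Us, us, As)) # drop j us,
      take (Suc i) As @ drop j As))"

definition splice :: "nat \<Rightarrow> nat \<Rightarrow> 'x \<Rightarrow> 'x list \<Rightarrow> 'x list" where
  "splice i j x fs = take i fs @ x # drop j fs"

definition hdiff :: "('k, 'o, 'm, 'a, 'x) mgcat \<Rightarrow> nat \<Rightarrow> ('o, 'm, 'a, 'x) cochain \<Rightarrow> ('o, 'm, 'a, 'x) cochain" where
  "hdiff \<aa> p \<phi> = (\<lambda>\<sigma>\<in>simplices \<aa> (int p + 1). \<lambda>fs\<in>tuples (sources \<aa> \<sigma>).
     gcmp \<aa> (edge \<sigma> 0) (path (base \<aa>) (seg 1 (Suc p) \<sigma>)) (vert \<sigma> (Suc p)) (vert \<sigma> 1) (vert \<sigma> 0)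
       (fs ! 0) (\<phi> (seg 1 (Suc p) \<sigma>) (tl fs))
     \<oplus>\<^bsub>target \<aa> \<sigma>\<^esub>
     (\<Oplus>\<^bsub>target \<aa> \<sigma>\<^esub>i\<in>{..<p}. signed (target \<aa> \<sigma>) (int i + 1)
       (\<phi> (contract (base \<aa>) i (i + 2) \<sigma>)
          (splice i (i + 2)
            (gcmp \<aa> (edge \<sigma> i) (edge \<sigma> (i + 1)) (vert \<sigma> (i + 2)) (vert \<sigma> (i + 1)) (vert \<sigma> i)
              (fs ! i) (fs ! (i + 1))) fs)))
     \<oplus>\<^bsub>target \<aa> \<sigma>\<^esub>
     signed (target \<aa> \<sigma>) (int p + 1)
       (gcmp \<aa> (path (base \<aa>) (seg 0 p \<sigma>)) (edge \<sigma> p) (vert \<sigma> (Suc p)) (vert \<sigma> p) (vert \<sigma> 0)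
         (\<phi> (seg 0 p \<sigma>) (butlast fs)) (fs ! p)))"

definition hcup :: "('k, 'o, 'm, 'a, 'x) mgcat \<Rightarrow> nat \<Rightarrow> ('o, 'm, 'a, 'x) cochain \<Rightarrow>
    nat \<Rightarrow> ('o, 'm, 'a, 'x) cochain \<Rightarrow> ('o, 'm, 'a, 'x) cochain" where
  "hcup \<aa> p \<phi> q \<psi> = (\<lambda>\<sigma>\<in>simplices \<aa> (int p + int q). \<lambda>fs\<in>tuples (sources \<aa> \<sigma>).
     gcmp \<aa> (path (base \<aa>) (seg 0 p \<sigma>)) (path (base \<aa>) (seg p (p + q) \<sigma>))
       (vert \<sigma> (p + q)) (vert \<sigma> p) (vert \<sigma> 0)
       (\<phi> (seg 0 p \<sigma>) (take p fs)) (\<psi> (seg p (p + q) \<sigma>) (drop p fs)))"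

text \<open>
  The brace \<open>\<phi>{\<psi>\<^sub>1, \<dots>, \<psi>\<^sub>r}\<close> is the sum, over all ways to place the \<open>\<psi>\<^sub>j\<close> in this order on
  non-overlapping runs of consecutive arguments, of
  \<open>(-1)\<^sup>\<epsilon> \<phi>(\<dots>, \<psi>\<^sub>1(\<dots>), \<dots>, \<psi>\<^sub>r(\<dots>), \<dots>)\<close>, where \<open>\<epsilon>\<close> is the sum of the \<open>(deg \<psi>\<^sub>j - 1) i\<^sub>j\<close>
  and \<open>i\<^sub>j\<close> is the number of all arguments in front of \<open>\<psi>\<^sub>j\<close>.
  The insertions are carried out starting with the last one, which leaves the positions of the
  others unchanged.
\<close>

definition placements :: "nat list \<Rightarrow> nat \<Rightarrow> nat list set" where
  "placements qs N = {ps. length ps = length qs \<and>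
     (\<forall>j<length qs. ps ! j + qs ! j \<le> (if Suc j < length qs then ps ! Suc j else N))}"

definition plug :: "('k, 'o, 'm, 'a, 'x) mgcat \<Rightarrow> (nat \<times> ('o, 'm, 'a, 'x) cochain) \<times> nat \<Rightarrow>
    ('o, 'm, 'a) simplex \<times> 'x list \<Rightarrow> ('o, 'm, 'a) simplex \<times> 'x list" where
  "plug \<aa> = (\<lambda>((q, \<psi>), i) (\<sigma>, fs).
     (contract (base \<aa>) i (i + q) \<sigma>,
      splice i (i + q) (\<psi> (seg i (i + q) \<sigma>) (take q (drop i fs))) fs))"

definition hbrace :: "('k, 'o, 'm, 'a, 'x) mgcat \<Rightarrow> nat \<Rightarrow> ('o, 'm, 'a, 'x) cochain \<Rightarrow>
    (nat \<times> ('o, 'm, 'a, 'x) cochain) list \<Rightarrow> ('o, 'm, 'a, 'x) cochain" where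
  "hbrace \<aa> p \<phi> \<psi>s =
    (\<lambda>\<sigma>\<in>simplices \<aa> (int p + (\<Sum>(q, \<psi>)\<leftarrow>\<psi>s. int q - 1)). \<lambda>fs\<in>tuples (sources \<aa> \<sigma>).
      \<Oplus>\<^bsub>target \<aa> \<sigma>\<^esub>ps\<in>placements (map fst \<psi>s) (length fs).
        signed (target \<aa> \<sigma>) (\<Sum>((q, \<psi>), i)\<leftarrow>zip \<psi>s ps. (int q - 1) * int i)
          (case foldr (plug \<aa>) (zip \<psi>s ps) (\<sigma>, fs) of (\<sigma>', fs') \<Rightarrow> \<phi> \<sigma>' fs'))"

text \<open>
  The \<open>B\<^sub>\<infinity>\<close>-structure.  On the shifted complex \<open>b\<^sub>1\<close> and \<open>b\<^sub>2\<close> are the Hochschild differential and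
  the cup product up to the usual signs (they are chosen such that \<open>b\<^sub>2(\<phi>, \<psi>) = \<mu>{\<phi>, \<psi>}\<close> and
  \<open>b\<^sub>1(\<phi>) = \<mu>{\<phi>} \<plusminus> \<phi>{\<mu>}\<close> for the 2-cochain \<open>\<mu>\<close> given by the composition), \<open>m\<^sub>1\<^sub>,\<^sub>q\<close> is the brace
  operation, \<open>m\<^sub>0\<^sub>,\<^sub>1\<close> is the identity and all other components vanish.
\<close>

definition hoch :: "'k ring \<Rightarrow> ('k, 'o, 'm, 'a, 'x) mgcat \<Rightarrow> ('k, ('o, 'm, 'a, 'x) cochain) binf" where
  "hoch R \<aa> =
    \<lparr>grd = cochains R \<aa>,
     bop = (\<lambda>w. if \<exists>(n, \<phi>)\<in>set w. n < 0 then \<zero>\<^bsub>cochains R \<aa> (bdeg w)\<^esub> else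
       (case w of
          [(p, \<phi>)] \<Rightarrow> signed (cochains R \<aa> (p + 1)) (p - 1) (hdiff \<aa> (nat p) \<phi>)
        | [(p, \<phi>), (q, \<psi>)] \<Rightarrow>
            signed (cochains R \<aa> (p + q)) (p * (q - 1)) (hcup \<aa> (nat p) \<phi> (nat q) \<psi>)
        | _ \<Rightarrow> \<zero>\<^bsub>cochains R \<aa> (bdeg w)\<^esub>)),
     mop = (\<lambda>v w. if \<exists>(n, \<phi>)\<in>set (v @ w). n < 0 then \<zero>\<^bsub>cochains R \<aa> (mdeg v w)\<^esub> else
       (case v of
          [] \<Rightarrow> (case w of [(q, \<psi>)] \<Rightarrow> \<psi> | _ \<Rightarrow> \<zero>\<^bsub>cochains R \<aa> (mdeg v w)\<^esub>)
        | [(p, \<phi>)] \<Rightarrow> hbrace \<aa> (nat p) \<phi> (map (\<lambda>(q, \<psi>). (nat q, \<psi>)) w)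
        | _ \<Rightarrow> \<zero>\<^bsub>cochains R \<aa> (mdeg v w)\<^esub>))\<rparr>"

text \<open>\<open>hpull \<bb> F\<close> is \<open>F\<^sup>*\<close> for a cartesian functor \<open>F\<close> with domain \<open>\<bb>\<close>.\<close>

definition map_simplex :: "('o, 'm, 'a, 'x, 'o', 'm', 'a', 'x') gfun \<Rightarrow>
    ('o, 'm, 'a) simplex \<Rightarrow> ('o', 'm', 'a') simplex" where
  "map_simplex F = (\<lambda>(Us, us, As). (map (fob F) Us, map (farr F) us, map2 (fobj F) Us As))"

definition map_args :: "('o, 'm, 'a, 'x, 'o', 'm', 'a', 'x') gfun \<Rightarrow>
    ('o, 'm, 'a) simplex \<Rightarrow> 'x list \<Rightarrow> 'x' list" where
  "map_args F \<sigma> fs =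
     map (\<lambda>i. fmor F (edge \<sigma> i) (vert \<sigma> (Suc i)) (vert \<sigma> i) (fs ! i)) [0..<length fs]"

definition hpull :: "('k, 'o, 'm, 'a, 'x) mgcat \<Rightarrow> ('o, 'm, 'a, 'x, 'o', 'm', 'a', 'x') gfun \<Rightarrow>
    int \<Rightarrow> ('o', 'm', 'a', 'x') cochain \<Rightarrow> ('o, 'm, 'a, 'x) cochain" where
  "hpull \<bb> F n \<phi> = (\<lambda>\<sigma>\<in>simplices \<bb> n. \<lambda>fs\<in>tuples (sources \<bb> \<sigma>).
     inv_into (carrier (target \<bb> \<sigma>))
       (case \<sigma> of (Vs, vs, Bs) \<Rightarrow> fmor F (path (base \<bb>) \<sigma>) (last Bs) (hd Bs))
       (\<phi> (map_simplex F \<sigma>) (map_args F \<sigma> fs)))"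


section \<open>The diagram of a cover\<close>

definition cover_res :: "'i set \<Rightarrow> ('i \<Rightarrow> ('k, 'o', 'm', 'a', 'x') mgcat) \<Rightarrow>
    ('i \<Rightarrow> ('o', 'm', 'a', 'x', 'o, 'm, 'a, 'x) gfun) \<Rightarrow>
    int \<Rightarrow> ('o, 'm, 'a, 'x) cochain \<Rightarrow> 'i \<Rightarrow> ('o', 'm', 'a', 'x') cochain" where
  "cover_res I \<bb> F n \<phi> = (\<lambda>i\<in>I. hpull (\<bb> i) (F i) n \<phi>)"

definition overlap :: "('i \<Rightarrow> ('k, 'o', 'm', 'a', 'x') mgcat) \<Rightarrow>
    ('i \<Rightarrow> ('o', 'm', 'a', 'x', 'o, 'm, 'a, 'x) gfun) \<Rightarrow> 'i \<times> 'i \<Rightarrow>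
    ('k, 'o' \<times> 'o', 'm' \<times> 'm', 'a' \<times> 'a', 'x' \<times> 'x') mgcat" where
  "overlap \<bb> F = (\<lambda>(i, j). pullback (\<bb> i) (F i) (\<bb> j) (F j))"

definition overlap_res1 :: "'i set \<Rightarrow> ('i \<Rightarrow> ('k, 'o', 'm', 'a', 'x') mgcat) \<Rightarrow>
    ('i \<Rightarrow> ('o', 'm', 'a', 'x', 'o, 'm, 'a, 'x) gfun) \<Rightarrow> int \<Rightarrow>
    ('i \<Rightarrow> ('o', 'm', 'a', 'x') cochain) \<Rightarrow>
    'i \<times> 'i \<Rightarrow> ('o' \<times> 'o', 'm' \<times> 'm', 'a' \<times> 'a', 'x' \<times> 'x') cochain" where
  "overlap_res1 I \<bb> F n \<phi> = (\<lambda>(i, j)\<in>I \<times> I. hpull (overlap \<bb> F (i, j)) proj1 n (\<phi> i))"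

definition overlap_res2 :: "'i set \<Rightarrow> ('i \<Rightarrow> ('k, 'o', 'm', 'a', 'x') mgcat) \<Rightarrow>
    ('i \<Rightarrow> ('o', 'm', 'a', 'x', 'o, 'm, 'a, 'x) gfun) \<Rightarrow> int \<Rightarrow>
    ('i \<Rightarrow> ('o', 'm', 'a', 'x') cochain) \<Rightarrow>
    'i \<times> 'i \<Rightarrow> ('o' \<times> 'o', 'm' \<times> 'm', 'a' \<times> 'a', 'x' \<times> 'x') cochain" where
  "overlap_res2 I \<bb> F n \<phi> = (\<lambda>(i, j)\<in>I \<times> I. hpull (overlap \<bb> F (i, j)) proj2 n (\<phi> j))"

end

theory Submission
  imports Defs
begin

text \<open>
  A Hochschild cochain is a family of multilinear maps, indexed by the simplices of a map-graded
  category, without any condition relating different members of the family.  A cartesian functor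
  \<open>F\<close> identifies the modules at a simplex with those at its image.  Restriction along \<open>F\<close> therefore
  only re-indexes a family along the map of simplices: \<open>F\<^sup>*\<phi>\<close> is the unique cochain whose values
  correspond to those of \<open>\<phi>\<close> on the image simplices (\<open>hpull_apply\<close>, \<open>hpull_eqI\<close>).

  Let now an \<open>\<infinity>\<close>-cover be given.  The cover condition lifts the chain of arrows of a simplex, and
  bijectivity on the fibres lifts its objects, so that every simplex of the base is the image of a
  simplex of some member of the cover (\<open>lift_simplex\<close>).  A cochain is thus determined by its
  restrictions (\<open>restrictions_injective\<close>).  Conversely, a family of cochains on the members
  prescribes a value for each lift of a simplex.  Two lifts of the same simplex form a simplex of
  the pullback (\<open>pair_simplex\<close>), and equality of the two restrictions to the pullback says exactly
  that the two values coincide (\<open>compatible_values\<close>).  A compatible family therefore glues, and the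
  result is multilinear at each simplex because it is transported from a single lift
  (\<open>glue_closed\<close>).  So the diagram is an equalizer of graded modules (\<open>cover_res_bij\<close>).

  For an equalizer of \<open>B\<^sub>\<infinity>\<close>-algebras it remains to see that restriction strictly preserves the
  operations (\<open>hpull_binf_hom\<close>): a homomorphism which equalizes the two arrows then lifts to a map
  of graded modules, and the lift respects the operations since its composite with an injective
  homomorphism does (\<open>binf_equalizerI\<close>).  The differential, the cup product and the braces are all
  built from the insertion of one multilinear map into another, which corresponds to the
  contraction of a part of a simplex.  Insertion preserves multilinearity (\<open>multilinear_splice\<close>),
  so the operations produce cochains, and functors commute with taking parts of simplices,
  contracting them and composing along them.  All of this applies to the projections of a
  pullback, because cartesian functors are stable under base change (\<open>proj1_cartesian\<close>,
  \<open>proj2_cartesian\<close>).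
\<close>

section \<open>Multilinear maps\<close>

lemma mod_homI:
  assumes "\<And>x. x \<in> carrier M \<Longrightarrow> f x \<in> carrier N"
    and "\<And>x y. \<lbrakk>x \<in> carrier M; y \<in> carrier M\<rbrakk> \<Longrightarrow> f (x \<oplus>\<^bsub>M\<^esub> y) = f x \<oplus>\<^bsub>N\<^esub> f y"
    and "\<And>c x. \<lbrakk>c \<in> carrier R; x \<in> carrier M\<rbrakk> \<Longrightarrow> f (c \<odot>\<^bsub>M\<^esub> x) = c \<odot>\<^bsub>N\<^esub> f x"
  shows "mod_hom R M N f"
  using assms by (auto simp: mod_hom_def)

lemma
  assumes "mod_hom R M N f"
  shows mod_hom_closed: "x \<in> carrier M \<Longrightarrow> f x \<in> carrier N"
    and mod_hom_add: "\<lbrakk>x \<in> carrier M; y \<in> carrier M\<rbrakk> \<Longrightarrow> f (x \<oplus>\<^bsub>M\<^esub> y) = f x \<oplus>\<^bsub>N\<^esub> f y"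
    and mod_hom_smult: "\<lbrakk>c \<in> carrier R; x \<in> carrier M\<rbrakk> \<Longrightarrow> f (c \<odot>\<^bsub>M\<^esub> x) = c \<odot>\<^bsub>N\<^esub> f x"
  using assms by (auto simp: mod_hom_def)

lemma mod_hom_id: "mod_hom R M M (\<lambda>x. x)"
  by (simp add: mod_hom_def)

lemma mod_hom_comp:
  assumes "mod_hom R M N f" "mod_hom R N P g"
  shows "mod_hom R M P (\<lambda>x. g (f x))"
  using assms by (auto simp: mod_hom_def Pi_iff)

lemma mod_hom_zero:
  assumes "mod_hom R M N f" "abelian_group M" "abelian_group N"
  shows "f \<zero>\<^bsub>M\<^esub> = \<zero>\<^bsub>N\<^esub>"
proof -
  interpret M: abelian_group M by fact
  interpret N: abelian_group N by fact
  have "f \<zero>\<^bsub>M\<^esub> \<oplus>\<^bsub>N\<^esub> f \<zero>\<^bsub>M\<^esub> = f \<zero>\<^bsub>M\<^esub>"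
    using mod_hom_add[OF assms(1), of "\<zero>\<^bsub>M\<^esub>" "\<zero>\<^bsub>M\<^esub>"] by simp
  then show ?thesis
    using mod_hom_closed[OF assms(1) M.zero_closed] N.add.r_cancel_one' by metis
qed

lemma mod_hom_minus:
  assumes "mod_hom R M N f" "abelian_group M" "abelian_group N" "x \<in> carrier M"
  shows "f (\<ominus>\<^bsub>M\<^esub> x) = \<ominus>\<^bsub>N\<^esub> f x"
proof -
  interpret M: abelian_group M by fact
  interpret N: abelian_group N by fact
  have "f (\<ominus>\<^bsub>M\<^esub> x) \<oplus>\<^bsub>N\<^esub> f x = \<zero>\<^bsub>N\<^esub>"
    using mod_hom_add[OF assms(1), of "\<ominus>\<^bsub>M\<^esub> x" x] assms(4) mod_hom_zero[OF assms(1-3)]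
    by (simp add: M.l_neg)
  then show ?thesis
    using mod_hom_closed[OF assms(1)] assms(4) N.minus_equality M.a_inv_closed by metis
qed

lemma mod_hom_signed:
  assumes "mod_hom R M N f" "abelian_group M" "abelian_group N" "x \<in> carrier M"
  shows "f (signed M e x) = signed N e (f x)"
  using mod_hom_minus[OF assms] by (simp add: signed_def)

lemma signed_closed: "\<lbrakk>abelian_group M; x \<in> carrier M\<rbrakk> \<Longrightarrow> signed M e x \<in> carrier M"
  by (simp add: signed_def abelian_group.a_inv_closed)

lemma mod_hom_finsum:
  assumes "mod_hom R M N f" "abelian_group M" "abelian_group N" "g \<in> A \<rightarrow> carrier M"
  shows "f (finsum M g A) = finsum N (\<lambda>a. f (g a)) A"
proof -
  interpret M: abelian_group M by fact
  interpret N: abelian_group N by fact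
  show ?thesis
    using assms(4)
  proof (induction A rule: infinite_finite_induct)
    case (infinite A)
    then show ?case using mod_hom_zero[OF assms(1-3)] by (simp add: finsum_def finprod_def)
  next
    case empty
    then show ?case using mod_hom_zero[OF assms(1-3)] by simp
  next
    case (insert a A)
    have "f (finsum M g (insert a A)) = f (g a \<oplus>\<^bsub>M\<^esub> finsum M g A)"
      using insert by (subst M.finsum_insert) auto
    also have "\<dots> = f (g a) \<oplus>\<^bsub>N\<^esub> f (finsum M g A)"
      using insert by (intro mod_hom_add[OF assms(1)] M.finsum_closed) auto
    also have "\<dots> = f (g a) \<oplus>\<^bsub>N\<^esub> finsum N (\<lambda>a. f (g a)) A"
      using insert by auto
    also have "\<dots> = finsum N (\<lambda>a. f (g a)) (insert a A)"
      using insert mod_hom_closed[OF assms(1)] by (subst N.finsum_insert) (auto simp: Pi_iff)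
    finally show ?case .
  qed
qed

context
  fixes R :: "'k ring" and M :: "('k, 'x) module"
  assumes M: "module R M"
begin

interpretation module R M
  by (rule M)

lemma mod_hom_const_zero: "mod_hom R P M (\<lambda>x. \<zero>\<^bsub>M\<^esub>)"
  by (rule mod_homI) auto

lemma mod_hom_plus:
  assumes "mod_hom R P M f" "mod_hom R P M g"
  shows "mod_hom R P M (\<lambda>x. f x \<oplus>\<^bsub>M\<^esub> g x)"
  using assms
  by (intro mod_homI)
    (simp_all add: mod_hom_closed mod_hom_add mod_hom_smult smult_r_distr M.a_ac)

lemma mod_hom_signed_right:
  assumes "mod_hom R P M f"
  shows "mod_hom R P M (\<lambda>x. signed M e (f x))"
  using assms
  by (intro mod_homI)
    (simp_all add: signed_def mod_hom_closed mod_hom_add mod_hom_smult M.minus_add smult_r_minus)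

lemma mod_hom_smult_right:
  assumes "mod_hom R P M f" "c \<in> carrier R"
  shows "mod_hom R P M (\<lambda>x. c \<odot>\<^bsub>M\<^esub> f x)"
  using assms
  by (intro mod_homI)
    (auto simp add: mod_hom_closed mod_hom_add mod_hom_smult smult_r_distr R.m_comm
      simp flip: smult_assoc1)

lemma mod_hom_finsum_right:
  assumes f: "\<And>a. a \<in> A \<Longrightarrow> mod_hom R P M (f a)"
  shows "mod_hom R P M (\<lambda>x. finsum M (\<lambda>a. f a x) A)"
proof (cases "finite A")
  case False
  then show ?thesis using mod_hom_const_zero by (simp add: M.finsum_infinite)
next
  case fin: True
  have cl: "(\<lambda>a. f a x) \<in> A \<rightarrow> carrier M" if "x \<in> carrier P" for x
    using that f by (auto intro: mod_hom_closed)
  show ?thesis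
  proof (rule mod_homI)
    fix x y assume xy: "x \<in> carrier P" "y \<in> carrier P"
    have "finsum M (\<lambda>a. f a (x \<oplus>\<^bsub>P\<^esub> y)) A = finsum M (\<lambda>a. f a x \<oplus>\<^bsub>M\<^esub> f a y) A"
      using cl[OF xy(1)] cl[OF xy(2)] mod_hom_add[OF f] xy by (intro M.finsum_cong') auto
    then show "finsum M (\<lambda>a. f a (x \<oplus>\<^bsub>P\<^esub> y)) A = finsum M (\<lambda>a. f a x) A \<oplus>\<^bsub>M\<^esub> finsum M (\<lambda>a. f a y) A"
      using cl[OF xy(1)] cl[OF xy(2)] by (simp add: M.finsum_addf)
  next
    fix c x assume c: "c \<in> carrier R" and x: "x \<in> carrier P"
    have "finsum M (\<lambda>a. f a (c \<odot>\<^bsub>P\<^esub> x)) A = finsum M (\<lambda>a. c \<odot>\<^bsub>M\<^esub> f a x) A"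
      using cl[OF x] mod_hom_smult[OF f] c x by (intro M.finsum_cong') auto
    then show "finsum M (\<lambda>a. f a (c \<odot>\<^bsub>P\<^esub> x)) A = c \<odot>\<^bsub>M\<^esub> finsum M (\<lambda>a. f a x) A"
      using cl[OF x] c fin by (simp add: finsum_smult_ldistr)
  qed (use cl in \<open>auto intro: M.finsum_closed\<close>)
qed

end

subsection \<open>Tuples\<close>

lemma tuples_length: "xs \<in> tuples Ms \<Longrightarrow> length xs = length Ms"
  by (auto simp: tuples_def dest: list_all2_lengthD)

lemma tuples_nth: "\<lbrakk>xs \<in> tuples Ms; i < length Ms\<rbrakk> \<Longrightarrow> xs ! i \<in> carrier (Ms ! i)"
  by (auto simp: tuples_def list_all2_conv_all_nth)

lemma tuplesI:
  "\<lbrakk>length xs = length Ms; \<And>i. i < length Ms \<Longrightarrow> xs ! i \<in> carrier (Ms ! i)\<rbrakk> \<Longrightarrow> xs \<in> tuples Ms"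
  by (auto simp: tuples_def list_all2_conv_all_nth)

lemma tuples_update:
  "\<lbrakk>xs \<in> tuples Ms; i < length Ms; x \<in> carrier (Ms ! i)\<rbrakk> \<Longrightarrow> xs[i := x] \<in> tuples Ms"
  by (auto simp: tuples_def list_all2_conv_all_nth nth_list_update)

lemma tuples_take: "xs \<in> tuples Ms \<Longrightarrow> take n xs \<in> tuples (take n Ms)"
  by (simp add: tuples_def)

lemma tuples_drop: "xs \<in> tuples Ms \<Longrightarrow> drop n xs \<in> tuples (drop n Ms)"
  by (simp add: tuples_def)

lemma tuples_splice:
  "\<lbrakk>xs \<in> tuples Ms; x \<in> carrier M\<rbrakk> \<Longrightarrow> splice i j x xs \<in> tuples (splice i j M Ms)"
  by (auto simp: tuples_def splice_def intro!: list_all2_appendI)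

subsection \<open>Closure properties of multilinear maps\<close>

lemma multilinear_closed: "\<lbrakk>multilinear R Ms N f; xs \<in> tuples Ms\<rbrakk> \<Longrightarrow> f xs \<in> carrier N"
  by (auto simp: multilinear_def)

lemma multilinear_mod_hom:
  "\<lbrakk>multilinear R Ms N f; xs \<in> tuples Ms; i < length Ms\<rbrakk> \<Longrightarrow> mod_hom R (Ms ! i) N (\<lambda>x. f (xs[i := x]))"
  by (auto simp: multilinear_def)

lemma multilinearI:
  assumes "\<And>xs. xs \<in> tuples Ms \<Longrightarrow> f xs \<in> carrier N"
    and "\<And>xs i. \<lbrakk>xs \<in> tuples Ms; i < length Ms\<rbrakk> \<Longrightarrow> mod_hom R (Ms ! i) N (\<lambda>x. f (xs[i := x]))"
  shows "multilinear R Ms N f"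
  using assms by (auto simp: multilinear_def)

text \<open>
  Linearity in one argument is tested on sums and multiples, so that the source modules must be
  closed under these operations.
\<close>

lemma multilinear_cong:
  assumes "\<And>M. M \<in> set Ms \<Longrightarrow> module R M" and "\<And>xs. xs \<in> tuples Ms \<Longrightarrow> f xs = g xs"
    and "multilinear R Ms N f"
  shows "multilinear R Ms N g"
proof (rule multilinearI)
  fix xs i assume xs: "xs \<in> tuples Ms" and i: "i < length Ms"
  interpret module R "Ms ! i" using assms(1) i by auto
  have eq: "g (xs[i := x]) = f (xs[i := x])" if "x \<in> carrier (Ms ! i)" for x
    using tuples_update[OF xs i that] assms(2) by simp
  note h = multilinear_mod_hom[OF assms(3) xs i]
  show "mod_hom R (Ms ! i) N (\<lambda>x. g (xs[i := x]))"
    using mod_hom_closed[OF h] mod_hom_add[OF h] mod_hom_smult[OF h]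
    by (intro mod_homI) (simp_all add: eq)
qed (use assms multilinear_closed in fastforce)

text \<open>
  Composition in an operad: plugging the output of a multilinear map into one argument of another
  one.  All operations on the Hochschild complex are iterated insertions, so that this lemma
  carries the multilinearity of all of them.
\<close>

lemma multilinear_splice:
  assumes ij: "i \<le> j" "j \<le> length Ms"
    and f: "multilinear R (splice i j M Ms) N f"
    and g: "multilinear R (take (j - i) (drop i Ms)) M g"
  shows "multilinear R Ms N (\<lambda>xs. f (splice i j (g (take (j - i) (drop i xs))) xs))"
proof (rule multilinearI)
  fix xs assume "xs \<in> tuples Ms"
  then show "f (splice i j (g (take (j - i) (drop i xs))) xs) \<in> carrier N"
    by (intro multilinear_closed[OF f] tuples_splice multilinear_closed[OF g] tuples_take tuples_drop)
next
  fix xs k assume xs: "xs \<in> tuples Ms" and k: "k < length Ms"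
  let ?y = "g (take (j - i) (drop i xs))"
  have len: "length xs = length Ms" using xs by (rule tuples_length)
  have y: "?y \<in> carrier M"
    using xs by (intro multilinear_closed[OF g] tuples_take tuples_drop)
  then have sp: "splice i j ?y xs \<in> tuples (splice i j M Ms)"
    using xs by (rule tuples_splice[rotated])
  \<comment> \<open>The argument which varies lies in front of, among, or behind those of the inserted map.\<close>
  consider "k < i" | "i \<le> k" "k < j" | "j \<le> k" by linarith
  then show "mod_hom R (Ms ! k) N (\<lambda>x. f (splice i j (g (take (j - i) (drop i (xs[k := x])))) (xs[k := x])))"
  proof cases
    case 1
    have "mod_hom R (splice i j M Ms ! k) N (\<lambda>x. f ((splice i j ?y xs)[k := x]))"
      using 1 ij by (intro multilinear_mod_hom[OF f sp]) (simp add: splice_def)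
    then show ?thesis
      using 1 ij len by (simp add: splice_def nth_append list_update_append take_update_swap)
  next
    case 2
    have "mod_hom R (take (j - i) (drop i Ms) ! (k - i)) M (\<lambda>x. g ((take (j - i) (drop i xs))[k - i := x]))"
      using 2 ij xs by (intro multilinear_mod_hom[OF g] tuples_take tuples_drop) auto
    moreover have "mod_hom R (splice i j M Ms ! i) N (\<lambda>x. f ((splice i j ?y xs)[i := x]))"
      using 2 ij by (intro multilinear_mod_hom[OF f sp]) (simp add: splice_def)
    moreover have "splice i j M Ms ! i = M" "take (j - i) (drop i Ms) ! (k - i) = Ms ! k"
      using 2 ij by (simp_all add: splice_def nth_append)
    ultimately have g': "mod_hom R (Ms ! k) M (\<lambda>x. g ((take (j - i) (drop i xs))[k - i := x]))"
      and f': "mod_hom R M N (\<lambda>x. f ((splice i j ?y xs)[i := x]))"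
      by simp_all
    note mod_hom_comp[OF g' f']
    moreover have "(splice i j ?y xs)[i := y] = splice i j y xs" for y
      using ij len by (simp add: splice_def list_update_append)
    moreover have "take (j - i) (drop i (xs[k := x])) = (take (j - i) (drop i xs))[k - i := x]" for x
      using 2 by (simp only: drop_update_swap take_update_swap)
    moreover have "splice i j y (xs[k := x]) = splice i j y xs" for x y
      using 2 by (simp add: splice_def)
    ultimately show ?thesis by simp
  next
    case 3
    have "mod_hom R (splice i j M Ms ! (k - (j - i) + 1)) N (\<lambda>x. f ((splice i j ?y xs)[k - (j - i) + 1 := x]))"
      using 3 ij k by (intro multilinear_mod_hom[OF f sp]) (simp add: splice_def)
    moreover have "splice i j M Ms ! (k - (j - i) + 1) = Ms ! k"
      using 3 ij k by (simp add: splice_def nth_append nth_Cons Suc_diff_le split: nat.split)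
    moreover have "take (j - i) (drop i (xs[k := x])) = take (j - i) (drop i xs)" for x
      using 3 ij by (simp add: drop_update_swap take_update_cancel)
    moreover have "(splice i j ?y xs)[k - (j - i) + 1 := x] = splice i j ?y (xs[k := x])" for x
    proof -
      obtain l where l: "k = j + l" using 3 le_Suc_ex by blast
      have pos: "k - (j - i) + 1 = i + Suc l" using ij l by linarith
      show ?thesis
        unfolding pos using l ij k len
        by (simp add: splice_def list_update_append drop_update_swap take_update_cancel)
    qed
    ultimately show ?thesis by simp
  qed
qed

context
  fixes R :: "'k ring" and M :: "('k, 'x) module"
  assumes M: "module R M"
begin

interpretation module R M
  by (rule M)

lemma multilinear_const_zero: "multilinear R Ms M (\<lambda>xs. \<zero>\<^bsub>M\<^esub>)"
  by (rule multilinearI) (auto intro: mod_hom_const_zero[OF M])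

lemma multilinear_plus:
  assumes "multilinear R Ms M f" "multilinear R Ms M g"
  shows "multilinear R Ms M (\<lambda>xs. f xs \<oplus>\<^bsub>M\<^esub> g xs)"
  using assms by (intro multilinearI) (auto intro: mod_hom_plus[OF M] multilinear_mod_hom multilinear_closed)

lemma multilinear_signed:
  assumes "multilinear R Ms M f"
  shows "multilinear R Ms M (\<lambda>xs. signed M e (f xs))"
  using assms
  by (intro multilinearI)
    (auto intro: mod_hom_signed_right[OF M] multilinear_mod_hom multilinear_closed signed_closed M.abelian_group_axioms)

lemma multilinear_smult:
  assumes "multilinear R Ms M f" "c \<in> carrier R"
  shows "multilinear R Ms M (\<lambda>xs. c \<odot>\<^bsub>M\<^esub> f xs)"
  using assms
  by (intro multilinearI) (auto intro: mod_hom_smult_right[OF M] multilinear_mod_hom multilinear_closed)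

lemma multilinear_finsum:
  assumes "\<And>a. a \<in> A \<Longrightarrow> multilinear R Ms M (f a)"
  shows "multilinear R Ms M (\<lambda>xs. finsum M (\<lambda>a. f a xs) A)"
  using assms
  by (intro multilinearI)
    (auto intro!: mod_hom_finsum_right[OF M] M.finsum_closed intro: multilinear_mod_hom multilinear_closed)

end

lemma multilinear_pair:
  assumes "\<And>y. y \<in> carrier M2 \<Longrightarrow> mod_hom R M1 N (\<lambda>x. f x y)"
    and "\<And>x. x \<in> carrier M1 \<Longrightarrow> mod_hom R M2 N (f x)"
  shows "multilinear R [M1, M2] N (\<lambda>xs. f (xs ! 0) (xs ! 1))"
proof (rule multilinearI)
  fix xs i assume xs: "xs \<in> tuples [M1, M2]" and i: "i < length [M1, M2]"
  obtain x y where [simp]: "xs = [x, y]" and "x \<in> carrier M1" "y \<in> carrier M2"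
    using xs by (auto simp: tuples_def list_all2_Cons2)
  then show "mod_hom R ([M1, M2] ! i) N (\<lambda>z. f (xs[i := z] ! 0) (xs[i := z] ! 1))"
    using i assms by (auto simp: less_Suc_eq)
qed (use mod_hom_closed[OF assms(2)] in \<open>auto simp: tuples_def list_all2_Cons2\<close>)

subsection \<open>Transport along isomorphisms\<close>

definition apply_each :: "('x \<Rightarrow> 'y) list \<Rightarrow> 'x list \<Rightarrow> 'y list" where
  "apply_each \<theta>s xs = map2 (\<lambda>\<theta> x. \<theta> x) \<theta>s xs"

definition mod_isos :: "'k ring \<Rightarrow> ('k, 'x) module list \<Rightarrow> ('k, 'y) module list \<Rightarrow> ('x \<Rightarrow> 'y) list \<Rightarrow> bool" where
  "mod_isos R Ms Ns \<theta>s \<longleftrightarrow> length Ns = length Ms \<and> length \<theta>s = length Ms \<and>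
     (\<forall>i<length Ms. mod_hom R (Ms ! i) (Ns ! i) (\<theta>s ! i) \<and>
        bij_betw (\<theta>s ! i) (carrier (Ms ! i)) (carrier (Ns ! i)))"

lemma apply_each_update:
  assumes "length \<theta>s = length xs" "i < length xs"
  shows "apply_each \<theta>s (xs[i := x]) = (apply_each \<theta>s xs)[i := (\<theta>s ! i) x]"
  using assms by (intro nth_equalityI) (auto simp: apply_each_def nth_list_update)

lemma apply_each_tuples:
  assumes "mod_isos R Ms Ns \<theta>s" "xs \<in> tuples Ms"
  shows "apply_each \<theta>s xs \<in> tuples Ns"
proof (rule tuplesI)
  fix i assume "i < length Ns"
  then have i: "i < length Ms" using assms(1) by (simp add: mod_isos_def)
  then have "mod_hom R (Ms ! i) (Ns ! i) (\<theta>s ! i)" using assms(1) by (simp add: mod_isos_def)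
  from mod_hom_closed[OF this tuples_nth[OF assms(2) i]]
  show "apply_each \<theta>s xs ! i \<in> carrier (Ns ! i)"
    using i assms tuples_length[OF assms(2)] by (simp add: apply_each_def mod_isos_def)
qed (use assms tuples_length[OF assms(2)] in \<open>simp add: apply_each_def mod_isos_def\<close>)

lemma bij_betw_apply_each:
  assumes "mod_isos R Ms Ns \<theta>s"
  shows "bij_betw (apply_each \<theta>s) (tuples Ms) (tuples Ns)"
  unfolding bij_betw_def
proof
  show "inj_on (apply_each \<theta>s) (tuples Ms)"
  proof (rule inj_onI)
    fix xs ys assume xs: "xs \<in> tuples Ms" and ys: "ys \<in> tuples Ms" and eq: "apply_each \<theta>s xs = apply_each \<theta>s ys"
    show "xs = ys"
    proof (rule nth_equalityI)
      fix i assume "i < length xs"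
      then have i: "i < length Ms" using tuples_length[OF xs] by simp
      have "(\<theta>s ! i) (xs ! i) = (\<theta>s ! i) (ys ! i)"
        using arg_cong[OF eq, of "\<lambda>zs. zs ! i"] i assms tuples_length[OF xs] tuples_length[OF ys]
        by (simp add: apply_each_def mod_isos_def)
      then show "xs ! i = ys ! i"
        using assms i tuples_nth[OF xs i] tuples_nth[OF ys i]
        by (auto simp: mod_isos_def bij_betw_def inj_on_def)
    qed (use tuples_length[OF xs] tuples_length[OF ys] in simp)
  qed
  show "apply_each \<theta>s ` tuples Ms = tuples Ns"
  proof (intro equalityI subsetI)
    fix ys assume ys: "ys \<in> tuples Ns"
    then have len: "length ys = length Ms" using assms by (auto simp: mod_isos_def dest: tuples_length)
    have "\<exists>x \<in> carrier (Ms ! i). (\<theta>s ! i) x = ys ! i" if i: "i < length Ms" for i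
    proof -
      have "ys ! i \<in> (\<theta>s ! i) ` carrier (Ms ! i)"
        using tuples_nth[OF ys, of i] i assms by (simp add: mod_isos_def bij_betw_def)
      then show ?thesis by auto
    qed
    then obtain x where x: "\<And>i. i < length Ms \<Longrightarrow> x i \<in> carrier (Ms ! i) \<and> (\<theta>s ! i) (x i) = ys ! i"
      by metis
    let ?xs = "map x [0..<length Ms]"
    have "?xs \<in> tuples Ms" using x by (auto intro: tuplesI)
    moreover have "apply_each \<theta>s ?xs = ys"
      using x len assms unfolding apply_each_def mod_isos_def by (intro nth_equalityI) simp_all
    ultimately show "ys \<in> apply_each \<theta>s ` tuples Ms" by blast
  qed (use apply_each_tuples[OF assms] in auto)
qed

text \<open>
  Multilinearity passes along isomorphisms of the source modules in both directions: backwards for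
  the restriction of a cochain, forwards for a cochain obtained by gluing.
\<close>

lemma multilinear_pull:
  assumes iso: "mod_isos R Ms Ns \<theta>s" and "\<And>M. M \<in> set Ms \<Longrightarrow> module R M"
    and N: "module R N" and \<eta>: "mod_hom R N N' \<eta>" "inj_on \<eta> (carrier N)"
    and f: "\<And>xs. xs \<in> tuples Ms \<Longrightarrow> f xs \<in> carrier N \<and> \<eta> (f xs) = g (apply_each \<theta>s xs)"
    and g: "multilinear R Ns N' g"
  shows "multilinear R Ms N f"
proof (rule multilinearI)
  fix xs i assume xs: "xs \<in> tuples Ms" and i: "i < length Ms"
  interpret N: module R N by fact
  interpret M: module R "Ms ! i" using assms(2) i by auto
  have \<theta>: "mod_hom R (Ms ! i) (Ns ! i) (\<theta>s ! i)" using iso i by (simp add: mod_isos_def)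
  have cl: "f (xs[i := x]) \<in> carrier N" if "x \<in> carrier (Ms ! i)" for x
    using f tuples_update[OF xs i that] by simp
  have gf: "\<eta> (f (xs[i := x])) = g ((apply_each \<theta>s xs)[i := (\<theta>s ! i) x])" if "x \<in> carrier (Ms ! i)" for x
    using f tuples_update[OF xs i that] iso i tuples_length[OF xs]
    by (simp add: apply_each_update mod_isos_def)
  have "mod_hom R (Ns ! i) N' (\<lambda>x. g ((apply_each \<theta>s xs)[i := x]))"
    using i iso by (intro multilinear_mod_hom[OF g] apply_each_tuples[OF iso xs]) (auto simp: mod_isos_def)
  note h = mod_hom_comp[OF \<theta> this]
  show "mod_hom R (Ms ! i) N (\<lambda>x. f (xs[i := x]))"
    by (intro mod_homI inj_onD[OF \<eta>(2)])
      (simp_all add: cl gf mod_hom_add[OF h] mod_hom_smult[OF h] mod_hom_add[OF \<eta>(1)] mod_hom_smult[OF \<eta>(1)])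
qed (use f in blast)

lemma multilinear_push:
  assumes iso: "mod_isos R Ms Ns \<theta>s" and "\<And>M. M \<in> set Ms \<Longrightarrow> module R M"
    and \<eta>: "mod_hom R N N' \<eta>"
    and g: "\<And>xs. xs \<in> tuples Ms \<Longrightarrow> g (apply_each \<theta>s xs) = \<eta> (f xs)"
    and f: "multilinear R Ms N f"
  shows "multilinear R Ns N' g"
proof (rule multilinearI)
  fix ys assume "ys \<in> tuples Ns"
  then obtain xs where "xs \<in> tuples Ms" "ys = apply_each \<theta>s xs"
    using bij_betw_apply_each[OF iso] by (auto simp: bij_betw_def)
  then show "g ys \<in> carrier N'"
    using g mod_hom_closed[OF \<eta>] multilinear_closed[OF f] by simp
next
  fix ys i assume ys: "ys \<in> tuples Ns" and "i < length Ns"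
  then have i: "i < length Ms" using iso by (simp add: mod_isos_def)
  obtain xs where xs: "xs \<in> tuples Ms" "ys = apply_each \<theta>s xs"
    using ys bij_betw_apply_each[OF iso] by (auto simp: bij_betw_def)
  interpret M: module R "Ms ! i" using assms(2) i by auto
  have \<theta>: "mod_hom R (Ms ! i) (Ns ! i) (\<theta>s ! i)" "(\<theta>s ! i) ` carrier (Ms ! i) = carrier (Ns ! i)"
    using iso i by (auto simp add: mod_isos_def bij_betw_def)
  have gf: "g (ys[i := (\<theta>s ! i) x]) = \<eta> (f (xs[i := x]))" if "x \<in> carrier (Ms ! i)" for x
    using g tuples_update[OF xs(1) i that] iso i tuples_length[OF xs(1)] xs(2)
    by (metis apply_each_update mod_isos_def)
  note h = mod_hom_comp[OF multilinear_mod_hom[OF f xs(1) i] \<eta>]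
  have ex: "\<exists>x \<in> carrier (Ms ! i). y = (\<theta>s ! i) x" if "y \<in> carrier (Ns ! i)" for y
    using \<theta>(2) that by blast
  show "mod_hom R (Ns ! i) N' (\<lambda>y. g (ys[i := y]))"
  proof (rule mod_homI)
    fix y assume "y \<in> carrier (Ns ! i)"
    with ex obtain x where "x \<in> carrier (Ms ! i)" "y = (\<theta>s ! i) x" by blast
    then show "g (ys[i := y]) \<in> carrier N'" using gf mod_hom_closed[OF h] by simp
  next
    fix y y' assume "y \<in> carrier (Ns ! i)" "y' \<in> carrier (Ns ! i)"
    with ex obtain x x' where "x \<in> carrier (Ms ! i)" "y = (\<theta>s ! i) x" "x' \<in> carrier (Ms ! i)" "y' = (\<theta>s ! i) x'"
      by metis
    then show "g (ys[i := y \<oplus>\<^bsub>Ns ! i\<^esub> y']) = g (ys[i := y]) \<oplus>\<^bsub>N'\<^esub> g (ys[i := y'])"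
      using gf mod_hom_add[OF h] by (simp flip: mod_hom_add[OF \<theta>(1)])
  next
    fix c y assume "c \<in> carrier R" "y \<in> carrier (Ns ! i)"
    moreover from ex this obtain x where "x \<in> carrier (Ms ! i)" "y = (\<theta>s ! i) x" by blast
    ultimately show "g (ys[i := c \<odot>\<^bsub>Ns ! i\<^esub> y]) = c \<odot>\<^bsub>N'\<^esub> g (ys[i := y])"
      using gf mod_hom_smult[OF h] by (simp flip: mod_hom_smult[OF \<theta>(1)])
  qed
qed

section \<open>Simplices, their faces and their composites\<close>

lemma nerve_iff:
  "(Us, us) \<in> nerve C m \<longleftrightarrow> length Us = Suc m \<and> length us = m \<and> (\<forall>i\<le>m. Us ! i \<in> Ob C) \<and>
     (\<forall>i<m. us ! i \<in> Arr C \<and> Dom C (us ! i) = Us ! Suc i \<and> Cod C (us ! i) = Us ! i)"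
  by (auto simp: nerve_def subset_code(1) all_set_conv_all_nth less_Suc_eq_le)

lemma nerve_Cons:
  assumes "(Us, u # us) \<in> nerve C m"
  obtains U Us' where "Us = U # Us'" "(Us', us) \<in> nerve C (m - 1)" "u \<in> Arr C"
    "Dom C u = hd Us'" "Cod C u = U"
proof -
  obtain U Us' where Us: "Us = U # Us'"
    using assms by (cases Us) (auto simp: nerve_def)
  have len: "length Us' = m" "length us = m - 1" "0 < m" "Us' \<noteq> []"
    and ob: "\<And>i. i \<le> m \<Longrightarrow> (U # Us') ! i \<in> Ob C"
    and ar: "\<And>i. i < m \<Longrightarrow> (u # us) ! i \<in> Arr C \<and> Dom C ((u # us) ! i) = (U # Us') ! Suc i \<and>
      Cod C ((u # us) ! i) = (U # Us') ! i"
    using assms by (auto simp: nerve_iff Us)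
  have "(Us', us) \<in> nerve C (m - 1)"
    unfolding nerve_iff
  proof (intro conjI allI impI)
    fix k assume "k \<le> m - 1"
    then show "Us' ! k \<in> Ob C" using ob[of "Suc k"] len by simp
  next
    fix k assume "k < m - 1"
    then show "us ! k \<in> Arr C" "Dom C (us ! k) = Us' ! Suc k" "Cod C (us ! k) = Us' ! k"
      using ar[of "Suc k"] len by simp_all
  qed (use len in simp_all)
  then show thesis
    using that Us ar[of 0] len by (simp add: hd_conv_nth)
qed

lemma nerve_seg:
  assumes "(Us, us) \<in> nerve C m" "i \<le> j" "j \<le> m"
  shows "(take (Suc (j - i)) (drop i Us), take (j - i) (drop i us)) \<in> nerve C (j - i)"
  using assms by (auto simp: nerve_iff)

text \<open>
  Associativity allows a tail of a chain of arrows to be replaced by its composite.  The behaviour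
  of paths under splitting and contraction follows from the last equation.
\<close>

lemma (in category) foldr_Comp:
  assumes "(Us, us) \<in> nerve C m" "w \<in> Arr C" "Cod C w = last Us"
  shows "foldr (Comp C) us w \<in> Arr C \<and> Dom C (foldr (Comp C) us w) = Dom C w \<and>
    Cod C (foldr (Comp C) us w) = hd Us \<and>
    foldr (Comp C) us w = Comp C (foldr (Comp C) us (Id C (last Us))) w"
  using assms
proof (induction us arbitrary: Us m w)
  case Nil
  then obtain U where "Us = [U]" by (auto simp: nerve_def length_Suc_conv)
  then show ?case using Nil comp_id by (auto simp: nerve_def)
next
  case (Cons u us)
  from Cons.prems(1) obtain U Us' where U: "Us = U # Us'" "(Us', us) \<in> nerve C (m - 1)"
    "u \<in> Arr C" "Dom C u = hd Us'" "Cod C u = U"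
    by (rule nerve_Cons)
  have ne: "Us' \<noteq> []" using U(2) by (auto simp: nerve_def)
  have "last Us' \<in> Ob C" using U(2) ne by (auto simp: nerve_def)
  note id = id_arr[OF this]
  have w: "Cod C w = last Us'" using Cons.prems U ne by simp
  note IH = Cons.IH[OF U(2) Cons.prems(2) w] and IH1 = Cons.IH[OF U(2), of "Id C (last Us')"]
  show ?case
    using IH IH1 U ne w id Cons.prems(2) comp_arr[of "foldr (Comp C) us w" u] comp_assoc
    by auto
qed

lemma (in category) path_arr:
  assumes "(Us, us) \<in> nerve C m"
  shows "path C (Us, us, As) \<in> Arr C" "Dom C (path C (Us, us, As)) = last Us"
    "Cod C (path C (Us, us, As)) = hd Us"
proof -
  have "last Us \<in> Ob C" using assms by (cases Us rule: rev_cases) (auto simp: nerve_def)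
  then show "path C (Us, us, As) \<in> Arr C" "Dom C (path C (Us, us, As)) = last Us"
    "Cod C (path C (Us, us, As)) = hd Us"
    using foldr_Comp[OF assms, of "Id C (last Us)"] id_arr by (auto simp: path_def)
qed

lemma last_seg: "\<lbrakk>i \<le> j; j < length Us\<rbrakk> \<Longrightarrow> last (take (Suc (j - i)) (drop i Us)) = Us ! j"
  by (simp add: last_conv_nth min_absorb1)

lemma hd_seg: "\<lbrakk>i \<le> j; j < length Us\<rbrakk> \<Longrightarrow> hd (take (Suc (j - i)) (drop i Us)) = Us ! i"
  by (simp add: hd_drop_conv_nth)

lemma (in category) foldr_Comp_seg:
  assumes Uu: "(Us, us) \<in> nerve C m" and ij: "i \<le> j" "j \<le> m" and w: "w \<in> Arr C" "Cod C w = Us ! j"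
  shows "foldr (Comp C) (take (j - i) (drop i us)) w = Comp C (path C (seg i j (Us, us, As))) w"
proof -
  have "last (take (Suc (j - i)) (drop i Us)) = Us ! j"
    using last_seg[of i j Us] assms by (simp add: nerve_iff)
  then show ?thesis
    using foldr_Comp[OF nerve_seg[OF Uu ij] w(1)] w(2) by (simp add: path_def seg_def)
qed

lemma (in category) path_contract:
  assumes Uu: "(Us, us) \<in> nerve C m" and ij: "i \<le> j" "j \<le> m"
  shows "path C (contract C i j (Us, us, As)) = path C (Us, us, As)"
proof -
  have len: "length Us = Suc m" "length us = m" using Uu by (auto simp: nerve_def)
  let ?w = "foldr (Comp C) (drop j us) (Id C (last Us))"
  have "(drop j Us, drop j us) \<in> nerve C (m - j)"
    using nerve_seg[OF Uu, of j m] ij len by simp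
  from path_arr[OF this, of "[]"] have w: "?w \<in> Arr C" "Cod C ?w = Us ! j"
    using ij len by (simp_all add: path_def hd_drop_conv_nth)
  have "path C (contract C i j (Us, us, As)) =
      foldr (Comp C) (take i us) (Comp C (path C (seg i j (Us, us, As))) ?w)"
    using ij len by (simp add: contract_def path_def)
  also have "\<dots> = foldr (Comp C) (take i us) (foldr (Comp C) (take (j - i) (drop i us)) ?w)"
    by (simp only: foldr_Comp_seg[OF Uu ij w, of As])
  also have "\<dots> = foldr (Comp C) (take i us @ take (j - i) (drop i us) @ drop j us) (Id C (last Us))"
    by simp
  also have "take i us @ take (j - i) (drop i us) @ drop j us = us"
    using ij by (metis append.assoc append_take_drop_id le_add_diff_inverse take_add)
  finally show ?thesis by (simp add: path_def)
qed

lemma (in category) path_split: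
  assumes Uu: "(Us, us) \<in> nerve C m" and p: "p \<le> m"
  shows "Comp C (path C (seg 0 p (Us, us, As))) (path C (seg p m (Us, us, As))) = path C (Us, us, As)"
proof -
  have len: "length Us = Suc m" "length us = m" using Uu by (auto simp: nerve_def)
  have seg: "seg p m (Us, us, As) = (drop p Us, drop p us, take (Suc (m - p)) (drop p As))"
    using len by (simp add: seg_def)
  have w: "path C (seg p m (Us, us, As)) \<in> Arr C" "Cod C (path C (seg p m (Us, us, As))) = Us ! p"
    using path_arr[OF nerve_seg[OF Uu p order.refl], of "take (Suc (m - p)) (drop p As)"] p len
    by (simp_all add: seg_def hd_drop_conv_nth)
  have "Comp C (path C (seg 0 p (Us, us, As))) (path C (seg p m (Us, us, As))) =
      foldr (Comp C) (take p us) (path C (seg p m (Us, us, As)))"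
    using foldr_Comp_seg[OF Uu _ p w, of 0 As] by simp
  also have "\<dots> = foldr (Comp C) (take p us @ drop p us) (Id C (last Us))"
    using len p by (simp add: path_def seg del: append_take_drop_id)
  finally show ?thesis by (simp add: path_def)
qed

lemma (in category) path_single:
  assumes Uu: "(Us, us) \<in> nerve C m" and i: "i < m"
  shows "path C (seg i (Suc i) (Us, us, As)) = us ! i"
proof -
  have "take (Suc 0) (drop i us) = [us ! i]"
    using assms by (simp add: nerve_iff take_Suc_conv_app_nth)
  moreover have "last (take (Suc (Suc 0)) (drop i Us)) = Us ! Suc i"
    using last_seg[of i "Suc i" Us] assms by (simp add: nerve_iff)
  ultimately show ?thesis
    using assms comp_id[of "us ! i"] by (simp add: path_def seg_def nerve_iff)
qed

lemma simplices_iff: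
  "(Us, us, As) \<in> simplices \<aa> n \<longleftrightarrow> n = int (length us) \<and> (Us, us) \<in> nerve (base \<aa>) (length us) \<and>
     length As = length Us \<and> (\<forall>i<length Us. As ! i \<in> gobj \<aa> (Us ! i))"
  by (auto simp: simplices_def list_all2_conv_all_nth)

text \<open>
  The sources and the target of a simplex, and the maps which a graded functor induces on them,
  are families indexed by the edges, respectively by the composite edge.  The next two functions
  express this common pattern, so that faces of a simplex need to be examined only once.
\<close>

definition edges :: "('m \<Rightarrow> 'a \<Rightarrow> 'a \<Rightarrow> 'c) \<Rightarrow> ('o, 'm, 'a) simplex \<Rightarrow> 'c list" where
  "edges g = (\<lambda>(Us, us, As). map (\<lambda>i. g (us ! i) (As ! Suc i) (As ! i)) [0..<length us])"

definition whole :: "('o, 'm) cat \<Rightarrow> ('m \<Rightarrow> 'a \<Rightarrow> 'a \<Rightarrow> 'c) \<Rightarrow> ('o, 'm, 'a) simplex \<Rightarrow> 'c" where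
  "whole C g = (\<lambda>(Us, us, As). g (path C (Us, us, As)) (last As) (hd As))"

lemma sources_edges: "sources \<aa> = edges (gmor \<aa>)"
  by (simp add: sources_def edges_def fun_eq_iff)

lemma target_whole: "target \<aa> = whole (base \<aa>) (gmor \<aa>)"
  by (simp add: target_def whole_def fun_eq_iff)

lemma length_edges: "\<sigma> \<in> simplices \<aa> (int m) \<Longrightarrow> length (edges g \<sigma>) = m"
  by (cases \<sigma>) (auto simp: edges_def simplices_iff)

lemma seg_simplex:
  assumes "\<sigma> \<in> simplices \<aa> (int m)" "i \<le> j" "j \<le> m"
  shows "seg i j \<sigma> \<in> simplices \<aa> (int (j - i))"
  using assms by (cases \<sigma>) (auto simp: simplices_iff seg_def nerve_iff)

lemma edges_seg:
  assumes "\<sigma> \<in> simplices \<aa> (int m)" "i \<le> j" "j \<le> m"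
  shows "edges g (seg i j \<sigma>) = take (j - i) (drop i (edges g \<sigma>))"
  using assms by (cases \<sigma>) (auto simp: simplices_iff seg_def edges_def nerve_iff intro!: nth_equalityI)

lemma whole_seg:
  assumes "\<sigma> \<in> simplices \<aa> (int m)" "i \<le> j" "j \<le> m"
  shows "whole C g (seg i j \<sigma>) = g (path C (seg i j \<sigma>)) (vert \<sigma> j) (vert \<sigma> i)"
  using assms
  by (cases \<sigma>) (auto simp: simplices_iff seg_def whole_def nerve_iff vert_def last_seg hd_drop_conv_nth)

lemma edges_contract:
  assumes "\<sigma> \<in> simplices \<aa> (int m)" "i \<le> j" "j \<le> m"
  shows "edges g (contract C i j \<sigma>) = splice i j (whole C g (seg i j \<sigma>)) (edges g \<sigma>)"
proof -
  obtain Us us As where \<sigma>: "\<sigma> = (Us, us, As)" by (cases \<sigma>)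
  have len: "length Us = Suc m" "length us = m" "length As = Suc m"
    using assms by (auto simp: \<sigma> simplices_iff nerve_def)
  show ?thesis
  proof (rule nth_equalityI)
    show "length (edges g (contract C i j \<sigma>)) = length (splice i j (whole C g (seg i j \<sigma>)) (edges g \<sigma>))"
      using assms len by (simp add: \<sigma> edges_def contract_def splice_def)
  next
    fix k assume "k < length (edges g (contract C i j \<sigma>))"
    then have k: "k < length (take i us @ path C (seg i j \<sigma>) # drop j us)"
      using assms len by (simp add: \<sigma> edges_def contract_def)
    then have lhs: "edges g (contract C i j \<sigma>) ! k = g ((take i us @ path C (seg i j \<sigma>) # drop j us) ! k)
        ((take (Suc i) As @ drop j As) ! Suc k) ((take (Suc i) As @ drop j As) ! k)"
      unfolding \<sigma> edges_def contract_def prod.case by (simp only: nth_map length_upt nth_upt minus_nat.diff_0 add_0)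
    consider "k < i" | "k = i" | l where "k = Suc (i + l)"
      using less_imp_Suc_add by (metis linorder_neqE_nat)
    then show "edges g (contract C i j \<sigma>) ! k = splice i j (whole C g (seg i j \<sigma>)) (edges g \<sigma>) ! k"
    proof cases
      case 1
      then show ?thesis using assms len unfolding lhs
        by (simp add: \<sigma> edges_def splice_def nth_append)
    next
      case 2
      then show ?thesis using assms len whole_seg[OF assms, of C g] unfolding lhs
        by (simp add: \<sigma> edges_def splice_def nth_append vert_def)
    next
      case (3 l)
      have "j + l < m" using 3 k len assms(2,3) by auto
      with 3 show ?thesis using assms len unfolding lhs
        by (simp add: \<sigma> edges_def splice_def nth_append)
    qed
  qed
qed

lemma edge_nth: "\<lbrakk>\<sigma> \<in> simplices \<aa> (int m); i < m\<rbrakk> \<Longrightarrow>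
    edges g \<sigma> ! i = g (edge \<sigma> i) (vert \<sigma> (Suc i)) (vert \<sigma> i)"
  by (cases \<sigma>) (auto simp: simplices_iff edges_def edge_def vert_def)

lemma simplex_nat: "\<sigma> \<in> simplices \<aa> n \<Longrightarrow> \<exists>m. n = int m"
  by (cases \<sigma>) (auto simp: simplices_iff)

context map_graded
begin

sublocale base: category "base \<aa>"
  by (rule base)

lemma simplex_path:
  assumes "\<sigma> \<in> simplices \<aa> (int m)" "i \<le> j" "j \<le> m"
  shows "path (base \<aa>) (seg i j \<sigma>) \<in> Arr (base \<aa>)"
    and "vert \<sigma> j \<in> gobj \<aa> (Dom (base \<aa>) (path (base \<aa>) (seg i j \<sigma>)))"
    and "vert \<sigma> i \<in> gobj \<aa> (Cod (base \<aa>) (path (base \<aa>) (seg i j \<sigma>)))"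
proof -
  obtain Us us As where \<sigma>: "\<sigma> = (Us, us, As)" by (cases \<sigma>)
  have Uu: "(Us, us) \<in> nerve (base \<aa>) m" and len: "length Us = Suc m"
    and As: "\<And>i. i \<le> m \<Longrightarrow> As ! i \<in> gobj \<aa> (Us ! i)"
    using assms by (auto simp: \<sigma> simplices_iff nerve_iff)
  note P = base.path_arr[OF nerve_seg[OF Uu assms(2,3)], of "take (Suc (j - i)) (drop i As)"]
  have "path (base \<aa>) (seg i j \<sigma>) \<in> Arr (base \<aa>)"
    "Dom (base \<aa>) (path (base \<aa>) (seg i j \<sigma>)) = Us ! j"
    "Cod (base \<aa>) (path (base \<aa>) (seg i j \<sigma>)) = Us ! i"
    using P last_seg[OF assms(2), of Us] hd_seg[OF assms(2), of Us] len assms(3)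
    by (simp_all add: \<sigma> seg_def)
  then show "path (base \<aa>) (seg i j \<sigma>) \<in> Arr (base \<aa>)"
    "vert \<sigma> j \<in> gobj \<aa> (Dom (base \<aa>) (path (base \<aa>) (seg i j \<sigma>)))"
    "vert \<sigma> i \<in> gobj \<aa> (Cod (base \<aa>) (path (base \<aa>) (seg i j \<sigma>)))"
    using As assms(2,3) by (simp_all add: \<sigma> vert_def)
qed

lemma seg_full: "\<sigma> \<in> simplices \<aa> (int m) \<Longrightarrow> seg 0 m \<sigma> = \<sigma>"
  by (cases \<sigma>) (auto simp: simplices_iff nerve_iff seg_def)

lemma simplex_split:
  assumes "\<sigma> \<in> simplices \<aa> (int m)" "p \<le> m"
  shows "Comp (base \<aa>) (path (base \<aa>) (seg 0 p \<sigma>)) (path (base \<aa>) (seg p m \<sigma>)) = path (base \<aa>) \<sigma>"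
  using assms base.path_split by (cases \<sigma>) (auto simp: simplices_iff)

lemma simplex_edge:
  assumes "\<sigma> \<in> simplices \<aa> (int m)" "i < m"
  shows "path (base \<aa>) (seg i (Suc i) \<sigma>) = edge \<sigma> i"
  using assms base.path_single by (cases \<sigma>) (auto simp: simplices_iff edge_def)

lemma whole_contract:
  assumes "\<sigma> \<in> simplices \<aa> (int m)" "i \<le> j" "j \<le> m"
  shows "whole (base \<aa>) g (contract (base \<aa>) i j \<sigma>) = whole (base \<aa>) g \<sigma>"
proof -
  obtain Us us As where \<sigma>: "\<sigma> = (Us, us, As)" by (cases \<sigma>)
  have Uu: "(Us, us) \<in> nerve (base \<aa>) m" and len: "length As = Suc m"
    using assms by (auto simp: \<sigma> simplices_iff nerve_iff)
  have "last (take (Suc i) As @ drop j As) = last As" "hd (take (Suc i) As @ drop j As) = hd As"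
    using assms len by (cases As; simp)+
  then show ?thesis
    using base.path_contract[OF Uu assms(2,3), of As]
    by (simp add: \<sigma> whole_def contract_def)
qed

lemma contract_simplex:
  assumes "\<sigma> \<in> simplices \<aa> (int m)" "i \<le> j" "j \<le> m"
  shows "contract (base \<aa>) i j \<sigma> \<in> simplices \<aa> (int (Suc (m - (j - i))))"
proof -
  obtain Us us As where \<sigma>: "\<sigma> = (Us, us, As)" by (cases \<sigma>)
  have Uu: "(Us, us) \<in> nerve (base \<aa>) m" and len: "length Us = Suc m" "length us = m" "length As = Suc m"
    and ob: "\<And>i. i \<le> m \<Longrightarrow> Us ! i \<in> Ob (base \<aa>)" and As: "\<And>i. i \<le> m \<Longrightarrow> As ! i \<in> gobj \<aa> (Us ! i)"
    and ar: "\<And>i. i < m \<Longrightarrow> us ! i \<in> Arr (base \<aa>) \<and> Dom (base \<aa>) (us ! i) = Us ! Suc i \<and> Cod (base \<aa>) (us ! i) = Us ! i"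
    using assms by (auto simp: \<sigma> simplices_iff nerve_iff)
  let ?P = "path (base \<aa>) (seg i j \<sigma>)"
  have P: "?P \<in> Arr (base \<aa>)" "Dom (base \<aa>) ?P = Us ! j" "Cod (base \<aa>) ?P = Us ! i"
    using base.path_arr[OF nerve_seg[OF Uu assms(2,3)]] last_seg[OF assms(2), of Us] hd_seg[OF assms(2), of Us] assms len
    by (simp_all add: \<sigma> seg_def)
  let ?Us = "take (Suc i) Us @ drop j Us" and ?us = "take i us @ ?P # drop j us" and ?As = "take (Suc i) As @ drop j As"
  have lens: "length ?Us = Suc (Suc (m - (j - i)))" "length ?us = Suc (m - (j - i))" "length ?As = length ?Us"
    using assms len by auto
  have "?Us ! k \<in> Ob (base \<aa>) \<and> ?As ! k \<in> gobj \<aa> (?Us ! k)" if "k < length ?Us" for k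
    using that assms len ob As by (auto simp: nth_append)
  moreover have "?us ! k \<in> Arr (base \<aa>) \<and> Dom (base \<aa>) (?us ! k) = ?Us ! Suc k \<and> Cod (base \<aa>) (?us ! k) = ?Us ! k"
    if k: "k < length ?us" for k
  proof -
    consider "k < i" | "k = i" | l where "k = Suc (i + l)"
      using less_imp_Suc_add by (metis linorder_neqE_nat)
    then show ?thesis
    proof cases
      case 1
      then show ?thesis using ar assms len by (simp add: nth_append)
    next
      case 2
      then show ?thesis using P assms len by (simp add: nth_append)
    next
      case (3 l)
      then show ?thesis using ar[of "j + l"] assms len k by (simp add: nth_append)
    qed
  qed
  ultimately have "(?Us, ?us, ?As) \<in> simplices \<aa> (int (length ?us))"
    using lens by (simp add: simplices_iff nerve_iff less_Suc_eq_le)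
  then show ?thesis unfolding lens(2) by (simp add: \<sigma> contract_def)
qed

lemma whole_simplex:
  "\<sigma> \<in> simplices \<aa> (int m) \<Longrightarrow> whole C g \<sigma> = g (path C \<sigma>) (vert \<sigma> m) (vert \<sigma> 0)"
  using whole_seg[of \<sigma> \<aa> m 0 m C g] seg_full[of \<sigma> m] by simp

lemma target_module:
  assumes "\<sigma> \<in> simplices \<aa> n"
  shows "module R (target \<aa> \<sigma>)"
proof -
  obtain m where n: "n = int m" using simplex_nat[OF assms] by blast
  show ?thesis
    using gmor_module[OF simplex_path[of \<sigma> m 0 m]] assms seg_full[of \<sigma> m]
    by (simp add: target_whole whole_simplex n)
qed

lemma source_module:
  assumes "\<sigma> \<in> simplices \<aa> n" "M \<in> set (sources \<aa> \<sigma>)"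
  shows "module R M"
proof -
  obtain m where n: "n = int m" using simplex_nat[OF assms(1)] by blast
  obtain i where i: "i < m" "M = sources \<aa> \<sigma> ! i"
    using assms length_edges[of \<sigma> \<aa> m "gmor \<aa>"] by (auto simp: in_set_conv_nth n sources_edges)
  then show ?thesis
    using gmor_module[OF simplex_path[of \<sigma> m i "Suc i"]] assms simplex_edge[of \<sigma> m i]
    by (simp add: sources_edges n edge_nth)
qed

lemma sources_seg:
  "\<lbrakk>\<sigma> \<in> simplices \<aa> (int m); i \<le> j; j \<le> m\<rbrakk> \<Longrightarrow> sources \<aa> (seg i j \<sigma>) = take (j - i) (drop i (sources \<aa> \<sigma>))"
  by (simp add: sources_edges edges_seg)

lemma sources_contract:
  "\<lbrakk>\<sigma> \<in> simplices \<aa> (int m); i \<le> j; j \<le> m\<rbrakk> \<Longrightarrow>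
    sources \<aa> (contract (base \<aa>) i j \<sigma>) = splice i j (target \<aa> (seg i j \<sigma>)) (sources \<aa> \<sigma>)"
  by (simp add: sources_edges target_whole edges_contract)

lemma target_contract:
  "\<lbrakk>\<sigma> \<in> simplices \<aa> (int m); i \<le> j; j \<le> m\<rbrakk> \<Longrightarrow> target \<aa> (contract (base \<aa>) i j \<sigma>) = target \<aa> \<sigma>"
  by (simp add: target_whole whole_contract)

end

section \<open>Operations on Hochschild cochains\<close>

lemma multilinear_single: "multilinear R [M] M (\<lambda>xs. xs ! 0)"
proof (rule multilinearI)
  fix xs and i :: nat assume "xs \<in> tuples [M]" "i < length [M]"
  then show "mod_hom R ([M] ! i) M (\<lambda>x. xs[i := x] ! 0)"
    using mod_hom_id tuples_length[of xs "[M]"] by simp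
qed (auto simp: tuples_def list_all2_Cons2)

text \<open>
  Two insertions into a bilinear map, the second one first, so that the positions of the first one
  are not shifted.
\<close>

lemma multilinear_product:
  fixes Ms :: "('k, 'x) module list" and M1 M2 :: "('k, 'x) module"
  assumes p: "p \<le> length Ms"
    and f: "multilinear R [M1, M2] N (\<lambda>xs. f (xs ! 0) (xs ! 1))"
    and g: "multilinear R (take p Ms) M1 g" and h: "multilinear R (drop p Ms) M2 h"
    and mods: "\<And>M. M \<in> set Ms \<Longrightarrow> module R M"
  shows "multilinear R Ms N (\<lambda>xs. f (g (take p xs)) (h (drop p xs)))"
proof -
  let ?n = "length Ms"
  let ?f = "\<lambda>xs. f (xs ! 0) (xs ! 1)"
  let ?f1 = "\<lambda>xs. ?f (splice 0 p (g (take p xs)) xs)"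
  let ?f2 = "\<lambda>xs. ?f1 (splice p ?n (h (take (?n - p) (drop p xs))) xs)"
  have "multilinear R (splice p ?n M2 Ms) N ?f1"
    using multilinear_splice[of 0 p "splice p ?n M2 Ms" R M1 N ?f g] p f g
    by (simp add: splice_def)
  then have "multilinear R Ms N ?f2"
    using multilinear_splice[of p ?n Ms R M2 N ?f1 h] p h by simp
  then show ?thesis
    by (rule multilinear_cong[OF mods, rotated 2])
      (use p in \<open>auto simp: splice_def dest!: tuples_length\<close>)
qed

lemma cochains_iff:
  "\<phi> \<in> carrier (cochains R \<aa> n) \<longleftrightarrow> \<phi> \<in> extensional (simplices \<aa> n) \<and>
     (\<forall>\<sigma>\<in>simplices \<aa> n. \<phi> \<sigma> \<in> extensional (tuples (sources \<aa> \<sigma>)) \<and>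
        multilinear R (sources \<aa> \<sigma>) (target \<aa> \<sigma>) (\<phi> \<sigma>))"
  by (auto simp: cochains_def PiE_iff)

lemma cochain_eqI:
  assumes "\<phi> \<in> carrier (cochains R \<aa> n)" "\<psi> \<in> carrier (cochains R \<aa> n)"
    and "\<And>\<sigma> fs. \<lbrakk>\<sigma> \<in> simplices \<aa> n; fs \<in> tuples (sources \<aa> \<sigma>)\<rbrakk> \<Longrightarrow> \<phi> \<sigma> fs = \<psi> \<sigma> fs"
  shows "\<phi> = \<psi>"
  using assms by (intro extensionalityI[of _ "simplices \<aa> n"]) (auto simp: cochains_iff intro!: extensionalityI)

lemma cochain_multilinear:
  "\<lbrakk>\<phi> \<in> carrier (cochains R \<aa> n); \<sigma> \<in> simplices \<aa> n\<rbrakk> \<Longrightarrow>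
    multilinear R (sources \<aa> \<sigma>) (target \<aa> \<sigma>) (\<phi> \<sigma>)"
  by (simp add: cochains_iff)

lemma cochain_closed:
  "\<lbrakk>\<phi> \<in> carrier (cochains R \<aa> n); \<sigma> \<in> simplices \<aa> n; fs \<in> tuples (sources \<aa> \<sigma>)\<rbrakk> \<Longrightarrow>
    \<phi> \<sigma> fs \<in> carrier (target \<aa> \<sigma>)"
  by (blast intro: multilinear_closed cochain_multilinear)

context map_graded
begin

lemma cochainI:
  assumes "\<And>\<sigma>. \<sigma> \<in> simplices \<aa> n \<Longrightarrow> multilinear R (sources \<aa> \<sigma>) (target \<aa> \<sigma>) (f \<sigma>)"
  shows "(\<lambda>\<sigma>\<in>simplices \<aa> n. \<lambda>fs\<in>tuples (sources \<aa> \<sigma>). f \<sigma> fs) \<in> carrier (cochains R \<aa> n)"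
  using assms
  by (auto simp: cochains_iff intro: multilinear_cong[OF source_module])

lemma
  shows cochain_zero_closed: "\<zero>\<^bsub>cochains R \<aa> n\<^esub> \<in> carrier (cochains R \<aa> n)"
    and cochain_add_closed: "\<lbrakk>\<phi> \<in> carrier (cochains R \<aa> n); \<psi> \<in> carrier (cochains R \<aa> n)\<rbrakk> \<Longrightarrow>
      \<phi> \<oplus>\<^bsub>cochains R \<aa> n\<^esub> \<psi> \<in> carrier (cochains R \<aa> n)"
    and cochain_smult_closed: "\<lbrakk>c \<in> carrier R; \<phi> \<in> carrier (cochains R \<aa> n)\<rbrakk> \<Longrightarrow>
      c \<odot>\<^bsub>cochains R \<aa> n\<^esub> \<phi> \<in> carrier (cochains R \<aa> n)"
proof -
  show "\<zero>\<^bsub>cochains R \<aa> n\<^esub> \<in> carrier (cochains R \<aa> n)"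
    using cochainI[OF multilinear_const_zero[OF target_module]] by (simp add: cochains_def)
  show "\<phi> \<oplus>\<^bsub>cochains R \<aa> n\<^esub> \<psi> \<in> carrier (cochains R \<aa> n)"
    if "\<phi> \<in> carrier (cochains R \<aa> n)" "\<psi> \<in> carrier (cochains R \<aa> n)"
    using cochainI[OF multilinear_plus[OF target_module cochain_multilinear[OF that(1)] cochain_multilinear[OF that(2)]]]
    by (simp add: cochains_def)
  show "c \<odot>\<^bsub>cochains R \<aa> n\<^esub> \<phi> \<in> carrier (cochains R \<aa> n)"
    if "c \<in> carrier R" "\<phi> \<in> carrier (cochains R \<aa> n)"
    using cochainI[OF multilinear_smult[OF target_module cochain_multilinear[OF that(2)] that(1)]]
    by (simp add: cochains_def)
qed

lemma cochain_apply:
  assumes "\<sigma> \<in> simplices \<aa> n" "fs \<in> tuples (sources \<aa> \<sigma>)"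
  shows "\<zero>\<^bsub>cochains R \<aa> n\<^esub> \<sigma> fs = \<zero>\<^bsub>target \<aa> \<sigma>\<^esub>"
    and "(\<phi> \<oplus>\<^bsub>cochains R \<aa> n\<^esub> \<psi>) \<sigma> fs = \<phi> \<sigma> fs \<oplus>\<^bsub>target \<aa> \<sigma>\<^esub> \<psi> \<sigma> fs"
    and "(c \<odot>\<^bsub>cochains R \<aa> n\<^esub> \<phi>) \<sigma> fs = c \<odot>\<^bsub>target \<aa> \<sigma>\<^esub> \<phi> \<sigma> fs"
  using assms by (simp_all add: cochains_def)

text \<open>
  The signs of the differential and the cup product are additive inverses in the modules of
  cochains.  These can be compared with inverses in the targets for actual cochains only, which is
  why closure of the operations comes before their naturality.
\<close>

lemma cochains_abelian_group: "abelian_group (cochains R \<aa> n)"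
proof (rule abelian_groupI)
  let ?C = "cochains R \<aa> n"
  have ab: "abelian_group (target \<aa> \<sigma>)" if "\<sigma> \<in> simplices \<aa> n" for \<sigma>
    using target_module[OF that] by (rule module.axioms)
  note abm = abelian_group.axioms(1)[OF ab]
  show "\<zero>\<^bsub>?C\<^esub> \<in> carrier ?C" by (rule cochain_zero_closed)
  fix \<phi> \<psi> \<chi> assume \<phi>: "\<phi> \<in> carrier ?C" and \<psi>: "\<psi> \<in> carrier ?C"
  show "\<phi> \<oplus>\<^bsub>?C\<^esub> \<psi> \<in> carrier ?C" using \<phi> \<psi> by (rule cochain_add_closed)
  show "\<phi> \<oplus>\<^bsub>?C\<^esub> \<psi> = \<psi> \<oplus>\<^bsub>?C\<^esub> \<phi>"
    using \<phi> \<psi> by (intro cochain_eqI[OF cochain_add_closed cochain_add_closed])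
      (auto simp: cochain_apply intro!: abelian_monoid.a_comm[OF abm] cochain_closed)
  show "\<zero>\<^bsub>?C\<^esub> \<oplus>\<^bsub>?C\<^esub> \<phi> = \<phi>"
    using \<phi> by (intro cochain_eqI[OF cochain_add_closed[OF cochain_zero_closed]])
      (auto simp: cochain_apply intro!: abelian_monoid.l_zero[OF abm] cochain_closed)
  show "\<exists>\<psi>\<in>carrier ?C. \<psi> \<oplus>\<^bsub>?C\<^esub> \<phi> = \<zero>\<^bsub>?C\<^esub>"
  proof
    let ?m = "\<lambda>\<sigma>\<in>simplices \<aa> n. \<lambda>fs\<in>tuples (sources \<aa> \<sigma>). signed (target \<aa> \<sigma>) 1 (\<phi> \<sigma> fs)"
    show m: "?m \<in> carrier ?C"
      using \<phi> by (intro cochainI multilinear_signed target_module cochain_multilinear)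
    show "?m \<oplus>\<^bsub>?C\<^esub> \<phi> = \<zero>\<^bsub>?C\<^esub>"
      using \<phi> m by (intro cochain_eqI[OF cochain_add_closed cochain_zero_closed])
        (auto simp: cochain_apply signed_def intro!: abelian_group.l_neg[OF ab] cochain_closed)
  qed
  assume \<chi>: "\<chi> \<in> carrier ?C"
  show "\<phi> \<oplus>\<^bsub>?C\<^esub> \<psi> \<oplus>\<^bsub>?C\<^esub> \<chi> = \<phi> \<oplus>\<^bsub>?C\<^esub> (\<psi> \<oplus>\<^bsub>?C\<^esub> \<chi>)"
    using \<phi> \<psi> \<chi> by (intro cochain_eqI[OF cochain_add_closed cochain_add_closed] cochain_add_closed)
      (auto simp: cochain_apply intro!: abelian_monoid.a_assoc[OF abm] cochain_closed)
qed

lemma seg_comp: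
  assumes \<sigma>: "\<sigma> \<in> simplices \<aa> (int m)" and ijk: "i \<le> j" "j \<le> k" "k \<le> m"
  shows "Comp (base \<aa>) (path (base \<aa>) (seg i j \<sigma>)) (path (base \<aa>) (seg j k \<sigma>)) = path (base \<aa>) (seg i k \<sigma>)"
proof -
  have "seg 0 (j - i) (seg i k \<sigma>) = seg i j \<sigma>" "seg (j - i) (k - i) (seg i k \<sigma>) = seg j k \<sigma>"
    using ijk by (cases \<sigma>; simp add: seg_def drop_take min_absorb1 Suc_diff_le)+
  then show ?thesis
    using simplex_split[OF seg_simplex[OF \<sigma>, of i k], of "j - i"] ijk by auto
qed

text \<open>
  This is the bilinear map behind all composites in the operations: the two parts carry two
  cochains in a cup product, a cochain and an argument in the outer terms of the differential, and
  two arguments in its inner terms.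
\<close>

lemma comp_multilinear:
  assumes \<sigma>: "\<sigma> \<in> simplices \<aa> (int m)" and ijk: "i \<le> j" "j \<le> k" "k \<le> m"
  shows "multilinear R [target \<aa> (seg i j \<sigma>), target \<aa> (seg j k \<sigma>)] (target \<aa> (seg i k \<sigma>))
     (\<lambda>xs. gcmp \<aa> (path (base \<aa>) (seg i j \<sigma>)) (path (base \<aa>) (seg j k \<sigma>))
        (vert \<sigma> k) (vert \<sigma> j) (vert \<sigma> i) (xs ! 0) (xs ! 1))"
proof -
  obtain Us us As where S: "\<sigma> = (Us, us, As)" by (cases \<sigma>)
  have Uu: "(Us, us) \<in> nerve (base \<aa>) m" and len: "length Us = Suc m"
    using \<sigma> by (auto simp: S simplices_iff nerve_iff)
  have "Dom (base \<aa>) (path (base \<aa>) (seg i j \<sigma>)) = Us ! j" "Cod (base \<aa>) (path (base \<aa>) (seg j k \<sigma>)) = Us ! j"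
    using base.path_arr[OF nerve_seg[OF Uu], of i j] base.path_arr[OF nerve_seg[OF Uu], of j k]
      last_seg[of i j Us] hd_seg[of j k Us] ijk len
    by (simp_all add: S seg_def)
  then have eq: "Cod (base \<aa>) (path (base \<aa>) (seg j k \<sigma>)) = Dom (base \<aa>) (path (base \<aa>) (seg i j \<sigma>))"
    by simp
  note P = simplex_path[OF \<sigma>, of i j] simplex_path[OF \<sigma>, of j k]
  have T: "target \<aa> (seg i j \<sigma>) = gmor \<aa> (path (base \<aa>) (seg i j \<sigma>)) (vert \<sigma> j) (vert \<sigma> i)"
    "target \<aa> (seg j k \<sigma>) = gmor \<aa> (path (base \<aa>) (seg j k \<sigma>)) (vert \<sigma> k) (vert \<sigma> j)"
    "target \<aa> (seg i k \<sigma>) = gmor \<aa> (Comp (base \<aa>) (path (base \<aa>) (seg i j \<sigma>)) (path (base \<aa>) (seg j k \<sigma>)))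
       (vert \<sigma> k) (vert \<sigma> i)"
    using ijk by (simp_all add: target_whole whole_seg[OF \<sigma>] seg_comp[OF \<sigma>])
  show ?thesis
    unfolding T using P eq ijk by (intro multilinear_pair gcmp_left gcmp_right) auto
qed

lemma edge_target:
  assumes "\<sigma> \<in> simplices \<aa> (int m)" "i < m"
  shows "target \<aa> (seg i (Suc i) \<sigma>) = sources \<aa> \<sigma> ! i"
  using assms simplex_edge[OF assms]
  by (simp add: target_whole sources_edges whole_seg[OF assms(1)] edge_nth[OF assms])

lemma length_sources: "\<sigma> \<in> simplices \<aa> (int m) \<Longrightarrow> length (sources \<aa> \<sigma>) = m"
  by (simp add: sources_edges length_edges)

lemma hcup_closed:
  assumes \<phi>: "\<phi> \<in> carrier (cochains R \<aa> (int p))" and \<psi>: "\<psi> \<in> carrier (cochains R \<aa> (int q))"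
  shows "hcup \<aa> p \<phi> q \<psi> \<in> carrier (cochains R \<aa> (int p + int q))"
  unfolding hcup_def
proof (rule cochainI)
  fix \<sigma> assume "\<sigma> \<in> simplices \<aa> (int p + int q)"
  then have \<sigma>: "\<sigma> \<in> simplices \<aa> (int (p + q))" by simp
  show "multilinear R (sources \<aa> \<sigma>) (target \<aa> \<sigma>)
     (\<lambda>fs. gcmp \<aa> (path (base \<aa>) (seg 0 p \<sigma>)) (path (base \<aa>) (seg p (p + q) \<sigma>))
       (vert \<sigma> (p + q)) (vert \<sigma> p) (vert \<sigma> 0)
       (\<phi> (seg 0 p \<sigma>) (take p fs)) (\<psi> (seg p (p + q) \<sigma>) (drop p fs)))"
    using cochain_multilinear[OF \<phi> seg_simplex[OF \<sigma>, of 0 p, simplified]]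
      cochain_multilinear[OF \<psi> seg_simplex[OF \<sigma>, of p "p + q", simplified]]
      comp_multilinear[OF \<sigma>, of 0 p "p + q"] source_module[OF \<sigma>]
    by (intro multilinear_product) (auto simp: length_sources[OF \<sigma>] sources_seg[OF \<sigma>] seg_full[OF \<sigma>])
qed

text \<open>
  The summands of the Hochschild differential are treated one by one, because its naturality also
  uses that each of them takes values in the target module.
\<close>

context
  fixes p :: nat and \<phi> :: "('o, 'm, 'a, 'x) cochain" and \<sigma> :: "('o, 'm, 'a) simplex"
  assumes \<phi>: "\<phi> \<in> carrier (cochains R \<aa> (int p))" and \<sigma>: "\<sigma> \<in> simplices \<aa> (int (Suc p))"
begin

lemma edge_multilinear:
  assumes "i < Suc p"
  shows "multilinear R (take (Suc 0) (drop i (sources \<aa> \<sigma>))) (target \<aa> (seg i (Suc i) \<sigma>)) (\<lambda>xs. xs ! 0)"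
proof -
  have "take (Suc 0) (drop i (sources \<aa> \<sigma>)) = [target \<aa> (seg i (Suc i) \<sigma>)]"
    using assms edge_target[OF \<sigma> assms] by (simp add: take_Suc_conv_app_nth length_sources[OF \<sigma>])
  then show ?thesis by (simp add: multilinear_single)
qed

lemma hdiff_first_multilinear:
  "multilinear R (sources \<aa> \<sigma>) (target \<aa> \<sigma>)
     (\<lambda>fs. gcmp \<aa> (edge \<sigma> 0) (path (base \<aa>) (seg 1 (Suc p) \<sigma>)) (vert \<sigma> (Suc p)) (vert \<sigma> 1) (vert \<sigma> 0)
       (fs ! 0) (\<phi> (seg 1 (Suc p) \<sigma>) (tl fs)))"
proof -
  have "multilinear R (sources \<aa> \<sigma>) (target \<aa> \<sigma>)
     (\<lambda>fs. gcmp \<aa> (edge \<sigma> 0) (path (base \<aa>) (seg 1 (Suc p) \<sigma>)) (vert \<sigma> (Suc p)) (vert \<sigma> 1) (vert \<sigma> 0)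
       (take 1 fs ! 0) (\<phi> (seg 1 (Suc p) \<sigma>) (drop 1 fs)))"
    using cochain_multilinear[OF \<phi> seg_simplex[OF \<sigma>, of 1 "Suc p", simplified]]
      comp_multilinear[OF \<sigma>, of 0 1 "Suc p"] source_module[OF \<sigma>] edge_multilinear[of 0] simplex_edge[OF \<sigma>, of 0]
    by (intro multilinear_product) (auto simp: length_sources[OF \<sigma>] sources_seg[OF \<sigma>] seg_full[OF \<sigma>])
  then show ?thesis by (simp add: drop_Suc)
qed

lemma hdiff_last_multilinear:
  "multilinear R (sources \<aa> \<sigma>) (target \<aa> \<sigma>)
     (\<lambda>fs. gcmp \<aa> (path (base \<aa>) (seg 0 p \<sigma>)) (edge \<sigma> p) (vert \<sigma> (Suc p)) (vert \<sigma> p) (vert \<sigma> 0)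
         (\<phi> (seg 0 p \<sigma>) (butlast fs)) (fs ! p))"
proof -
  have "multilinear R (sources \<aa> \<sigma>) (target \<aa> \<sigma>)
     (\<lambda>fs. gcmp \<aa> (path (base \<aa>) (seg 0 p \<sigma>)) (edge \<sigma> p) (vert \<sigma> (Suc p)) (vert \<sigma> p) (vert \<sigma> 0)
         (\<phi> (seg 0 p \<sigma>) (take p fs)) (drop p fs ! 0))"
    using cochain_multilinear[OF \<phi> seg_simplex[OF \<sigma>, of 0 p, simplified]]
      comp_multilinear[OF \<sigma>, of 0 p "Suc p"] source_module[OF \<sigma>] edge_multilinear[of p] simplex_edge[OF \<sigma>, of p]
    by (intro multilinear_product) (auto simp: length_sources[OF \<sigma>] sources_seg[OF \<sigma>] seg_full[OF \<sigma>])
  then show ?thesis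
    by (rule multilinear_cong[OF source_module[OF \<sigma>], rotated 2])
      (auto dest!: tuples_length simp: length_sources[OF \<sigma>] butlast_conv_take)
qed

lemma hdiff_inner_multilinear:
  assumes i: "i < p"
  shows "multilinear R (sources \<aa> \<sigma>) (target \<aa> \<sigma>)
     (\<lambda>fs. \<phi> (contract (base \<aa>) i (i + 2) \<sigma>)
          (splice i (i + 2)
            (gcmp \<aa> (edge \<sigma> i) (edge \<sigma> (i + 1)) (vert \<sigma> (i + 2)) (vert \<sigma> (i + 1)) (vert \<sigma> i)
              (fs ! i) (fs ! (i + 1))) fs))"
proof -
  let ?S = "sources \<aa> \<sigma>"
  note len = length_sources[OF \<sigma>]
  let ?c = "\<lambda>xs. gcmp \<aa> (edge \<sigma> i) (edge \<sigma> (i + 1)) (vert \<sigma> (i + 2)) (vert \<sigma> (i + 1)) (vert \<sigma> i) (xs ! 0) (xs ! 1)"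
  have "take 2 (drop i ?S) = [target \<aa> (seg i (Suc i) \<sigma>), target \<aa> (seg (Suc i) (Suc (Suc i)) \<sigma>)]"
    using i len by (simp add: edge_target[OF \<sigma>] numeral_2_eq_2 take_Suc_conv_app_nth)
  then have c: "multilinear R (take (i + 2 - i) (drop i ?S)) (target \<aa> (seg i (i + 2) \<sigma>)) ?c"
    using comp_multilinear[OF \<sigma>, of i "i + 1" "i + 2"] i simplex_edge[OF \<sigma>, of i] simplex_edge[OF \<sigma>, of "Suc i"]
    by simp
  have "contract (base \<aa>) i (i + 2) \<sigma> \<in> simplices \<aa> (int p)"
    using contract_simplex[OF \<sigma>, of i "i + 2"] i by simp
  from cochain_multilinear[OF \<phi> this]
  have "multilinear R (splice i (i + 2) (target \<aa> (seg i (i + 2) \<sigma>)) ?S) (target \<aa> \<sigma>) (\<phi> (contract (base \<aa>) i (i + 2) \<sigma>))"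
    using i sources_contract[OF \<sigma>, of i "i + 2"] target_contract[OF \<sigma>, of i "i + 2"] by simp
  from multilinear_splice[OF _ _ this c]
  have "multilinear R ?S (target \<aa> \<sigma>)
     (\<lambda>xs. \<phi> (contract (base \<aa>) i (i + 2) \<sigma>) (splice i (i + 2) (?c (take (i + 2 - i) (drop i xs))) xs))"
    using i len by simp
  then show ?thesis
    by (rule multilinear_cong[OF source_module[OF \<sigma>], rotated 2])
      (use i in \<open>auto dest!: tuples_length simp: len\<close>)
qed

end

lemma hdiff_closed:
  assumes \<phi>: "\<phi> \<in> carrier (cochains R \<aa> (int p))"
  shows "hdiff \<aa> p \<phi> \<in> carrier (cochains R \<aa> (int p + 1))"
  unfolding hdiff_def
  by (intro cochainI multilinear_plus multilinear_finsum multilinear_signed target_module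
      hdiff_first_multilinear[OF \<phi>] hdiff_inner_multilinear[OF \<phi>] hdiff_last_multilinear[OF \<phi>])
    (auto simp: add.commute)

end

text \<open>
  \<open>contracts C L \<sigma>\<close> and \<open>inserts \<aa> L \<sigma> fs\<close> are the simplex and the arguments on which the outer
  cochain of a brace is evaluated.  The simplex does not depend on the arguments, which makes it
  meaningful to ask for multilinearity.
\<close>

definition contracts :: "('o, 'm) cat \<Rightarrow> ((nat \<times> 'c) \<times> nat) list \<Rightarrow> ('o, 'm, 'a) simplex \<Rightarrow> ('o, 'm, 'a) simplex" where
  "contracts C = foldr (\<lambda>((q, \<psi>), i). contract C i (i + q))"

definition inserts :: "('k, 'o, 'm, 'a, 'x) mgcat \<Rightarrow> ((nat \<times> ('o, 'm, 'a, 'x) cochain) \<times> nat) list \<Rightarrow>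
    ('o, 'm, 'a) simplex \<Rightarrow> 'x list \<Rightarrow> 'x list" where
  "inserts \<aa> L \<sigma> fs = snd (foldr (plug \<aa>) L (\<sigma>, fs))"

lemma foldr_plug: "foldr (plug \<aa>) L (\<sigma>, fs) = (contracts (base \<aa>) L \<sigma>, inserts \<aa> L \<sigma> fs)"
proof -
  have "fst (foldr (plug \<aa>) L (\<sigma>, fs)) = contracts (base \<aa>) L \<sigma>"
    by (induction L) (auto simp: contracts_def plug_def split: prod.splits)
  then show ?thesis by (simp add: inserts_def prod_eq_iff)
qed

lemma inserts_Nil: "inserts \<aa> [] \<sigma> fs = fs"
  by (simp add: inserts_def)

lemma inserts_Cons:
  "inserts \<aa> (((q, \<psi>), i) # L) \<sigma> fs = splice i (i + q)
     (\<psi> (seg i (i + q) (contracts (base \<aa>) L \<sigma>)) (take q (drop i (inserts \<aa> L \<sigma> fs)))) (inserts \<aa> L \<sigma> fs)"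
  using foldr_plug[of \<aa> L \<sigma> fs] by (simp add: inserts_def[of \<aa> "_ # _"] plug_def)

lemma contracts_Nil: "contracts C [] \<sigma> = \<sigma>"
  and contracts_Cons: "contracts C (((q, \<psi>), i) # L) \<sigma> = contract C i (i + q) (contracts C L \<sigma>)"
  by (simp_all add: contracts_def)

text \<open>
  The insertions are carried out from the last one to the first one.  What is known to have kept
  its place after some of them are the vertices up to the position of the latest, and the next
  insertion has to fit in front of it.
\<close>

definition first_pos :: "((nat \<times> 'c) \<times> nat) list \<Rightarrow> nat \<Rightarrow> nat" where
  "first_pos L m = (case L of [] \<Rightarrow> m | ((q, \<psi>), i) # L' \<Rightarrow> i)"

fun fits :: "((nat \<times> 'c) \<times> nat) list \<Rightarrow> nat \<Rightarrow> bool" where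
  "fits [] m \<longleftrightarrow> True"
| "fits (((q, \<psi>), i) # L) m \<longleftrightarrow> i + q \<le> first_pos L m \<and> fits L m"

lemma placements_fits: "ps \<in> placements (map fst \<psi>s) m \<Longrightarrow> fits (zip \<psi>s ps) m"
proof (induction \<psi>s arbitrary: ps)
  case (Cons x \<psi>s)
  obtain q \<psi> where x: "x = (q, \<psi>)" by (cases x)
  obtain p ps' where ps: "ps = p # ps'" "length ps' = length \<psi>s"
    using Cons.prems by (auto simp: placements_def length_Suc_conv)
  have le: "ps ! j + map fst (x # \<psi>s) ! j \<le> (if Suc j < Suc (length \<psi>s) then ps ! Suc j else m)"
    if "j < Suc (length \<psi>s)" for j
    using Cons.prems that by (auto simp: placements_def)
  have "ps' ! j + map fst \<psi>s ! j \<le> (if Suc j < length \<psi>s then ps' ! Suc j else m)"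
    if "j < length \<psi>s" for j
    using le[of "Suc j"] that by (simp add: ps(1) split: if_splits)
  then have "ps' \<in> placements (map fst \<psi>s) m"
    using ps(2) by (simp add: placements_def)
  moreover have "p + q \<le> first_pos (zip \<psi>s ps') m"
    using le[of 0] ps x by (cases \<psi>s; cases ps') (auto simp: first_pos_def)
  ultimately show ?case using Cons.IH by (simp add: ps x)
qed simp

text \<open>
  The bound on the dimension records that there is still room for an insertion in front of the
  earlier ones.
\<close>

lemma (in map_graded) contracts_simplex:
  assumes "\<sigma> \<in> simplices \<aa> (int m)" "fits L m"
  shows "\<exists>m'. int m' = int m + (\<Sum>((q, \<psi>), i)\<leftarrow>L. 1 - int q) \<and> first_pos L m \<le> m' \<and>
    contracts (base \<aa>) L \<sigma> \<in> simplices \<aa> (int m')"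
  using assms(2)
proof (induction L)
  case Nil
  then show ?case using assms by (simp add: first_pos_def contracts_Nil)
next
  case (Cons x L)
  obtain q \<psi> i where x: "x = ((q, \<psi>), i)" by (cases x) auto
  then obtain m' where m': "int m' = int m + (\<Sum>((q, \<psi>), i)\<leftarrow>L. 1 - int q)" "first_pos L m \<le> m'"
    "contracts (base \<aa>) L \<sigma> \<in> simplices \<aa> (int m')"
    using Cons by auto
  have le: "i + q \<le> m'" using Cons.prems m' x by simp
  show ?case
    using contract_simplex[OF m'(3), of i "i + q"] m'(1) le x
    by (intro exI[of _ "Suc (m' - q)"]) (auto simp: contracts_Cons first_pos_def of_nat_diff)
qed

text \<open>
  Inserting cochains from the last position to the first one reduces multilinearity to that of a
  single insertion, whatever multilinear map is applied in the end.
\<close>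

lemma (in map_graded) inserts_multilinear:
  assumes \<sigma>: "\<sigma> \<in> simplices \<aa> (int m)" and "fits L m"
    and "\<And>q \<psi> i. ((q, \<psi>), i) \<in> set L \<Longrightarrow> \<psi> \<in> carrier (cochains R \<aa> (int q))"
    and "multilinear R (sources \<aa> (contracts (base \<aa>) L \<sigma>)) N f"
  shows "multilinear R (sources \<aa> \<sigma>) N (\<lambda>fs. f (inserts \<aa> L \<sigma> fs))"
  using assms(2-)
proof (induction L arbitrary: f)
  case Nil
  then show ?case by (simp add: inserts_Nil contracts_Nil)
next
  case (Cons x L)
  obtain q \<psi> i where x: "x = ((q, \<psi>), i)" by (cases x) auto
  obtain m' where m': "first_pos L m \<le> m'" "contracts (base \<aa>) L \<sigma> \<in> simplices \<aa> (int m')"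
    using contracts_simplex[OF \<sigma>, of L] Cons.prems(1) x by auto
  have le: "i + q \<le> m'" using Cons.prems m' x by simp
  let ?\<tau> = "contracts (base \<aa>) L \<sigma>"
  have "multilinear R (sources \<aa> (seg i (i + q) ?\<tau>)) (target \<aa> (seg i (i + q) ?\<tau>)) (\<psi> (seg i (i + q) ?\<tau>))"
    using Cons.prems(2)[of q \<psi> i] seg_simplex[OF m'(2), of i "i + q"] le x by (auto intro: cochain_multilinear)
  moreover have "multilinear R (splice i (i + q) (target \<aa> (seg i (i + q) ?\<tau>)) (sources \<aa> ?\<tau>)) N f"
    using Cons.prems(3) sources_contract[OF m'(2), of i "i + q"] le by (simp add: x contracts_Cons)
  ultimately have "multilinear R (sources \<aa> ?\<tau>) N
     (\<lambda>fs. f (splice i (i + q) (\<psi> (seg i (i + q) ?\<tau>) (take (i + q - i) (drop i fs))) fs))"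
    using le by (intro multilinear_splice)
      (auto simp: length_sources[OF m'(2)] sources_seg[OF m'(2), of i "i + q"])
  moreover have "\<psi>' \<in> carrier (cochains R \<aa> (int q'))" if "((q', \<psi>'), i') \<in> set L" for q' \<psi>' i'
    using Cons.prems(2)[of q' \<psi>' i'] that by simp
  moreover have "fits L m" using Cons.prems(1) x by simp
  ultimately show ?case
    using Cons.IH by (simp add: x inserts_Cons)
qed

lemma (in map_graded) target_contracts:
  assumes \<sigma>: "\<sigma> \<in> simplices \<aa> (int m)" and "fits L m"
  shows "target \<aa> (contracts (base \<aa>) L \<sigma>) = target \<aa> \<sigma>"
  using assms(2)
proof (induction L)
  case (Cons x L)
  obtain q \<psi> i where x: "x = ((q, \<psi>), i)" by (cases x) auto
  obtain m' where m': "first_pos L m \<le> m'" "contracts (base \<aa>) L \<sigma> \<in> simplices \<aa> (int m')"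
    using contracts_simplex[OF \<sigma>, of L] Cons.prems(1) x by auto
  then show ?case
    using Cons target_contract[OF m'(2), of i "i + q"] by (simp add: x contracts_Cons)
qed (simp add: contracts_Nil)

lemma (in map_graded) inserts_tuples:
  assumes \<sigma>: "\<sigma> \<in> simplices \<aa> (int m)" and "fits L m"
    and "\<And>q \<psi> i. ((q, \<psi>), i) \<in> set L \<Longrightarrow> \<psi> \<in> carrier (cochains R \<aa> (int q))"
    and fs: "fs \<in> tuples (sources \<aa> \<sigma>)"
  shows "inserts \<aa> L \<sigma> fs \<in> tuples (sources \<aa> (contracts (base \<aa>) L \<sigma>))"
  using assms(2,3)
proof (induction L)
  case (Cons x L)
  obtain q \<psi> i where x: "x = ((q, \<psi>), i)" by (cases x) auto
  obtain m' where m': "first_pos L m \<le> m'" "contracts (base \<aa>) L \<sigma> \<in> simplices \<aa> (int m')"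
    using contracts_simplex[OF \<sigma>, of L] Cons.prems(1) x by auto
  have le: "i + q \<le> m'" using Cons.prems m' x by simp
  let ?\<tau> = "contracts (base \<aa>) L \<sigma>"
  have IH: "inserts \<aa> L \<sigma> fs \<in> tuples (sources \<aa> ?\<tau>)"
  proof (rule Cons.IH)
    show "fits L m" using Cons.prems(1) x by simp
    show "\<psi>' \<in> carrier (cochains R \<aa> (int q'))" if "((q', \<psi>'), i') \<in> set L" for q' \<psi>' i'
      using Cons.prems(2)[of q' \<psi>' i'] that by simp
  qed
  have "\<psi> (seg i (i + q) ?\<tau>) (take q (drop i (inserts \<aa> L \<sigma> fs))) \<in> carrier (target \<aa> (seg i (i + q) ?\<tau>))"
    using Cons.prems(2)[of q \<psi> i] seg_simplex[OF m'(2), of i "i + q"] le x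
      tuples_take[OF tuples_drop[OF IH], of q i] sources_seg[OF m'(2), of i "i + q"]
    by (auto intro!: cochain_closed)
  then show ?case
    using tuples_splice[OF IH] sources_contract[OF m'(2), of i "i + q"] le
    by (simp add: x inserts_Cons contracts_Cons)
qed (use fs in \<open>simp add: contracts_Nil inserts_Nil\<close>)

text \<open>
  The degree of a brace is chosen such that contracting the arguments of all inserted cochains
  leaves a simplex of the dimension of the outer cochain.
\<close>

lemma (in map_graded) brace_simplex:
  assumes \<sigma>: "\<sigma> \<in> simplices \<aa> (int p + (\<Sum>(q, \<psi>)\<leftarrow>\<psi>s. int q - 1))" "\<sigma> \<in> simplices \<aa> (int m)"
    and ps: "ps \<in> placements (map fst \<psi>s) m"
  shows "contracts (base \<aa>) (zip \<psi>s ps) \<sigma> \<in> simplices \<aa> (int p)"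
proof -
  have m: "int m = int p + (\<Sum>(q, \<psi>)\<leftarrow>\<psi>s. int q - 1)"
    using \<sigma> by (auto simp: simplices_def)
  have "(\<Sum>((q, \<psi>), i)\<leftarrow>zip \<psi>s ps. 1 - int q) + (\<Sum>(q, \<psi>)\<leftarrow>\<psi>s. int q - 1) = 0" if "length ps = length \<psi>s"
    using that by (induction rule: list_induct2[OF that[symmetric]]) auto
  moreover have "length ps = length \<psi>s" using ps by (simp add: placements_def)
  ultimately have "int m + (\<Sum>((q, \<psi>), i)\<leftarrow>zip \<psi>s ps. 1 - int q) = int p"
    using m by simp
  then show ?thesis
    using contracts_simplex[OF \<sigma>(2) placements_fits[OF ps]] by auto
qed

context map_graded
begin

context
  fixes p :: nat and \<phi> :: "('o, 'm, 'a, 'x) cochain" and \<psi>s :: "(nat \<times> ('o, 'm, 'a, 'x) cochain) list"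
  assumes \<phi>: "\<phi> \<in> carrier (cochains R \<aa> (int p))"
    and \<psi>s: "\<And>q \<psi>. (q, \<psi>) \<in> set \<psi>s \<Longrightarrow> \<psi> \<in> carrier (cochains R \<aa> (int q))"
begin

lemma hbrace_summand_multilinear:
  assumes \<sigma>: "\<sigma> \<in> simplices \<aa> (int p + (\<Sum>(q, \<psi>)\<leftarrow>\<psi>s. int q - 1))" "\<sigma> \<in> simplices \<aa> (int m)"
    and ps: "ps \<in> placements (map fst \<psi>s) m"
  shows "multilinear R (sources \<aa> \<sigma>) (target \<aa> \<sigma>)
      (\<lambda>fs. \<phi> (contracts (base \<aa>) (zip \<psi>s ps) \<sigma>) (inserts \<aa> (zip \<psi>s ps) \<sigma> fs))"
proof (rule inserts_multilinear[OF \<sigma>(2) placements_fits[OF ps]])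
  show "\<psi> \<in> carrier (cochains R \<aa> (int q))" if "((q, \<psi>), i) \<in> set (zip \<psi>s ps)" for q \<psi> i
    using \<psi>s that by (auto dest: set_zip_leftD)
  show "multilinear R (sources \<aa> (contracts (base \<aa>) (zip \<psi>s ps) \<sigma>)) (target \<aa> \<sigma>)
      (\<phi> (contracts (base \<aa>) (zip \<psi>s ps) \<sigma>))"
    using cochain_multilinear[OF \<phi> brace_simplex[OF \<sigma> ps]]
      target_contracts[OF \<sigma>(2) placements_fits[OF ps]] by simp
qed

lemma hbrace_closed:
  "hbrace \<aa> p \<phi> \<psi>s \<in> carrier (cochains R \<aa> (int p + (\<Sum>(q, \<psi>)\<leftarrow>\<psi>s. int q - 1)))"
  unfolding hbrace_def
proof (rule cochainI)
  fix \<sigma> assume \<sigma>: "\<sigma> \<in> simplices \<aa> (int p + (\<Sum>(q, \<psi>)\<leftarrow>\<psi>s. int q - 1))"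
  then obtain m where \<sigma>m: "\<sigma> \<in> simplices \<aa> (int m)" using simplex_nat by metis
  have "multilinear R (sources \<aa> \<sigma>) (target \<aa> \<sigma>)
      (\<lambda>fs. \<Oplus>\<^bsub>target \<aa> \<sigma>\<^esub>ps\<in>placements (map fst \<psi>s) m.
        signed (target \<aa> \<sigma>) (\<Sum>((q, \<psi>), i)\<leftarrow>zip \<psi>s ps. (int q - 1) * int i)
          (\<phi> (contracts (base \<aa>) (zip \<psi>s ps) \<sigma>) (inserts \<aa> (zip \<psi>s ps) \<sigma> fs)))"
    by (intro multilinear_finsum multilinear_signed target_module[OF \<sigma>] hbrace_summand_multilinear[OF \<sigma> \<sigma>m])
  then show "multilinear R (sources \<aa> \<sigma>) (target \<aa> \<sigma>)
      (\<lambda>fs. \<Oplus>\<^bsub>target \<aa> \<sigma>\<^esub>ps\<in>placements (map fst \<psi>s) (length fs).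
        signed (target \<aa> \<sigma>) (\<Sum>((q, \<psi>), i)\<leftarrow>zip \<psi>s ps. (int q - 1) * int i)
          (case foldr (plug \<aa>) (zip \<psi>s ps) (\<sigma>, fs) of (\<sigma>', fs') \<Rightarrow> \<phi> \<sigma>' fs'))"
    by (rule multilinear_cong[OF source_module[OF \<sigma>], rotated 2])
      (auto simp: foldr_plug length_sources[OF \<sigma>m] dest!: tuples_length)
qed

end

end

section \<open>Closure of the \<open>B\<^sub>\<infinity>\<close>-operations\<close>

lemma words_hoch: "w \<in> words (hoch R \<aa>) \<longleftrightarrow> (\<forall>(n, x)\<in>set w. x \<in> carrier (cochains R \<aa> n))"
  by (simp add: words_def hoch_def)

lemma sdeg_nonneg:
  "\<forall>(n, x)\<in>set w. 0 \<le> n \<Longrightarrow> (\<Sum>(q, \<psi>)\<leftarrow>map (\<lambda>(q, \<psi>). (nat q, \<psi>)) w. int q - 1) = sdeg w"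
  by (induction w) (auto simp: sdeg_def)

lemma hoch_bop_zero:
  "\<lbrakk>\<And>x. w \<noteq> [x]; \<And>x y. w \<noteq> [x, y]\<rbrakk> \<Longrightarrow> bop (hoch R \<aa>) w = \<zero>\<^bsub>cochains R \<aa> (bdeg w)\<^esub>"
  by (auto simp: hoch_def split: list.splits)

lemma hoch_mop_zero:
  "(v = [] \<and> (\<forall>x. w \<noteq> [x])) \<or> (v \<noteq> [] \<and> (\<forall>x. v \<noteq> [x])) \<Longrightarrow>
    mop (hoch R \<aa>) v w = \<zero>\<^bsub>cochains R \<aa> (mdeg v w)\<^esub>"
  by (auto simp: hoch_def split: list.splits)

lemma (in map_graded) hoch_bop_closed:
  assumes w: "w \<in> words (hoch R \<aa>)"
  shows "bop (hoch R \<aa>) w \<in> carrier (cochains R \<aa> (bdeg w))"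
proof -
  consider "\<exists>(n, x)\<in>set w. n < 0"
    | p \<phi> where "w = [(p, \<phi>)]" "0 \<le> p"
    | p \<phi> q \<psi> where "w = [(p, \<phi>), (q, \<psi>)]" "0 \<le> p" "0 \<le> q"
    | "\<And>x. w \<noteq> [x]" "\<And>x y. w \<noteq> [x, y]"
    by (cases w rule: remdups_adj.cases) force+
  then show ?thesis
  proof cases
    case 1
    then show ?thesis using cochain_zero_closed by (simp add: hoch_def)
  next
    case (2 p \<phi>)
    then have "\<phi> \<in> carrier (cochains R \<aa> p)" using w by (simp add: words_hoch)
    then show ?thesis
      using 2 hdiff_closed[of \<phi> "nat p"]
      by (auto simp: hoch_def bdeg_def sdeg_def add.commute
          intro!: signed_closed cochains_abelian_group)
  next
    case (3 p \<phi> q \<psi>)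
    then have "\<phi> \<in> carrier (cochains R \<aa> p)" "\<psi> \<in> carrier (cochains R \<aa> q)"
      using w by (simp_all add: words_hoch)
    then show ?thesis
      using 3 hcup_closed[of \<phi> "nat p" \<psi> "nat q"]
      by (auto simp: hoch_def bdeg_def sdeg_def
          intro!: signed_closed cochains_abelian_group)
  next
    case 4
    then show ?thesis
      using cochain_zero_closed by (simp add: hoch_bop_zero)
  qed
qed

lemma (in map_graded) hoch_mop_closed:
  assumes v: "v \<in> words (hoch R \<aa>)" and w: "w \<in> words (hoch R \<aa>)"
  shows "mop (hoch R \<aa>) v w \<in> carrier (cochains R \<aa> (mdeg v w))"
proof -
  consider "\<exists>(n, x)\<in>set (v @ w). n < 0"
    | q \<psi> where "v = []" "w = [(q, \<psi>)]" "0 \<le> q"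
    | p \<phi> where "v = [(p, \<phi>)]" "0 \<le> p" "\<forall>(n, x)\<in>set w. 0 \<le> n"
    | "(v = [] \<and> (\<forall>x. w \<noteq> [x])) \<or> (v \<noteq> [] \<and> (\<forall>x. v \<noteq> [x]))"
    by (cases v rule: remdups_adj.cases; cases w rule: remdups_adj.cases) force+
  then show ?thesis
  proof cases
    case 1
    then show ?thesis using cochain_zero_closed by (simp add: hoch_def)
  next
    case (2 q \<psi>)
    then have "\<psi> \<in> carrier (cochains R \<aa> q)" using w by (simp add: words_hoch)
    then show ?thesis
      using 2 by (simp add: hoch_def mdeg_def sdeg_def)
  next
    case (3 p \<phi>)
    then have "hbrace \<aa> (nat p) \<phi> (map (\<lambda>(q, \<psi>). (nat q, \<psi>)) w) \<in>
        carrier (cochains R \<aa> (int (nat p) + (\<Sum>(q, \<psi>)\<leftarrow>map (\<lambda>(q, \<psi>). (nat q, \<psi>)) w. int q - 1)))"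
      using v w by (intro hbrace_closed) (auto simp: words_hoch)
    moreover have "int (nat p) + (\<Sum>(q, \<psi>)\<leftarrow>map (\<lambda>(q, \<psi>). (nat q, \<psi>)) w. int q - 1) = mdeg v w"
      unfolding sdeg_nonneg[OF 3(3)] using 3 by (simp add: mdeg_def sdeg_def)
    ultimately show ?thesis using 3 cochain_zero_closed
      by (auto simp: hoch_def)
  next
    case 4
    then show ?thesis
      using cochain_zero_closed by (simp add: hoch_mop_zero)
  qed
qed

section \<open>Restriction along a cartesian functor\<close>

lemma take_apply_each: "take n (apply_each \<theta>s xs) = apply_each (take n \<theta>s) (take n xs)"
  by (simp add: apply_each_def take_map take_zip)

lemma drop_apply_each: "drop n (apply_each \<theta>s xs) = apply_each (drop n \<theta>s) (drop n xs)"
  by (simp add: apply_each_def drop_map drop_zip)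

lemma splice_apply_each:
  assumes "length xs = length \<theta>s"
  shows "apply_each (splice i j \<theta> \<theta>s) (splice i j x xs) = splice i j (\<theta> x) (apply_each \<theta>s xs)"
  using assms by (simp add: apply_each_def splice_def take_map drop_map take_zip drop_zip)

lemma map_simplex_seg: "map_simplex F (seg i j \<sigma>) = seg i j (map_simplex F \<sigma>)"
  by (cases \<sigma>) (simp add: map_simplex_def seg_def take_map drop_map take_zip drop_zip)

text \<open>
  The isomorphisms which a cartesian functor induces at a simplex.  The second one is \<^const>\<open>map_args\<close>,
  written as an entrywise application of a list of maps, to which transport along isomorphisms applies.
\<close>

definition on_target :: "('k, 'o, 'm, 'a, 'x) mgcat \<Rightarrow> ('o, 'm, 'a, 'x, 'o', 'm', 'a', 'x') gfun \<Rightarrow>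
    ('o, 'm, 'a) simplex \<Rightarrow> 'x \<Rightarrow> 'x'" where
  "on_target \<bb> F = whole (base \<bb>) (fmor F)"

definition on_args :: "('o, 'm, 'a, 'x, 'o', 'm', 'a', 'x') gfun \<Rightarrow>
    ('o, 'm, 'a) simplex \<Rightarrow> 'x list \<Rightarrow> 'x' list" where
  "on_args F \<sigma> = apply_each (edges (fmor F) \<sigma>)"

lemma map_args_apply_each:
  assumes "\<sigma> \<in> simplices \<aa> (int m)" "length fs = m"
  shows "map_args F \<sigma> fs = apply_each (edges (fmor F) \<sigma>) fs"
  using assms length_edges[OF assms(1), of "fmor F"]
  by (intro nth_equalityI) (auto simp: map_args_def apply_each_def edge_nth[OF assms(1)])

lemma is_functor_path:
  assumes "category C" "is_functor C D fo fa" "(Us, us) \<in> nerve C m"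
  shows "path D (map fo Us, map fa us, Bs) = fa (path C (Us, us, As))"
  using assms(3)
proof (induction us arbitrary: Us m)
  case Nil
  then obtain U where "Us = [U]" "U \<in> Ob C" by (auto simp: nerve_def length_Suc_conv)
  then show ?case using assms(2) by (simp add: path_def is_functor_def)
next
  case (Cons u us)
  interpret category C by fact
  from Cons.prems(1) obtain U Us' where U: "Us = U # Us'" "(Us', us) \<in> nerve C (m - 1)"
    "u \<in> Arr C" "Dom C u = hd Us'" "Cod C u = U"
    by (rule nerve_Cons)
  have ne: "Us' \<noteq> []" using U(2) by (auto simp: nerve_def)
  have "path C (Us, u # us, As) = Comp C u (path C (Us', us, As))"
    "path D (map fo Us, map fa (u # us), Bs) = Comp D (fa u) (path D (map fo Us', map fa us, Bs))"
    using U(1) ne by (simp_all add: path_def)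
  then show ?case
    using Cons.IH[OF U(2)] path_arr[OF U(2), of As] U assms(2) by (simp add: is_functor_def)
qed

lemma map_word_degrees:
  "(\<exists>(n, x)\<in>set (map_word f w). n < 0) \<longleftrightarrow> (\<exists>(n, x)\<in>set w. n < 0)"
  "bdeg (map_word f w) = bdeg w" "mdeg (map_word f v) (map_word f w) = mdeg v w"
  by (auto simp: map_word_def bdeg_def mdeg_def sdeg_def comp_def case_prod_unfold)

locale cartesian_functor = src: map_graded R \<bb> + tgt: map_graded R \<aa>
  for R :: "'k ring" and \<bb> :: "('k, 'o1, 'm1, 'a1, 'x1) mgcat" and \<aa> :: "('k, 'o, 'm, 'a, 'x) mgcat" +
  fixes F :: "('o1, 'm1, 'a1, 'x1, 'o, 'm, 'a, 'x) gfun"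
  assumes cart: "cartesian R \<bb> \<aa> F"
begin

lemma graded: "graded_functor R \<bb> \<aa> F"
  using cart by (simp add: cartesian_def)

lemma base_functor: "is_functor (base \<bb>) (base \<aa>) (fob F) (farr F)"
  using graded by (simp add: graded_functor_def)

lemma base_functor_simps:
  "U \<in> Ob (base \<bb>) \<Longrightarrow> fob F U \<in> Ob (base \<aa>)"
  "u \<in> Arr (base \<bb>) \<Longrightarrow> farr F u \<in> Arr (base \<aa>)"
  "u \<in> Arr (base \<bb>) \<Longrightarrow> Dom (base \<aa>) (farr F u) = fob F (Dom (base \<bb>) u)"
  "u \<in> Arr (base \<bb>) \<Longrightarrow> Cod (base \<aa>) (farr F u) = fob F (Cod (base \<bb>) u)"
  using base_functor by (auto simp: is_functor_def)

lemma fobj_closed: "\<lbrakk>V \<in> Ob (base \<bb>); B \<in> gobj \<bb> V\<rbrakk> \<Longrightarrow> fobj F V B \<in> gobj \<aa> (fob F V)"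
  using graded by (auto simp: graded_functor_def)

lemma map_simplex_closed:
  assumes "\<sigma> \<in> simplices \<bb> n"
  shows "map_simplex F \<sigma> \<in> simplices \<aa> n"
  using assms by (cases \<sigma>) (auto simp: simplices_iff map_simplex_def nerve_iff base_functor_simps less_Suc_eq_le intro!: fobj_closed)

lemma path_map_simplex:
  "\<sigma> \<in> simplices \<bb> n \<Longrightarrow> path (base \<aa>) (map_simplex F \<sigma>) = farr F (path (base \<bb>) \<sigma>)"
  by (cases \<sigma>) (auto simp: simplices_iff map_simplex_def is_functor_path[OF src.base base_functor])

lemma map_simplex_contract:
  assumes "\<sigma> \<in> simplices \<bb> (int m)" "i \<le> j" "j \<le> m"
  shows "map_simplex F (contract (base \<bb>) i j \<sigma>) = contract (base \<aa>) i j (map_simplex F \<sigma>)"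
proof -
  obtain Us us As where \<sigma>: "\<sigma> = (Us, us, As)" by (cases \<sigma>)
  have len: "length As = length Us"
    using assms by (auto simp: \<sigma> simplices_iff)
  have "farr F (path (base \<bb>) (seg i j \<sigma>)) = path (base \<aa>) (seg i j (map_simplex F \<sigma>))"
    using path_map_simplex[OF seg_simplex[OF assms]] by (simp add: map_simplex_seg)
  then show ?thesis
    using len by (simp add: \<sigma> map_simplex_def contract_def take_map drop_map take_zip drop_zip)
qed

abbreviation target_map :: "('o1, 'm1, 'a1) simplex \<Rightarrow> 'x1 \<Rightarrow> 'x" where
  "target_map \<equiv> on_target \<bb> F"

abbreviation args_map :: "('o1, 'm1, 'a1) simplex \<Rightarrow> 'x1 list \<Rightarrow> 'x list" where
  "args_map \<equiv> on_args F"

lemma hpull_eq_inv: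
  assumes "\<sigma> \<in> simplices \<bb> n" "fs \<in> tuples (sources \<bb> \<sigma>)"
  shows "hpull \<bb> F n \<phi> \<sigma> fs =
    inv_into (carrier (target \<bb> \<sigma>)) (target_map \<sigma>) (\<phi> (map_simplex F \<sigma>) (args_map \<sigma> fs))"
proof -
  obtain m where n: "n = int m" using simplex_nat[OF assms(1)] by blast
  have "map_args F \<sigma> fs = args_map \<sigma> fs"
    using assms src.length_sources[of \<sigma> m] tuples_length[OF assms(2)]
    by (simp add: n on_args_def map_args_apply_each)
  then show ?thesis
    using assms by (cases \<sigma>) (simp add: hpull_def on_target_def whole_def)
qed

lemma map_simplex_vert:
  assumes "\<sigma> \<in> simplices \<bb> (int m)" "i \<le> j" "j \<le> m"
  shows "vert (map_simplex F \<sigma>) j = fobj F (Dom (base \<bb>) (path (base \<bb>) (seg i j \<sigma>))) (vert \<sigma> j)"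
    and "vert (map_simplex F \<sigma>) i = fobj F (Cod (base \<bb>) (path (base \<bb>) (seg i j \<sigma>))) (vert \<sigma> i)"
proof -
  obtain Us us As where \<sigma>: "\<sigma> = (Us, us, As)" by (cases \<sigma>)
  have Uu: "(Us, us) \<in> nerve (base \<bb>) m" and len: "length Us = Suc m" "length As = Suc m"
    using assms by (auto simp: \<sigma> simplices_iff nerve_iff)
  have "Dom (base \<bb>) (path (base \<bb>) (seg i j \<sigma>)) = Us ! j" "Cod (base \<bb>) (path (base \<bb>) (seg i j \<sigma>)) = Us ! i"
    using src.base.path_arr[OF nerve_seg[OF Uu assms(2,3)]] last_seg[OF assms(2), of Us] hd_seg[OF assms(2), of Us] assms len
    by (simp_all add: \<sigma> seg_def)
  then show "vert (map_simplex F \<sigma>) j = fobj F (Dom (base \<bb>) (path (base \<bb>) (seg i j \<sigma>))) (vert \<sigma> j)"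
    "vert (map_simplex F \<sigma>) i = fobj F (Cod (base \<bb>) (path (base \<bb>) (seg i j \<sigma>))) (vert \<sigma> i)"
    using assms len by (simp_all add: \<sigma> map_simplex_def vert_def)
qed

lemma target_iso:
  assumes "\<sigma> \<in> simplices \<bb> n"
  shows target_map_hom: "mod_hom R (target \<bb> \<sigma>) (target \<aa> (map_simplex F \<sigma>)) (target_map \<sigma>)"
    and target_map_bij: "bij_betw (target_map \<sigma>) (carrier (target \<bb> \<sigma>)) (carrier (target \<aa> (map_simplex F \<sigma>)))"
proof -
  obtain m where n: "n = int m" using simplex_nat[OF assms] by blast
  note \<sigma> = assms[unfolded n]
  have "target \<aa> (map_simplex F \<sigma>) = gmor \<aa> (farr F (path (base \<bb>) \<sigma>))
      (vert (map_simplex F \<sigma>) m) (vert (map_simplex F \<sigma>) 0)"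
    using path_map_simplex[OF \<sigma>] by (simp add: target_whole tgt.whole_simplex[OF map_simplex_closed[OF \<sigma>]])
  then have eq: "target \<aa> (map_simplex F \<sigma>) = gmor \<aa> (farr F (path (base \<bb>) \<sigma>))
      (fobj F (Dom (base \<bb>) (path (base \<bb>) \<sigma>)) (vert \<sigma> m)) (fobj F (Cod (base \<bb>) (path (base \<bb>) \<sigma>)) (vert \<sigma> 0))"
    using map_simplex_vert[OF \<sigma>, of 0 m] src.seg_full[OF \<sigma>] by simp
  have eq': "target \<bb> \<sigma> = gmor \<bb> (path (base \<bb>) \<sigma>) (vert \<sigma> m) (vert \<sigma> 0)"
    "target_map \<sigma> = fmor F (path (base \<bb>) \<sigma>) (vert \<sigma> m) (vert \<sigma> 0)"
    by (simp_all add: target_whole on_target_def src.whole_simplex[OF \<sigma>])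
  show "mod_hom R (target \<bb> \<sigma>) (target \<aa> (map_simplex F \<sigma>)) (target_map \<sigma>)"
    "bij_betw (target_map \<sigma>) (carrier (target \<bb> \<sigma>)) (carrier (target \<aa> (map_simplex F \<sigma>)))"
    unfolding eq eq'
    using src.simplex_path[OF \<sigma>, of 0 m] src.seg_full[OF \<sigma>] graded cart
    by (auto simp: cartesian_def graded_functor_def)
qed

lemma edge_target_map:
  assumes "\<sigma> \<in> simplices \<bb> (int m)" "i < m"
  shows "target_map (seg i (Suc i) \<sigma>) = edges (fmor F) \<sigma> ! i"
  using assms src.simplex_edge[OF assms]
  by (simp add: on_target_def whole_seg[OF assms(1)] edge_nth[OF assms])

text \<open>
  A single edge is a simplex whose composite is the edge itself, so that the statement about
  targets applies to it.
\<close>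

lemma sources_iso:
  assumes "\<sigma> \<in> simplices \<bb> n"
  shows "mod_isos R (sources \<bb> \<sigma>) (sources \<aa> (map_simplex F \<sigma>)) (edges (fmor F) \<sigma>)"
proof -
  obtain m where n: "n = int m" using simplex_nat[OF assms] by blast
  note \<sigma> = assms[unfolded n]
  have "mod_hom R (sources \<bb> \<sigma> ! i) (sources \<aa> (map_simplex F \<sigma>) ! i) (edges (fmor F) \<sigma> ! i) \<and>
      bij_betw (edges (fmor F) \<sigma> ! i) (carrier (sources \<bb> \<sigma> ! i)) (carrier (sources \<aa> (map_simplex F \<sigma>) ! i))"
    if "i < m" for i
    using target_iso[OF seg_simplex[OF \<sigma>, of i "Suc i"]] that edge_target_map[OF \<sigma> that]
      src.edge_target[OF \<sigma> that] tgt.edge_target[OF map_simplex_closed[OF \<sigma>] that]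
    by (simp add: map_simplex_seg)
  then show ?thesis
    by (simp add: mod_isos_def length_edges[OF \<sigma>] src.length_sources[OF \<sigma>] tgt.length_sources[OF map_simplex_closed[OF \<sigma>]])
qed

lemma args_map_closed:
  "\<lbrakk>\<sigma> \<in> simplices \<bb> n; fs \<in> tuples (sources \<bb> \<sigma>)\<rbrakk> \<Longrightarrow> args_map \<sigma> fs \<in> tuples (sources \<aa> (map_simplex F \<sigma>))"
  unfolding on_args_def by (rule apply_each_tuples[OF sources_iso])

lemma args_map_bij:
  "\<sigma> \<in> simplices \<bb> n \<Longrightarrow> bij_betw (args_map \<sigma>) (tuples (sources \<bb> \<sigma>)) (tuples (sources \<aa> (map_simplex F \<sigma>)))"
  unfolding on_args_def by (rule bij_betw_apply_each[OF sources_iso])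

lemma args_map_seg:
  assumes "\<sigma> \<in> simplices \<bb> (int m)" "i \<le> j" "j \<le> m"
  shows "args_map (seg i j \<sigma>) (take (j - i) (drop i fs)) = take (j - i) (drop i (args_map \<sigma> fs))"
  by (simp add: on_args_def edges_seg[OF assms] take_apply_each drop_apply_each)

lemma args_map_contract:
  assumes "\<sigma> \<in> simplices \<bb> (int m)" "i \<le> j" "j \<le> m" "fs \<in> tuples (sources \<bb> \<sigma>)"
  shows "args_map (contract (base \<bb>) i j \<sigma>) (splice i j x fs) = splice i j (target_map (seg i j \<sigma>) x) (args_map \<sigma> fs)"
  using tuples_length[OF assms(4)] src.length_sources[OF assms(1)]
  by (simp add: length_edges[OF assms(1)] on_args_def on_target_def edges_contract[OF assms(1-3)] splice_apply_each)

lemma args_map_nth: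
  assumes "\<sigma> \<in> simplices \<bb> (int m)" "fs \<in> tuples (sources \<bb> \<sigma>)" "i < m"
  shows "args_map \<sigma> fs ! i = target_map (seg i (Suc i) \<sigma>) (fs ! i)"
  using assms tuples_length[OF assms(2)] src.length_sources[OF assms(1)]
  by (simp add: length_edges[OF assms(1)] on_args_def apply_each_def edge_target_map[OF assms(1,3)])

lemma target_map_contract:
  assumes "\<sigma> \<in> simplices \<bb> (int m)" "i \<le> j" "j \<le> m"
  shows "target_map (contract (base \<bb>) i j \<sigma>) = target_map \<sigma>"
  by (simp add: on_target_def src.whole_contract[OF assms])

text \<open>
  Apart from linearity and the behaviour of faces, this consequence of functoriality is all that the
  naturality of the operations depends on.
\<close>

lemma target_map_comp:
  assumes \<sigma>: "\<sigma> \<in> simplices \<bb> (int m)" and ijk: "i \<le> j" "j \<le> k" "k \<le> m"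
    and g: "g \<in> carrier (target \<bb> (seg i j \<sigma>))" and f: "f \<in> carrier (target \<bb> (seg j k \<sigma>))"
  shows "target_map (seg i k \<sigma>)
     (gcmp \<bb> (path (base \<bb>) (seg i j \<sigma>)) (path (base \<bb>) (seg j k \<sigma>)) (vert \<sigma> k) (vert \<sigma> j) (vert \<sigma> i) g f) =
   gcmp \<aa> (path (base \<aa>) (seg i j (map_simplex F \<sigma>))) (path (base \<aa>) (seg j k (map_simplex F \<sigma>)))
     (vert (map_simplex F \<sigma>) k) (vert (map_simplex F \<sigma>) j) (vert (map_simplex F \<sigma>) i)
     (target_map (seg i j \<sigma>) g) (target_map (seg j k \<sigma>) f)"
proof -
  obtain Us us As where S: "\<sigma> = (Us, us, As)" by (cases \<sigma>)
  have Uu: "(Us, us) \<in> nerve (base \<bb>) m" and len: "length Us = Suc m"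
    using \<sigma> by (auto simp: S simplices_iff nerve_iff)
  have "Dom (base \<bb>) (path (base \<bb>) (seg i j \<sigma>)) = Us ! j" "Cod (base \<bb>) (path (base \<bb>) (seg j k \<sigma>)) = Us ! j"
    using src.base.path_arr[OF nerve_seg[OF Uu], of i j] src.base.path_arr[OF nerve_seg[OF Uu], of j k]
      last_seg[of i j Us] hd_seg[of j k Us] ijk len
    by (simp_all add: S seg_def)
  then have eq: "Cod (base \<bb>) (path (base \<bb>) (seg j k \<sigma>)) = Dom (base \<bb>) (path (base \<bb>) (seg i j \<sigma>))"
    by simp
  have ik: "i \<le> k" using ijk by simp
  have jm: "j \<le> m" using ijk by simp
  note P = src.simplex_path[OF \<sigma> ijk(1) jm] src.simplex_path[OF \<sigma> ijk(2,3)]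
  have pth: "path (base \<aa>) (seg a b (map_simplex F \<sigma>)) = farr F (path (base \<bb>) (seg a b \<sigma>))" if "a \<le> b" "b \<le> m" for a b
    using path_map_simplex[OF seg_simplex[OF \<sigma> that]] by (simp add: map_simplex_seg)
  have T: "target \<bb> (seg i j \<sigma>) = gmor \<bb> (path (base \<bb>) (seg i j \<sigma>)) (vert \<sigma> j) (vert \<sigma> i)"
    "target \<bb> (seg j k \<sigma>) = gmor \<bb> (path (base \<bb>) (seg j k \<sigma>)) (vert \<sigma> k) (vert \<sigma> j)"
    using ijk by (simp_all add: target_whole whole_seg[OF \<sigma>])
  have "target_map (seg i k \<sigma>) = fmor F (Comp (base \<bb>) (path (base \<bb>) (seg i j \<sigma>)) (path (base \<bb>) (seg j k \<sigma>))) (vert \<sigma> k) (vert \<sigma> i)"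
    "target_map (seg i j \<sigma>) = fmor F (path (base \<bb>) (seg i j \<sigma>)) (vert \<sigma> j) (vert \<sigma> i)"
    "target_map (seg j k \<sigma>) = fmor F (path (base \<bb>) (seg j k \<sigma>)) (vert \<sigma> k) (vert \<sigma> j)"
    using ijk by (simp_all add: on_target_def whole_seg[OF \<sigma>] src.seg_comp[OF \<sigma>])
  then show ?thesis
    using graded P eq g f
    by (simp add: pth ijk jm map_simplex_vert(1)[OF \<sigma> ijk(2,3)] map_simplex_vert(2)[OF \<sigma> ijk(2,3)]
        map_simplex_vert(2)[OF \<sigma> ijk(1) jm] T graded_functor_def)
qed

lemma target_abelian:
  assumes "\<sigma> \<in> simplices \<bb> n"
  shows "abelian_group (target \<bb> \<sigma>)" "abelian_group (target \<aa> (map_simplex F \<sigma>))"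
  using src.target_module[OF assms] tgt.target_module[OF map_simplex_closed[OF assms]]
  by (auto dest: module.axioms)

lemma target_map_inv:
  assumes "\<sigma> \<in> simplices \<bb> n" "y \<in> carrier (target \<aa> (map_simplex F \<sigma>))"
  shows "inv_into (carrier (target \<bb> \<sigma>)) (target_map \<sigma>) y \<in> carrier (target \<bb> \<sigma>)"
    and "target_map \<sigma> (inv_into (carrier (target \<bb> \<sigma>)) (target_map \<sigma>) y) = y"
  using target_map_bij[OF assms(1)] assms(2)
  by (auto simp: bij_betw_def intro: inv_into_into f_inv_into_f)

lemma hpull_apply:
  assumes "\<phi> \<in> carrier (cochains R \<aa> n)" "\<sigma> \<in> simplices \<bb> n" "fs \<in> tuples (sources \<bb> \<sigma>)"
  shows "hpull \<bb> F n \<phi> \<sigma> fs \<in> carrier (target \<bb> \<sigma>)"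
    and "target_map \<sigma> (hpull \<bb> F n \<phi> \<sigma> fs) = \<phi> (map_simplex F \<sigma>) (args_map \<sigma> fs)"
  using target_map_inv[OF assms(2)] cochain_closed[OF assms(1) map_simplex_closed[OF assms(2)] args_map_closed[OF assms(2,3)]]
  by (simp_all add: hpull_eq_inv[OF assms(2,3)])

lemma hpull_closed:
  assumes "\<phi> \<in> carrier (cochains R \<aa> n)"
  shows "hpull \<bb> F n \<phi> \<in> carrier (cochains R \<bb> n)"
proof -
  have "multilinear R (sources \<bb> \<sigma>) (target \<bb> \<sigma>) (hpull \<bb> F n \<phi> \<sigma>)" if \<sigma>: "\<sigma> \<in> simplices \<bb> n" for \<sigma>
    by (rule multilinear_pull[OF sources_iso[OF \<sigma>] src.source_module[OF \<sigma>] src.target_module[OF \<sigma>] target_map_hom[OF \<sigma>] _ _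
          cochain_multilinear[OF assms map_simplex_closed[OF \<sigma>]]])
      (use target_map_bij[OF \<sigma>] hpull_apply[OF assms \<sigma>] in \<open>auto simp: bij_betw_def on_args_def\<close>)
  then show ?thesis
    by (auto simp: cochains_iff hpull_def)
qed

text \<open>
  The isomorphisms on targets are injective, so that a restricted cochain can be recognised after
  mapping its values to \<open>\<aa>\<close>.  Compatibility of restriction with the differential, the cup product and
  the braces is proved in this way.
\<close>

lemma hpull_eqI:
  assumes \<psi>: "\<psi> \<in> carrier (cochains R \<bb> n)"
    and eq: "\<And>\<sigma> fs. \<lbrakk>\<sigma> \<in> simplices \<bb> n; fs \<in> tuples (sources \<bb> \<sigma>)\<rbrakk> \<Longrightarrow>
      target_map \<sigma> (\<psi> \<sigma> fs) = \<phi> (map_simplex F \<sigma>) (args_map \<sigma> fs)"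
  shows "hpull \<bb> F n \<phi> = \<psi>"
proof (rule extensionalityI[of _ "simplices \<bb> n"])
  fix \<sigma> assume \<sigma>: "\<sigma> \<in> simplices \<bb> n"
  show "hpull \<bb> F n \<phi> \<sigma> = \<psi> \<sigma>"
  proof (rule extensionalityI[of _ "tuples (sources \<bb> \<sigma>)"])
    fix fs assume fs: "fs \<in> tuples (sources \<bb> \<sigma>)"
    show "hpull \<bb> F n \<phi> \<sigma> fs = \<psi> \<sigma> fs"
      using target_map_bij[OF \<sigma>] cochain_closed[OF \<psi> \<sigma> fs]
      by (simp add: hpull_eq_inv[OF \<sigma> fs] bij_betw_def flip: eq[OF \<sigma> fs])
  qed (use \<sigma> \<psi> in \<open>auto simp: hpull_def cochains_iff\<close>)
qed (use \<psi> in \<open>auto simp: hpull_def cochains_iff\<close>)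

lemma hpull_hom: "mod_hom R (cochains R \<aa> n) (cochains R \<bb> n) (hpull \<bb> F n)"
proof (rule mod_homI)
  fix \<phi> \<psi> assume \<phi>: "\<phi> \<in> carrier (cochains R \<aa> n)" and \<psi>: "\<psi> \<in> carrier (cochains R \<aa> n)"
  show "hpull \<bb> F n (\<phi> \<oplus>\<^bsub>cochains R \<aa> n\<^esub> \<psi>) = hpull \<bb> F n \<phi> \<oplus>\<^bsub>cochains R \<bb> n\<^esub> hpull \<bb> F n \<psi>"
    by (intro hpull_eqI src.cochain_add_closed hpull_closed \<phi> \<psi>)
      (simp add: src.cochain_apply tgt.cochain_apply map_simplex_closed args_map_closed
        mod_hom_add[OF target_map_hom] hpull_apply[OF \<phi>] hpull_apply[OF \<psi>])
next
  fix c \<phi> assume c: "c \<in> carrier R" and \<phi>: "\<phi> \<in> carrier (cochains R \<aa> n)"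
  show "hpull \<bb> F n (c \<odot>\<^bsub>cochains R \<aa> n\<^esub> \<phi>) = c \<odot>\<^bsub>cochains R \<bb> n\<^esub> hpull \<bb> F n \<phi>"
    by (intro hpull_eqI src.cochain_smult_closed hpull_closed c \<phi>)
      (simp add: src.cochain_apply tgt.cochain_apply map_simplex_closed args_map_closed
        mod_hom_smult[OF target_map_hom] hpull_apply[OF \<phi>] c)
qed (rule hpull_closed)

lemma hpull_zero: "hpull \<bb> F n \<zero>\<^bsub>cochains R \<aa> n\<^esub> = \<zero>\<^bsub>cochains R \<bb> n\<^esub>"
  by (rule mod_hom_zero[OF hpull_hom tgt.cochains_abelian_group src.cochains_abelian_group])

lemma hpull_hcup:
  assumes \<phi>: "\<phi> \<in> carrier (cochains R \<aa> (int p))" and \<psi>: "\<psi> \<in> carrier (cochains R \<aa> (int q))"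
  shows "hpull \<bb> F (int p + int q) (hcup \<aa> p \<phi> q \<psi>) =
    hcup \<bb> p (hpull \<bb> F (int p) \<phi>) q (hpull \<bb> F (int q) \<psi>)"
proof (rule hpull_eqI[OF src.hcup_closed[OF hpull_closed[OF \<phi>] hpull_closed[OF \<psi>]]])
  fix \<sigma> fs assume \<sigma>: "\<sigma> \<in> simplices \<bb> (int p + int q)" and fs: "fs \<in> tuples (sources \<bb> \<sigma>)"
  have \<sigma>': "\<sigma> \<in> simplices \<bb> (int (p + q))" using \<sigma> by simp
  note s1 = seg_simplex[OF \<sigma>', of 0 p, simplified] and s2 = seg_simplex[OF \<sigma>', of p "p + q", simplified]
  have f1: "take p fs \<in> tuples (sources \<bb> (seg 0 p \<sigma>))" "drop p fs \<in> tuples (sources \<bb> (seg p (p + q) \<sigma>))"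
    using tuples_take[OF fs, of p] tuples_drop[OF fs, of p] src.length_sources[OF \<sigma>']
    by (simp_all add: src.sources_seg[OF \<sigma>'])
  have len: "length fs = p + q" using tuples_length[OF fs] src.length_sources[OF \<sigma>'] by simp
  have len': "length (args_map \<sigma> fs) = p + q"
    using tuples_length[OF args_map_closed[OF \<sigma> fs]] tgt.length_sources[OF map_simplex_closed[OF \<sigma>']] by simp
  have a: "args_map (seg 0 p \<sigma>) (take p fs) = take p (args_map \<sigma> fs)"
    "args_map (seg p (p + q) \<sigma>) (drop p fs) = drop p (args_map \<sigma> fs)"
    using args_map_seg[OF \<sigma>', of 0 p fs] args_map_seg[OF \<sigma>', of p "p + q" fs] len len' by simp_all
  show "target_map \<sigma> (hcup \<bb> p (hpull \<bb> F (int p) \<phi>) q (hpull \<bb> F (int q) \<psi>) \<sigma> fs) =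
      hcup \<aa> p \<phi> q \<psi> (map_simplex F \<sigma>) (args_map \<sigma> fs)"
    using target_map_comp[OF \<sigma>', of 0 p "p + q" "hpull \<bb> F (int p) \<phi> (seg 0 p \<sigma>) (take p fs)"
        "hpull \<bb> F (int q) \<psi> (seg p (p + q) \<sigma>) (drop p fs)"]
      hpull_apply[OF \<phi> s1 f1(1)] hpull_apply[OF \<psi> s2 f1(2)] src.seg_full[OF \<sigma>']
    by (simp add: hcup_def \<sigma> fs map_simplex_closed[OF \<sigma>] args_map_closed[OF \<sigma> fs] a map_simplex_seg)
qed

lemma hpull_hdiff:
  assumes \<phi>: "\<phi> \<in> carrier (cochains R \<aa> (int p))"
  shows "hpull \<bb> F (int p + 1) (hdiff \<aa> p \<phi>) = hdiff \<bb> p (hpull \<bb> F (int p) \<phi>)"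
proof (rule hpull_eqI[OF src.hdiff_closed[OF hpull_closed[OF \<phi>]]])
  fix \<sigma> fs assume \<sigma>: "\<sigma> \<in> simplices \<bb> (int p + 1)" and fs: "fs \<in> tuples (sources \<bb> \<sigma>)"
  have \<sigma>': "\<sigma> \<in> simplices \<bb> (int (Suc p))" using \<sigma> by (simp add: add.commute)
  let ?\<psi> = "hpull \<bb> F (int p) \<phi>" and ?T = "target \<bb> \<sigma>" and ?T' = "target \<aa> (map_simplex F \<sigma>)"
    and ?\<tau> = "map_simplex F \<sigma>" and ?gs = "args_map \<sigma> fs"
  note \<psi> = hpull_closed[OF \<phi>]
  note \<tau> = map_simplex_closed[OF \<sigma>]
  note hom = target_map_hom[OF \<sigma>] and ab = target_abelian[OF \<sigma>]
  interpret T: abelian_group ?T by (rule ab(1))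
  have len: "length fs = Suc p" using tuples_length[OF fs] src.length_sources[OF \<sigma>'] by simp
  have len': "length ?gs = Suc p"
    using tuples_length[OF args_map_closed[OF \<sigma> fs]] tgt.length_sources[OF map_simplex_closed[OF \<sigma>']] by simp
  have nth: "?gs ! i = target_map (seg i (Suc i) \<sigma>) (fs ! i)" if "i < Suc p" for i
    by (rule args_map_nth[OF \<sigma>' fs that])
  have nthc: "fs ! i \<in> carrier (target \<bb> (seg i (Suc i) \<sigma>))" if "i < Suc p" for i
    using tuples_nth[OF fs, of i] that src.edge_target[OF \<sigma>' that] src.length_sources[OF \<sigma>'] by simp
  have edge: "path (base \<bb>) (seg i (Suc i) \<sigma>) = edge \<sigma> i" "path (base \<aa>) (seg i (Suc i) ?\<tau>) = edge ?\<tau> i"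
    if "i < Suc p" for i
    using that src.simplex_edge[OF \<sigma>'] tgt.simplex_edge[OF map_simplex_closed[OF \<sigma>']] by auto
  let ?a = "gcmp \<bb> (edge \<sigma> 0) (path (base \<bb>) (seg 1 (Suc p) \<sigma>)) (vert \<sigma> (Suc p)) (vert \<sigma> 1) (vert \<sigma> 0)
       (fs ! 0) (?\<psi> (seg 1 (Suc p) \<sigma>) (tl fs))"
  let ?b = "\<lambda>i. ?\<psi> (contract (base \<bb>) i (i + 2) \<sigma>)
          (splice i (i + 2)
            (gcmp \<bb> (edge \<sigma> i) (edge \<sigma> (i + 1)) (vert \<sigma> (i + 2)) (vert \<sigma> (i + 1)) (vert \<sigma> i)
              (fs ! i) (fs ! (i + 1))) fs)"
  let ?c = "gcmp \<bb> (path (base \<bb>) (seg 0 p \<sigma>)) (edge \<sigma> p) (vert \<sigma> (Suc p)) (vert \<sigma> p) (vert \<sigma> 0)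
         (?\<psi> (seg 0 p \<sigma>) (butlast fs)) (fs ! p)"
  have a: "?a \<in> carrier ?T"
    by (rule multilinear_closed[OF src.hdiff_first_multilinear[OF \<psi> \<sigma>'] fs])
  have b: "?b i \<in> carrier ?T" if "i < p" for i
    by (rule multilinear_closed[OF src.hdiff_inner_multilinear[OF \<psi> \<sigma>' that] fs])
  have c: "?c \<in> carrier ?T"
    by (rule multilinear_closed[OF src.hdiff_last_multilinear[OF \<psi> \<sigma>'] fs])
  have a': "target_map \<sigma> ?a = gcmp \<aa> (edge ?\<tau> 0) (path (base \<aa>) (seg 1 (Suc p) ?\<tau>)) (vert ?\<tau> (Suc p)) (vert ?\<tau> 1) (vert ?\<tau> 0)
       (?gs ! 0) (\<phi> (seg 1 (Suc p) ?\<tau>) (tl ?gs))"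
  proof -
    have s: "seg 1 (Suc p) \<sigma> \<in> simplices \<bb> (int p)" using seg_simplex[OF \<sigma>', of 1 "Suc p"] by simp
    have f: "tl fs \<in> tuples (sources \<bb> (seg 1 (Suc p) \<sigma>))"
      using tuples_drop[OF fs, of 1] src.length_sources[OF \<sigma>'] by (simp add: src.sources_seg[OF \<sigma>'] drop_Suc)
    have "args_map (seg 1 (Suc p) \<sigma>) (tl fs) = tl ?gs"
      using args_map_seg[OF \<sigma>', of 1 "Suc p" fs] len len' by (simp add: drop_Suc)
    then show ?thesis
      using target_map_comp[OF \<sigma>', of 0 1 "Suc p" "fs ! 0" "?\<psi> (seg 1 (Suc p) \<sigma>) (tl fs)"]
        hpull_apply[OF \<phi> s f] src.seg_full[OF \<sigma>'] nth[of 0] nthc[of 0] edge[of 0]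
      by (simp add: map_simplex_seg)
  qed
  have c': "target_map \<sigma> ?c = gcmp \<aa> (path (base \<aa>) (seg 0 p ?\<tau>)) (edge ?\<tau> p) (vert ?\<tau> (Suc p)) (vert ?\<tau> p) (vert ?\<tau> 0)
         (\<phi> (seg 0 p ?\<tau>) (butlast ?gs)) (?gs ! p)"
  proof -
    have s: "seg 0 p \<sigma> \<in> simplices \<bb> (int p)" using seg_simplex[OF \<sigma>', of 0 p] by simp
    have f: "butlast fs \<in> tuples (sources \<bb> (seg 0 p \<sigma>))"
      using tuples_take[OF fs, of p] len by (simp add: src.sources_seg[OF \<sigma>'] butlast_conv_take)
    have "args_map (seg 0 p \<sigma>) (butlast fs) = butlast ?gs"
      using args_map_seg[OF \<sigma>', of 0 p fs] len len' by (simp add: butlast_conv_take)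
    then show ?thesis
      using target_map_comp[OF \<sigma>', of 0 p "Suc p" "?\<psi> (seg 0 p \<sigma>) (butlast fs)" "fs ! p"]
        hpull_apply[OF \<phi> s f] src.seg_full[OF \<sigma>'] nth[of p] nthc[of p] edge[of p]
      by (simp add: map_simplex_seg)
  qed
  let ?b' = "\<lambda>i. \<phi> (contract (base \<aa>) i (i + 2) ?\<tau>)
          (splice i (i + 2)
            (gcmp \<aa> (edge ?\<tau> i) (edge ?\<tau> (i + 1)) (vert ?\<tau> (i + 2)) (vert ?\<tau> (i + 1)) (vert ?\<tau> i)
              (?gs ! i) (?gs ! (i + 1))) ?gs)"
  have b': "target_map \<sigma> (?b i) = ?b' i" if i: "i < p" for i
  proof -
    let ?x = "gcmp \<bb> (edge \<sigma> i) (edge \<sigma> (i + 1)) (vert \<sigma> (i + 2)) (vert \<sigma> (i + 1)) (vert \<sigma> i) (fs ! i) (fs ! (i + 1))"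
    have s: "contract (base \<bb>) i (i + 2) \<sigma> \<in> simplices \<bb> (int p)"
      using src.contract_simplex[OF \<sigma>', of i "i + 2"] i by simp
    have "[fs ! i, fs ! (i + 1)] \<in> tuples [target \<bb> (seg i (i + 1) \<sigma>), target \<bb> (seg (i + 1) (i + 2) \<sigma>)]"
      using nthc[of i] nthc[of "Suc i"] i by (simp add: tuples_def)
    from multilinear_closed[OF src.comp_multilinear[OF \<sigma>', of i "i + 1" "i + 2"] this]
    have x: "?x \<in> carrier (target \<bb> (seg i (i + 2) \<sigma>))"
      using i edge[of i] edge[of "Suc i"] by simp
    have f: "splice i (i + 2) ?x fs \<in> tuples (sources \<bb> (contract (base \<bb>) i (i + 2) \<sigma>))"
      using tuples_splice[OF fs x] src.sources_contract[OF \<sigma>', of i "i + 2"] i by simp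
    show ?thesis
      using hpull_apply(2)[OF \<phi> s f] i target_map_contract[OF \<sigma>', of i "i + 2"]
        map_simplex_contract[OF \<sigma>', of i "i + 2"] args_map_contract[OF \<sigma>' _ _ fs, of i "i + 2" ?x]
        target_map_comp[OF \<sigma>', of i "i + 1" "i + 2" "fs ! i" "fs ! (i + 1)"]
        nth[of i] nthc[of i] nth[of "Suc i"] nthc[of "Suc i"] edge[of i] edge[of "Suc i"]
      by simp
  qed
  have bs: "(\<lambda>i. signed ?T (int i + 1) (?b i)) \<in> {..<p} \<rightarrow> carrier ?T"
    using b by (auto intro: signed_closed[OF ab(1)])
  have "target_map \<sigma> (?a \<oplus>\<^bsub>?T\<^esub> (\<Oplus>\<^bsub>?T\<^esub>i\<in>{..<p}. signed ?T (int i + 1) (?b i)) \<oplus>\<^bsub>?T\<^esub> signed ?T (int p + 1) ?c) =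
      target_map \<sigma> ?a \<oplus>\<^bsub>?T'\<^esub> (\<Oplus>\<^bsub>?T'\<^esub>i\<in>{..<p}. target_map \<sigma> (signed ?T (int i + 1) (?b i))) \<oplus>\<^bsub>?T'\<^esub>
        signed ?T' (int p + 1) (target_map \<sigma> ?c)"
    using a c bs by (simp add: mod_hom_add[OF hom] mod_hom_finsum[OF hom ab] mod_hom_signed[OF hom ab]
        signed_closed[OF ab(1)] T.finsum_closed)
  also have "(\<Oplus>\<^bsub>?T'\<^esub>i\<in>{..<p}. target_map \<sigma> (signed ?T (int i + 1) (?b i))) =
      (\<Oplus>\<^bsub>?T'\<^esub>i\<in>{..<p}. signed ?T' (int i + 1) (target_map \<sigma> (?b i)))"
    using b by (intro abelian_monoid.finsum_cong'[OF abelian_group.axioms(1)[OF ab(2)]])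
      (auto simp: mod_hom_signed[OF hom ab] intro!: signed_closed[OF ab(2)] mod_hom_closed[OF hom])
  also have "\<dots> = (\<Oplus>\<^bsub>?T'\<^esub>i\<in>{..<p}. signed ?T' (int i + 1) (?b' i))"
  proof (rule abelian_monoid.finsum_cong'[OF abelian_group.axioms(1)[OF ab(2)] refl])
    show "(\<lambda>i. signed ?T' (int i + 1) (?b' i)) \<in> {..<p} \<rightarrow> carrier ?T'"
    proof (rule Pi_I)
      fix i assume "i \<in> {..<p}"
      then have i: "i < p" by simp
      show "signed ?T' (int i + 1) (?b' i) \<in> carrier ?T'"
        using signed_closed[OF ab(2) mod_hom_closed[OF hom b[OF i]]] unfolding b'[OF i] .
    qed
    show "signed ?T' (int i + 1) (target_map \<sigma> (?b i)) = signed ?T' (int i + 1) (?b' i)" if "i \<in> {..<p}" for i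
      using b'[of i] that by (simp only: lessThan_iff)
  qed
  finally show "target_map \<sigma> (hdiff \<bb> p ?\<psi> \<sigma> fs) = hdiff \<aa> p \<phi> ?\<tau> ?gs"
    unfolding hdiff_def restrict_apply'[OF \<sigma>] restrict_apply'[OF \<tau>] restrict_apply'[OF fs]
      restrict_apply'[OF args_map_closed[OF \<sigma> fs]] a' c' .
qed

definition pull_inner :: "(nat \<times> ('o, 'm, 'a, 'x) cochain) list \<Rightarrow> (nat \<times> ('o1, 'm1, 'a1, 'x1) cochain) list" where
  "pull_inner = map (\<lambda>(q, \<psi>). (q, hpull \<bb> F (int q) \<psi>))"

text \<open>
  Restriction commutes with every single insertion, hence, from the last one to the first one, with
  all of them.
\<close>

lemma inserts_pull:
  assumes \<sigma>: "\<sigma> \<in> simplices \<bb> (int m)" and fs: "fs \<in> tuples (sources \<bb> \<sigma>)"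
    and "length ps = length \<psi>s" "fits (zip (pull_inner \<psi>s) ps) m"
    and "\<And>q \<psi>. (q, \<psi>) \<in> set \<psi>s \<Longrightarrow> \<psi> \<in> carrier (cochains R \<aa> (int q))"
  shows "map_simplex F (contracts (base \<bb>) (zip (pull_inner \<psi>s) ps) \<sigma>) = contracts (base \<aa>) (zip \<psi>s ps) (map_simplex F \<sigma>) \<and>
    args_map (contracts (base \<bb>) (zip (pull_inner \<psi>s) ps) \<sigma>) (inserts \<bb> (zip (pull_inner \<psi>s) ps) \<sigma> fs) =
      inserts \<aa> (zip \<psi>s ps) (map_simplex F \<sigma>) (args_map \<sigma> fs) \<and>
    target_map (contracts (base \<bb>) (zip (pull_inner \<psi>s) ps) \<sigma>) = target_map \<sigma>"
  using assms(3-)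
proof (induction ps \<psi>s rule: list_induct2)
  case Nil
  then show ?case by (simp add: contracts_Nil inserts_Nil)
next
  case (Cons i ps x \<psi>s)
  obtain q \<psi> where x: "x = (q, \<psi>)" by (cases x)
  let ?L = "zip (pull_inner \<psi>s) ps" and ?\<psi> = "hpull \<bb> F (int q) \<psi>"
  have L: "zip (pull_inner (x # \<psi>s)) (i # ps) = ((q, ?\<psi>), i) # ?L"
    by (simp add: pull_inner_def x)
  have fit: "fits ?L m" "i + q \<le> first_pos ?L m" using Cons.prems(1) by (simp_all add: L)
  have \<psi>: "\<psi> \<in> carrier (cochains R \<aa> (int q))" using Cons.prems(2) x by simp
  have \<psi>s: "\<psi>' \<in> carrier (cochains R \<aa> (int q'))" if "(q', \<psi>') \<in> set \<psi>s" for q' \<psi>'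
    using Cons.prems(2) that by simp
  have inner: "\<psi>' \<in> carrier (cochains R \<bb> (int q'))" if "((q', \<psi>'), i') \<in> set ?L" for q' \<psi>' i'
    using set_zip_leftD[OF that] \<psi>s by (auto simp: pull_inner_def intro: hpull_closed)
  obtain m' where m': "first_pos ?L m \<le> m'" "contracts (base \<bb>) ?L \<sigma> \<in> simplices \<bb> (int m')"
    using src.contracts_simplex[OF \<sigma> fit(1)] by auto
  have le: "i \<le> i + q" "i + q \<le> m'" using fit m' by simp_all
  let ?\<tau> = "contracts (base \<bb>) ?L \<sigma>" and ?gs = "inserts \<bb> ?L \<sigma> fs"
  note IH = Cons.IH[OF fit(1) \<psi>s]
  have gs: "?gs \<in> tuples (sources \<bb> ?\<tau>)"
    by (rule src.inserts_tuples[OF \<sigma> fit(1) inner fs])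
  have s: "seg i (i + q) ?\<tau> \<in> simplices \<bb> (int q)"
    using seg_simplex[OF m'(2) le] by simp
  have g: "take q (drop i ?gs) \<in> tuples (sources \<bb> (seg i (i + q) ?\<tau>))"
    using tuples_take[OF tuples_drop[OF gs], of q i] src.sources_seg[OF m'(2) le] by simp
  show ?case
    using IH hpull_apply(2)[OF \<psi> s g] map_simplex_contract[OF m'(2) le] args_map_contract[OF m'(2) le gs]
      target_map_contract[OF m'(2) le] args_map_seg[OF m'(2) le, of ?gs]
    unfolding L by (simp add: x contracts_Cons inserts_Cons map_simplex_seg)
qed

lemma hpull_hbrace:
  assumes \<phi>: "\<phi> \<in> carrier (cochains R \<aa> (int p))"
    and \<psi>s: "\<And>q \<psi>. (q, \<psi>) \<in> set \<psi>s \<Longrightarrow> \<psi> \<in> carrier (cochains R \<aa> (int q))"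
  shows "hpull \<bb> F (int p + (\<Sum>(q, \<psi>)\<leftarrow>\<psi>s. int q - 1)) (hbrace \<aa> p \<phi> \<psi>s) =
    hbrace \<bb> p (hpull \<bb> F (int p) \<phi>) (pull_inner \<psi>s)"
proof (rule hpull_eqI)
  have sum: "(\<Sum>(q, \<psi>)\<leftarrow>pull_inner \<psi>s. int q - 1) = (\<Sum>(q, \<psi>)\<leftarrow>\<psi>s. int q - 1)"
    by (induction \<psi>s) (auto simp: pull_inner_def)
  have fst: "map fst (pull_inner \<psi>s) = map fst \<psi>s"
    by (auto simp: pull_inner_def)
  note \<phi>' = hpull_closed[OF \<phi>]
  have \<psi>s': "\<psi> \<in> carrier (cochains R \<bb> (int q))" if "(q, \<psi>) \<in> set (pull_inner \<psi>s)" for q \<psi>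
    using that \<psi>s by (auto simp: pull_inner_def intro: hpull_closed)
  show "hbrace \<bb> p (hpull \<bb> F (int p) \<phi>) (pull_inner \<psi>s) \<in> carrier (cochains R \<bb> (int p + (\<Sum>(q, \<psi>)\<leftarrow>\<psi>s. int q - 1)))"
    using src.hbrace_closed[where \<psi>s = "pull_inner \<psi>s", OF \<phi>' \<psi>s'] by (simp add: sum)
  fix \<sigma> fs assume \<sigma>: "\<sigma> \<in> simplices \<bb> (int p + (\<Sum>(q, \<psi>)\<leftarrow>\<psi>s. int q - 1))" and fs: "fs \<in> tuples (sources \<bb> \<sigma>)"
  then obtain m where \<sigma>m: "\<sigma> \<in> simplices \<bb> (int m)" using simplex_nat by metis
  note \<sigma>' = \<sigma>[folded sum]
  let ?T = "target \<bb> \<sigma>" and ?T' = "target \<aa> (map_simplex F \<sigma>)" and ?\<tau> = "map_simplex F \<sigma>" and ?gs = "args_map \<sigma> fs"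
  note hom = target_map_hom[OF \<sigma>] and ab = target_abelian[OF \<sigma>]
  have len: "length fs = m" using tuples_length[OF fs] src.length_sources[OF \<sigma>m] by simp
  have len': "length ?gs = m"
    using tuples_length[OF args_map_closed[OF \<sigma> fs]] tgt.length_sources[OF map_simplex_closed[OF \<sigma>m]] by simp
  let ?P = "placements (map fst \<psi>s) m"
  let ?e = "\<lambda>ps. \<Sum>((q, \<psi>), i)\<leftarrow>zip \<psi>s ps. (int q - 1) * int i"
  have e: "(\<Sum>((q, \<psi>), i)\<leftarrow>zip (pull_inner \<psi>s) ps. (int q - 1) * int i) = ?e ps" for ps
    unfolding pull_inner_def zip_map1 by (simp add: comp_def case_prod_unfold)
  let ?t = "\<lambda>ps. hpull \<bb> F (int p) \<phi> (contracts (base \<bb>) (zip (pull_inner \<psi>s) ps) \<sigma>) (inserts \<bb> (zip (pull_inner \<psi>s) ps) \<sigma> fs)"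
  let ?t' = "\<lambda>ps. \<phi> (contracts (base \<aa>) (zip \<psi>s ps) ?\<tau>) (inserts \<aa> (zip \<psi>s ps) ?\<tau> ?gs)"
  have t: "?t ps \<in> carrier ?T" if "ps \<in> ?P" for ps
    using multilinear_closed[OF src.hbrace_summand_multilinear[OF \<phi>' \<psi>s' \<sigma>' \<sigma>m] fs, of ps] that by (simp add: fst)
  have t': "target_map \<sigma> (?t ps) = ?t' ps" if ps: "ps \<in> ?P" for ps
  proof -
    let ?L = "zip (pull_inner \<psi>s) ps"
    have ps': "ps \<in> placements (map fst (pull_inner \<psi>s)) m" using ps by (simp add: fst)
    have fit: "fits ?L m" by (rule placements_fits[OF ps'])
    have lps: "length ps = length \<psi>s" using ps by (simp add: placements_def)
    have inner: "\<psi>' \<in> carrier (cochains R \<bb> (int q'))" if "((q', \<psi>'), i') \<in> set ?L" for q' \<psi>' i'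
      using set_zip_leftD[OF that] \<psi>s' by simp
    show ?thesis
      using inserts_pull[OF \<sigma>m fs lps fit \<psi>s]
        hpull_apply(2)[OF \<phi> src.brace_simplex[OF \<sigma>' \<sigma>m ps'] src.inserts_tuples[OF \<sigma>m fit inner fs]]
      by simp
  qed
  have "target_map \<sigma> (\<Oplus>\<^bsub>?T\<^esub>ps\<in>?P. signed ?T (?e ps) (?t ps)) = (\<Oplus>\<^bsub>?T'\<^esub>ps\<in>?P. target_map \<sigma> (signed ?T (?e ps) (?t ps)))"
    using t by (intro mod_hom_finsum[OF hom ab]) (auto intro: signed_closed[OF ab(1)])
  also have "\<dots> = (\<Oplus>\<^bsub>?T'\<^esub>ps\<in>?P. signed ?T' (?e ps) (?t' ps))"
    using t by (intro abelian_monoid.finsum_cong'[OF abelian_group.axioms(1)[OF ab(2)]])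
      (auto simp: mod_hom_signed[OF hom ab] simp flip: t' intro!: signed_closed[OF ab(2)] mod_hom_closed[OF hom])
  finally show "target_map \<sigma> (hbrace \<bb> p (hpull \<bb> F (int p) \<phi>) (pull_inner \<psi>s) \<sigma> fs) = hbrace \<aa> p \<phi> \<psi>s ?\<tau> ?gs"
    unfolding hbrace_def sum fst restrict_apply'[OF \<sigma>] restrict_apply'[OF map_simplex_closed[OF \<sigma>]] restrict_apply'[OF fs]
      restrict_apply'[OF args_map_closed[OF \<sigma> fs]] foldr_plug prod.case e len len' .
qed

lemma hpull_bop:
  assumes w: "w \<in> words (hoch R \<aa>)"
  shows "hpull \<bb> F (bdeg w) (bop (hoch R \<aa>) w) = bop (hoch R \<bb>) (map_word (hpull \<bb> F) w)"
proof -
  consider "\<exists>(n, x)\<in>set w. n < 0"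
    | p \<phi> where "w = [(p, \<phi>)]" "0 \<le> p"
    | p \<phi> q \<psi> where "w = [(p, \<phi>), (q, \<psi>)]" "0 \<le> p" "0 \<le> q"
    | "\<And>x. w \<noteq> [x]" "\<And>x y. w \<noteq> [x, y]"
    by (cases w rule: remdups_adj.cases) force+
  then show ?thesis
  proof cases
    case 1
    then show ?thesis by (simp add: hoch_def map_word_degrees hpull_zero)
  next
    case (2 p \<phi>)
    have \<phi>: "\<phi> \<in> carrier (cochains R \<aa> (int (nat p)))" using w 2 by (simp add: words_hoch)
    have "hpull \<bb> F (p + 1) (signed (cochains R \<aa> (p + 1)) (p - 1) (hdiff \<aa> (nat p) \<phi>)) =
        signed (cochains R \<bb> (p + 1)) (p - 1) (hdiff \<bb> (nat p) (hpull \<bb> F p \<phi>))"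
      using tgt.hdiff_closed[OF \<phi>] hpull_hdiff[OF \<phi>] 2
      by (subst mod_hom_signed[OF hpull_hom tgt.cochains_abelian_group src.cochains_abelian_group]) simp_all
    then show ?thesis
      using 2 by (simp add: hoch_def bdeg_def sdeg_def map_word_def add.commute)
  next
    case (3 p \<phi> q \<psi>)
    have \<phi>: "\<phi> \<in> carrier (cochains R \<aa> (int (nat p)))" "\<psi> \<in> carrier (cochains R \<aa> (int (nat q)))"
      using w 3 by (simp_all add: words_hoch)
    have "hpull \<bb> F (p + q) (signed (cochains R \<aa> (p + q)) (p * (q - 1)) (hcup \<aa> (nat p) \<phi> (nat q) \<psi>)) =
        signed (cochains R \<bb> (p + q)) (p * (q - 1)) (hcup \<bb> (nat p) (hpull \<bb> F p \<phi>) (nat q) (hpull \<bb> F q \<psi>))"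
      using tgt.hcup_closed[OF \<phi>] hpull_hcup[OF \<phi>] 3
      by (subst mod_hom_signed[OF hpull_hom tgt.cochains_abelian_group src.cochains_abelian_group]) simp_all
    then show ?thesis
      using 3 by (simp add: hoch_def bdeg_def sdeg_def map_word_def)
  next
    case 4
    have "\<exists>x'. w = [x']" if "map_word (hpull \<bb> F) w = [x]" for x
      using that by (auto simp: map_word_def map_eq_Cons_conv)
    moreover have "\<exists>x' y'. w = [x', y']" if "map_word (hpull \<bb> F) w = [x, y]" for x y
      using that by (auto simp: map_word_def map_eq_Cons_conv)
    ultimately have "map_word (hpull \<bb> F) w \<noteq> [x]" "map_word (hpull \<bb> F) w \<noteq> [x, y]" for x y
      using 4 by blast+
    then show ?thesis
      using 4 by (simp add: hoch_bop_zero map_word_degrees hpull_zero)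
  qed
qed

lemma hpull_mop:
  assumes v: "v \<in> words (hoch R \<aa>)" and w: "w \<in> words (hoch R \<aa>)"
  shows "hpull \<bb> F (mdeg v w) (mop (hoch R \<aa>) v w) =
    mop (hoch R \<bb>) (map_word (hpull \<bb> F) v) (map_word (hpull \<bb> F) w)"
proof -
  have neg: "(\<exists>(n, x)\<in>set (map_word (hpull \<bb> F) v @ map_word (hpull \<bb> F) w). n < 0) \<longleftrightarrow> (\<exists>(n, x)\<in>set (v @ w). n < 0)"
    using map_word_degrees(1)[of "hpull \<bb> F" "v @ w"] by (simp add: map_word_def)
  consider "\<exists>(n, x)\<in>set (v @ w). n < 0"
    | q \<psi> where "v = []" "w = [(q, \<psi>)]" "0 \<le> q"
    | p \<phi> where "v = [(p, \<phi>)]" "0 \<le> p" "\<forall>(n, x)\<in>set w. 0 \<le> n"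
    | "(v = [] \<and> (\<forall>x. w \<noteq> [x])) \<or> (v \<noteq> [] \<and> (\<forall>x. v \<noteq> [x]))"
    by (cases v rule: remdups_adj.cases; cases w rule: remdups_adj.cases) force+
  then show ?thesis
  proof cases
    case 1
    with neg show ?thesis by (simp add: hoch_def map_word_degrees hpull_zero)
  next
    case (2 q \<psi>)
    then show ?thesis
      by (simp add: hoch_def mdeg_def sdeg_def map_word_def)
  next
    case (3 p \<phi>)
    let ?w = "map (\<lambda>(q, \<psi>). (nat q, \<psi>)) w"
    have \<phi>: "\<phi> \<in> carrier (cochains R \<aa> (int (nat p)))" using v 3 by (simp add: words_hoch)
    have w': "\<psi> \<in> carrier (cochains R \<aa> (int q))" if "(q, \<psi>) \<in> set ?w" for q \<psi>
      using w that 3(3) by (auto simp: words_hoch)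
    have "int (nat p) + (\<Sum>(q, \<psi>)\<leftarrow>?w. int q - 1) = mdeg v w"
      unfolding sdeg_nonneg[OF 3(3)] using 3 by (simp add: mdeg_def sdeg_def)
    moreover have "pull_inner ?w = map (\<lambda>(q, \<psi>). (nat q, \<psi>)) (map_word (hpull \<bb> F) w)"
      using 3(3) by (auto simp: pull_inner_def map_word_def)
    ultimately have "hpull \<bb> F (mdeg v w) (hbrace \<aa> (nat p) \<phi> ?w) =
        hbrace \<bb> (nat p) (hpull \<bb> F p \<phi>) (map (\<lambda>(q, \<psi>). (nat q, \<psi>)) (map_word (hpull \<bb> F) w))"
      using hpull_hbrace[where \<psi>s = ?w, OF \<phi> w'] 3 by simp
    moreover have "\<not> (\<exists>(n, x)\<in>set (v @ w). n < 0)" using 3 by auto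
    moreover have "map_word (hpull \<bb> F) v = [(p, hpull \<bb> F p \<phi>)]"
      using 3 by (simp add: map_word_def)
    ultimately show ?thesis using neg 3(1)
      by (simp add: hoch_def)
  next
    case 4
    have "\<exists>x'. u = [x']" if "map_word (hpull \<bb> F) u = [x]" for x u
      using that by (auto simp: map_word_def map_eq_Cons_conv)
    moreover have "map_word (hpull \<bb> F) u = [] \<longleftrightarrow> u = []" for u
      by (simp add: map_word_def)
    ultimately have "(map_word (hpull \<bb> F) v = [] \<and> (\<forall>x. map_word (hpull \<bb> F) w \<noteq> [x])) \<or>
        (map_word (hpull \<bb> F) v \<noteq> [] \<and> (\<forall>x. map_word (hpull \<bb> F) v \<noteq> [x]))"
      using 4 by blast
    then show ?thesis
      using 4 by (simp add: hoch_mop_zero map_word_degrees hpull_zero)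
  qed
qed

text \<open>
  Naturality of the components which vanish by definition amounts to the preservation of zero.
\<close>

theorem hpull_binf_hom: "binf_hom R (hoch R \<aa>) (hoch R \<bb>) (hpull \<bb> F)"
  using hpull_hom hpull_bop hpull_mop by (simp add: binf_hom_def hoch_def[of R \<aa>] hoch_def[of R \<bb>])

end

section \<open>Pullbacks of cartesian functors\<close>

lemma pullback_cat_category:
  assumes "category C1" "category C2" and F1: "is_functor C1 D fo1 fa1" and F2: "is_functor C2 D fo2 fa2"
  shows "category (pullback_cat C1 C2 fo1 fa1 fo2 fa2)"
proof -
  interpret C1: category C1 by fact
  interpret C2: category C2 by fact
  show ?thesis
    by unfold_locales
      (use F1 F2 in \<open>auto simp: pullback_cat_def is_functor_def C1.dom_cod C2.dom_cod C1.id_arr C2.id_arr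
        C1.comp_arr C2.comp_arr C1.comp_id C2.comp_id C1.comp_assoc C2.comp_assoc\<close>)
qed

lemma pullback_module_carrier:
  "carrier (pullback_module M1 M2 f1 f2) = {(x, y). x \<in> carrier M1 \<and> y \<in> carrier M2 \<and> f1 x = f2 y}"
  by (simp add: pullback_module_def)

lemma pullback_module_module:
  assumes "module R M1" "module R M2" "module R N"
    and f: "mod_hom R M1 N f1" "mod_hom R M2 N f2"
  shows "module R (pullback_module M1 M2 f1 f2)"
proof -
  interpret M1: module R M1 by fact
  interpret M2: module R M2 by fact
  interpret N: module R N by fact
  note ag = M1.abelian_group_axioms M2.abelian_group_axioms N.abelian_group_axioms
  note f_simps = mod_hom_add[OF f(1)] mod_hom_add[OF f(2)] mod_hom_smult[OF f(1)] mod_hom_smult[OF f(2)]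
    mod_hom_zero[OF f(1) ag(1,3)] mod_hom_zero[OF f(2) ag(2,3)]
    mod_hom_minus[OF f(1) ag(1,3)] mod_hom_minus[OF f(2) ag(2,3)]
  have "abelian_group (pullback_module M1 M2 f1 f2)"
  proof (rule abelian_groupI)
    fix z assume "z \<in> carrier (pullback_module M1 M2 f1 f2)"
    then obtain x y where z: "z = (x, y)" "x \<in> carrier M1" "y \<in> carrier M2" "f1 x = f2 y"
      by (auto simp: pullback_module_def)
    then show "\<exists>z'\<in>carrier (pullback_module M1 M2 f1 f2).
        z' \<oplus>\<^bsub>pullback_module M1 M2 f1 f2\<^esub> z = \<zero>\<^bsub>pullback_module M1 M2 f1 f2\<^esub>"
      by (intro bexI[of _ "(\<ominus>\<^bsub>M1\<^esub> x, \<ominus>\<^bsub>M2\<^esub> y)"])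
        (auto simp: pullback_module_def f_simps M1.M.l_neg M2.M.l_neg)
  qed (auto simp: pullback_module_def f_simps M1.M.a_ac M2.M.a_ac)
  then show ?thesis
    by (intro moduleI M1.R.is_cring)
      (auto simp: pullback_module_def f_simps M1.smult_l_distr M2.smult_l_distr M1.smult_r_distr M2.smult_r_distr
        M1.smult_assoc1 M2.smult_assoc1)
qed

lemma bij_betw_fibre_product:
  assumes f: "bij_betw f X N" and g: "bij_betw g Y N"
  shows "bij_betw fst {(x, y). x \<in> X \<and> y \<in> Y \<and> f x = g y} X"
    and "bij_betw snd {(x, y). x \<in> X \<and> y \<in> Y \<and> f x = g y} Y"
proof -
  let ?P = "{(x, y). x \<in> X \<and> y \<in> Y \<and> f x = g y}"
  have inj: "inj_on f X" "inj_on g Y" and im: "f ` X = N" "g ` Y = N"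
    using f g by (auto simp: bij_betw_def)
  have "inj_on fst ?P" "inj_on snd ?P"
    using inj by (auto simp: inj_on_def)
  moreover have "fst ` ?P = X"
  proof
    show "X \<subseteq> fst ` ?P"
    proof
      fix x assume x: "x \<in> X"
      then have "f x \<in> g ` Y" using im by blast
      then obtain y where "y \<in> Y" "f x = g y" by blast
      with x show "x \<in> fst ` ?P" by (intro image_eqI[of _ _ "(x, y)"]) auto
    qed
  qed auto
  moreover have "snd ` ?P = Y"
  proof
    show "Y \<subseteq> snd ` ?P"
    proof
      fix y assume y: "y \<in> Y"
      then have "g y \<in> f ` X" using im by blast
      then obtain x where "x \<in> X" "g y = f x" by blast
      with y show "y \<in> snd ` ?P" by (intro image_eqI[of _ _ "(x, y)"]) auto
    qed
  qed auto
  ultimately show "bij_betw fst ?P X" "bij_betw snd ?P Y"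
    by (simp_all add: bij_betw_def)
qed

locale cartesian_cospan =
  left: cartesian_functor R \<bb>1 \<aa> F1 + right: cartesian_functor R \<bb>2 \<aa> F2
  for R :: "'k ring" and \<bb>1 :: "('k, 'o1, 'm1, 'a1, 'x1) mgcat" and \<bb>2 :: "('k, 'o2, 'm2, 'a2, 'x2) mgcat"
    and \<aa> :: "('k, 'o, 'm, 'a, 'x) mgcat"
    and F1 :: "('o1, 'm1, 'a1, 'x1, 'o, 'm, 'a, 'x) gfun" and F2 :: "('o2, 'm2, 'a2, 'x2, 'o, 'm, 'a, 'x) gfun"
begin

abbreviation \<pp> where "\<pp> \<equiv> pullback \<bb>1 F1 \<bb>2 F2"

lemma base_pullback: "base \<pp> = pullback_cat (base \<bb>1) (base \<bb>2) (fob F1) (farr F1) (fob F2) (farr F2)"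
  by (simp add: pullback_def)

lemma pullback_simps:
  "(v, w) \<in> Arr (base \<pp>) \<longleftrightarrow> v \<in> Arr (base \<bb>1) \<and> w \<in> Arr (base \<bb>2) \<and> farr F1 v = farr F2 w"
  "(V, W) \<in> Ob (base \<pp>) \<longleftrightarrow> V \<in> Ob (base \<bb>1) \<and> W \<in> Ob (base \<bb>2) \<and> fob F1 V = fob F2 W"
  "Dom (base \<pp>) (v, w) = (Dom (base \<bb>1) v, Dom (base \<bb>2) w)"
  "Cod (base \<pp>) (v, w) = (Cod (base \<bb>1) v, Cod (base \<bb>2) w)"
  "Id (base \<pp>) (V, W) = (Id (base \<bb>1) V, Id (base \<bb>2) W)"
  "Comp (base \<pp>) (v', w') (v, w) = (Comp (base \<bb>1) v' v, Comp (base \<bb>2) w' w)"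
  "(B, C) \<in> gobj \<pp> (V, W) \<longleftrightarrow> B \<in> gobj \<bb>1 V \<and> C \<in> gobj \<bb>2 W \<and> fobj F1 V B = fobj F2 W C"
  "gmor \<pp> (v, w) (B, C) (B', C') =
    pullback_module (gmor \<bb>1 v B B') (gmor \<bb>2 w C C') (fmor F1 v B B') (fmor F2 w C C')"
  "gcmp \<pp> (v', w') (v, w) (B, C) (B', C') (B'', C'') (g, h) (g', h') =
    (gcmp \<bb>1 v' v B B' B'' g g', gcmp \<bb>2 w' w C C' C'' h h')"
  "gone \<pp> (V, W) (B, C) = (gone \<bb>1 V B, gone \<bb>2 W C)"
  by (auto simp: pullback_def pullback_cat_def)

text \<open>
  Over an arrow of the pullback both functors take values in the same module, so that the pullback
  of modules is formed over a common target.
\<close>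

lemma common_target:
  assumes "(v, w) \<in> Arr (base \<pp>)" "(B, C) \<in> gobj \<pp> (Dom (base \<pp>) (v, w))" "(B', C') \<in> gobj \<pp> (Cod (base \<pp>) (v, w))"
  obtains N where "module R N"
    "mod_hom R (gmor \<bb>1 v B B') N (fmor F1 v B B')" "mod_hom R (gmor \<bb>2 w C C') N (fmor F2 w C C')"
    "bij_betw (fmor F1 v B B') (carrier (gmor \<bb>1 v B B')) (carrier N)"
    "bij_betw (fmor F2 w C C') (carrier (gmor \<bb>2 w C C')) (carrier N)"
    "module R (gmor \<bb>1 v B B')" "module R (gmor \<bb>2 w C C')"
proof -
  let ?N = "gmor \<aa> (farr F1 v) (fobj F1 (Dom (base \<bb>1) v) B) (fobj F1 (Cod (base \<bb>1) v) B')"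
  have a: "v \<in> Arr (base \<bb>1)" "w \<in> Arr (base \<bb>2)" "farr F1 v = farr F2 w"
    "B \<in> gobj \<bb>1 (Dom (base \<bb>1) v)" "C \<in> gobj \<bb>2 (Dom (base \<bb>2) w)"
    "B' \<in> gobj \<bb>1 (Cod (base \<bb>1) v)" "C' \<in> gobj \<bb>2 (Cod (base \<bb>2) w)"
    "fobj F1 (Dom (base \<bb>1) v) B = fobj F2 (Dom (base \<bb>2) w) C"
    "fobj F1 (Cod (base \<bb>1) v) B' = fobj F2 (Cod (base \<bb>2) w) C'"
    using assms by (auto simp: pullback_simps)
  have "module R ?N"
    using a(1,4,6) left.src.base.dom_cod[OF a(1)]
    by (intro left.tgt.gmor_module) (auto simp: left.base_functor_simps intro!: left.fobj_closed)
  moreover have "mod_hom R (gmor \<bb>1 v B B') ?N (fmor F1 v B B')"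
      "bij_betw (fmor F1 v B B') (carrier (gmor \<bb>1 v B B')) (carrier ?N)"
    using a(1,4,6) left.graded left.cart by (auto simp: graded_functor_def cartesian_def)
  moreover have "mod_hom R (gmor \<bb>2 w C C') ?N (fmor F2 w C C')"
      "bij_betw (fmor F2 w C C') (carrier (gmor \<bb>2 w C C')) (carrier ?N)"
    using a(2,5,7) right.graded right.cart unfolding a(3,8,9) by (auto simp: graded_functor_def cartesian_def)
  ultimately show thesis
    using that left.src.gmor_module[OF a(1,4,6)] right.src.gmor_module[OF a(2,5,7)] by blast
qed

text \<open>
  Both functors respect composition, so that pairs with the same image in \<open>\<aa>\<close> compose to such a
  pair.
\<close>

lemma pullback_comp_closed:
  assumes "(v, w) \<in> Arr (base \<pp>)" "(v', w') \<in> Arr (base \<pp>)" "Cod (base \<pp>) (v, w) = Dom (base \<pp>) (v', w')"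
    "(B, C) \<in> gobj \<pp> (Dom (base \<pp>) (v, w))" "(B', C') \<in> gobj \<pp> (Cod (base \<pp>) (v, w))"
    "(B'', C'') \<in> gobj \<pp> (Cod (base \<pp>) (v', w'))"
    "(f, f') \<in> carrier (gmor \<pp> (v, w) (B, C) (B', C'))" "(g, g') \<in> carrier (gmor \<pp> (v', w') (B', C') (B'', C''))"
  shows "(gcmp \<bb>1 v' v B B' B'' g f, gcmp \<bb>2 w' w C C' C'' g' f') \<in>
    carrier (gmor \<pp> (Comp (base \<bb>1) v' v, Comp (base \<bb>2) w' w) (B, C) (B'', C''))"
proof -
  have a: "v \<in> Arr (base \<bb>1)" "w \<in> Arr (base \<bb>2)" "farr F1 v = farr F2 w"
    "v' \<in> Arr (base \<bb>1)" "w' \<in> Arr (base \<bb>2)" "farr F1 v' = farr F2 w'"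
    "Cod (base \<bb>1) v = Dom (base \<bb>1) v'" "Cod (base \<bb>2) w = Dom (base \<bb>2) w'"
    "B \<in> gobj \<bb>1 (Dom (base \<bb>1) v)" "C \<in> gobj \<bb>2 (Dom (base \<bb>2) w)"
    "B' \<in> gobj \<bb>1 (Cod (base \<bb>1) v)" "C' \<in> gobj \<bb>2 (Cod (base \<bb>2) w)"
    "B'' \<in> gobj \<bb>1 (Cod (base \<bb>1) v')" "C'' \<in> gobj \<bb>2 (Cod (base \<bb>2) w')"
    "fobj F1 (Dom (base \<bb>1) v) B = fobj F2 (Dom (base \<bb>2) w) C"
    "fobj F1 (Cod (base \<bb>1) v) B' = fobj F2 (Cod (base \<bb>2) w) C'"
    "fobj F1 (Cod (base \<bb>1) v') B'' = fobj F2 (Cod (base \<bb>2) w') C''"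
    and m: "f \<in> carrier (gmor \<bb>1 v B B')" "f' \<in> carrier (gmor \<bb>2 w C C')"
    "g \<in> carrier (gmor \<bb>1 v' B' B'')" "g' \<in> carrier (gmor \<bb>2 w' C' C'')"
    "fmor F1 v B B' f = fmor F2 w C C' f'" "fmor F1 v' B' B'' g = fmor F2 w' C' C'' g'"
    using assms by (auto simp: pullback_simps pullback_module_carrier)
  have "gcmp \<bb>1 v' v B B' B'' g f \<in> carrier (gmor \<bb>1 (Comp (base \<bb>1) v' v) B B'')"
    using mod_hom_closed[OF left.src.gcmp_left[of v v' B B' B'' f] m(3)] a m by simp
  moreover have "gcmp \<bb>2 w' w C C' C'' g' f' \<in> carrier (gmor \<bb>2 (Comp (base \<bb>2) w' w) C C'')"
    using mod_hom_closed[OF right.src.gcmp_left[of w w' C C' C'' f'] m(4)] a m by simp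
  moreover have "fmor F1 (Comp (base \<bb>1) v' v) B B'' (gcmp \<bb>1 v' v B B' B'' g f) =
      gcmp \<aa> (farr F1 v') (farr F1 v) (fobj F1 (Dom (base \<bb>1) v) B) (fobj F1 (Cod (base \<bb>1) v) B')
        (fobj F1 (Cod (base \<bb>1) v') B'') (fmor F1 v' B' B'' g) (fmor F1 v B B' f)"
    using left.graded a m by (simp add: graded_functor_def)
  moreover have "fmor F2 (Comp (base \<bb>2) w' w) C C'' (gcmp \<bb>2 w' w C C' C'' g' f') =
      gcmp \<aa> (farr F2 w') (farr F2 w) (fobj F2 (Dom (base \<bb>2) w) C) (fobj F2 (Cod (base \<bb>2) w) C')
        (fobj F2 (Cod (base \<bb>2) w') C'') (fmor F2 w' C' C'' g') (fmor F2 w C C' f')"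
    using right.graded a m by (simp add: graded_functor_def)
  ultimately show ?thesis
    using a m by (simp add: pullback_simps pullback_module_carrier)
qed

lemma pullback_map_graded: "map_graded R \<pp>"
proof (rule map_graded.intro)
  show "cring R" by (rule left.src.ground)
  show "category (base \<pp>)"
    unfolding base_pullback
    by (rule pullback_cat_category[OF left.src.base right.src.base left.base_functor right.base_functor])
next
  fix u A A' assume u: "u \<in> Arr (base \<pp>)" "A \<in> gobj \<pp> (Dom (base \<pp>) u)" "A' \<in> gobj \<pp> (Cod (base \<pp>) u)"
  obtain v w B C B' C' where [simp]: "u = (v, w)" "A = (B, C)" "A' = (B', C')"
    by (cases u; cases A; cases A')
  obtain N where "module R N"
    "mod_hom R (gmor \<bb>1 v B B') N (fmor F1 v B B')" "mod_hom R (gmor \<bb>2 w C C') N (fmor F2 w C C')"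
    "module R (gmor \<bb>1 v B B')" "module R (gmor \<bb>2 w C C')"
    using common_target[of v w B C B' C'] u by auto
  then show "module R (gmor \<pp> u A A')"
    by (auto simp: pullback_simps intro: pullback_module_module)
next
  fix u u' A A' A'' f
  assume u: "u \<in> Arr (base \<pp>)" "u' \<in> Arr (base \<pp>)" "Cod (base \<pp>) u = Dom (base \<pp>) u'"
    "A \<in> gobj \<pp> (Dom (base \<pp>) u)" "A' \<in> gobj \<pp> (Cod (base \<pp>) u)" "A'' \<in> gobj \<pp> (Cod (base \<pp>) u')"
    and f: "f \<in> carrier (gmor \<pp> u A A')"
  obtain v w v' w' B C B' C' B'' C'' f1 f2 where
    [simp]: "u = (v, w)" "u' = (v', w')" "A = (B, C)" "A' = (B', C')" "A'' = (B'', C'')" "f = (f1, f2)"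
    by (cases u; cases u'; cases A; cases A'; cases A''; cases f)
  note cl = pullback_comp_closed[OF u[simplified]]
  have h: "mod_hom R (gmor \<bb>1 v' B' B'') (gmor \<bb>1 (Comp (base \<bb>1) v' v) B B'') (\<lambda>g. gcmp \<bb>1 v' v B B' B'' g f1)"
    "mod_hom R (gmor \<bb>2 w' C' C'') (gmor \<bb>2 (Comp (base \<bb>2) w' w) C C'') (\<lambda>g. gcmp \<bb>2 w' w C C' C'' g f2)"
    using u f by (auto simp: pullback_simps pullback_module_carrier intro: left.src.gcmp_left right.src.gcmp_left)
  show "mod_hom R (gmor \<pp> u' A' A'') (gmor \<pp> (Comp (base \<pp>) u' u) A A'') (\<lambda>g. gcmp \<pp> u' u A A' A'' g f)"
  proof (rule mod_homI)
    fix g assume "g \<in> carrier (gmor \<pp> u' A' A'')"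
    then show "gcmp \<pp> u' u A A' A'' g f \<in> carrier (gmor \<pp> (Comp (base \<pp>) u' u) A A'')"
      using cl[of f1 f2] f by (cases g) (simp add: pullback_simps)
  qed (auto simp: pullback_simps pullback_module_def mod_hom_add[OF h(1)] mod_hom_add[OF h(2)]
      mod_hom_smult[OF h(1)] mod_hom_smult[OF h(2)])
next
  fix u u' A A' A'' g
  assume u: "u \<in> Arr (base \<pp>)" "u' \<in> Arr (base \<pp>)" "Cod (base \<pp>) u = Dom (base \<pp>) u'"
    "A \<in> gobj \<pp> (Dom (base \<pp>) u)" "A' \<in> gobj \<pp> (Cod (base \<pp>) u)" "A'' \<in> gobj \<pp> (Cod (base \<pp>) u')"
    and g: "g \<in> carrier (gmor \<pp> u' A' A'')"
  obtain v w v' w' B C B' C' B'' C'' g1 g2 where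
    [simp]: "u = (v, w)" "u' = (v', w')" "A = (B, C)" "A' = (B', C')" "A'' = (B'', C'')" "g = (g1, g2)"
    by (cases u; cases u'; cases A; cases A'; cases A''; cases g)
  note cl = pullback_comp_closed[OF u[simplified]]
  have h: "mod_hom R (gmor \<bb>1 v B B') (gmor \<bb>1 (Comp (base \<bb>1) v' v) B B'') (\<lambda>f. gcmp \<bb>1 v' v B B' B'' g1 f)"
    "mod_hom R (gmor \<bb>2 w C C') (gmor \<bb>2 (Comp (base \<bb>2) w' w) C C'') (\<lambda>f. gcmp \<bb>2 w' w C C' C'' g2 f)"
    using u g by (auto simp: pullback_simps pullback_module_carrier intro: left.src.gcmp_right right.src.gcmp_right)
  show "mod_hom R (gmor \<pp> u A A') (gmor \<pp> (Comp (base \<pp>) u' u) A A'') (\<lambda>f. gcmp \<pp> u' u A A' A'' g f)"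
  proof (rule mod_homI)
    fix f assume "f \<in> carrier (gmor \<pp> u A A')"
    then show "gcmp \<pp> u' u A A' A'' g f \<in> carrier (gmor \<pp> (Comp (base \<pp>) u' u) A A'')"
      using cl[of "fst f" "snd f" g1 g2] g by (cases f) (simp add: pullback_simps)
  qed (auto simp: pullback_simps pullback_module_def mod_hom_add[OF h(1)] mod_hom_add[OF h(2)]
      mod_hom_smult[OF h(1)] mod_hom_smult[OF h(2)])
next
  fix U A assume "U \<in> Ob (base \<pp>)" "A \<in> gobj \<pp> U"
  then show "gone \<pp> U A \<in> carrier (gmor \<pp> (Id (base \<pp>) U) A A)"
    using left.graded right.graded
    by (cases U; cases A)
      (auto simp: pullback_simps pullback_module_carrier left.src.gone_mor right.src.gone_mor graded_functor_def)
next
  fix u A A' f assume "u \<in> Arr (base \<pp>)" "A \<in> gobj \<pp> (Dom (base \<pp>) u)" "A' \<in> gobj \<pp> (Cod (base \<pp>) u)"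
    "f \<in> carrier (gmor \<pp> u A A')"
  then show "gcmp \<pp> u (Id (base \<pp>) (Dom (base \<pp>) u)) A A A' f (gone \<pp> (Dom (base \<pp>) u) A) = f \<and>
      gcmp \<pp> (Id (base \<pp>) (Cod (base \<pp>) u)) u A A' A' (gone \<pp> (Cod (base \<pp>) u) A') f = f"
    by (cases u; cases A; cases A'; cases f)
      (auto simp: pullback_simps pullback_module_carrier left.src.gcmp_one right.src.gcmp_one)
next
  fix u u' u'' A A' A'' A''' f g h
  assume "u \<in> Arr (base \<pp>)" "u' \<in> Arr (base \<pp>)" "u'' \<in> Arr (base \<pp>)"
    "Cod (base \<pp>) u = Dom (base \<pp>) u'" "Cod (base \<pp>) u' = Dom (base \<pp>) u''"
    "A \<in> gobj \<pp> (Dom (base \<pp>) u)" "A' \<in> gobj \<pp> (Cod (base \<pp>) u)"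
    "A'' \<in> gobj \<pp> (Cod (base \<pp>) u')" "A''' \<in> gobj \<pp> (Cod (base \<pp>) u'')"
    "f \<in> carrier (gmor \<pp> u A A')" "g \<in> carrier (gmor \<pp> u' A' A'')" "h \<in> carrier (gmor \<pp> u'' A'' A''')"
  then show "gcmp \<pp> u'' (Comp (base \<pp>) u' u) A A'' A''' h (gcmp \<pp> u' u A A' A'' g f) =
      gcmp \<pp> (Comp (base \<pp>) u'' u') u A A' A''' (gcmp \<pp> u'' u' A' A'' A''' h g) f"
    by (cases u; cases u'; cases u''; cases A; cases A'; cases A''; cases A'''; cases f; cases g; cases h)
      (simp add: pullback_simps pullback_module_carrier left.src.gcmp_assoc right.src.gcmp_assoc)
qed

text \<open>
  In a pullback of two bijections both projections are bijections.  Applied to fibres over objects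
  and over arrows, this gives stability of cartesian functors under base change.
\<close>

lemma pullback_objects:
  assumes "(V, W) \<in> Ob (base \<pp>)"
  shows "bij_betw fst (gobj \<pp> (V, W)) (gobj \<bb>1 V)" "bij_betw snd (gobj \<pp> (V, W)) (gobj \<bb>2 W)"
proof -
  have "bij_betw (fobj F1 V) (gobj \<bb>1 V) (gobj \<aa> (fob F1 V))" "bij_betw (fobj F2 W) (gobj \<bb>2 W) (gobj \<aa> (fob F1 V))"
    using assms left.cart right.cart by (auto simp: cartesian_def pullback_simps)
  from bij_betw_fibre_product[OF this]
  show "bij_betw fst (gobj \<pp> (V, W)) (gobj \<bb>1 V)" "bij_betw snd (gobj \<pp> (V, W)) (gobj \<bb>2 W)"
    by (simp_all add: pullback_def)
qed

lemma pullback_morphisms: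
  assumes "(v, w) \<in> Arr (base \<pp>)" "(B, C) \<in> gobj \<pp> (Dom (base \<pp>) (v, w))" "(B', C') \<in> gobj \<pp> (Cod (base \<pp>) (v, w))"
  shows "bij_betw fst (carrier (gmor \<pp> (v, w) (B, C) (B', C'))) (carrier (gmor \<bb>1 v B B'))"
    and "bij_betw snd (carrier (gmor \<pp> (v, w) (B, C) (B', C'))) (carrier (gmor \<bb>2 w C C'))"
proof -
  obtain N :: "('k, 'x) module" where "bij_betw (fmor F1 v B B') (carrier (gmor \<bb>1 v B B')) (carrier N)"
    "bij_betw (fmor F2 w C C') (carrier (gmor \<bb>2 w C C')) (carrier N)"
    by (rule common_target[OF assms]) (rule that; assumption)
  from bij_betw_fibre_product[OF this]
  show "bij_betw fst (carrier (gmor \<pp> (v, w) (B, C) (B', C'))) (carrier (gmor \<bb>1 v B B'))"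
    "bij_betw snd (carrier (gmor \<pp> (v, w) (B, C) (B', C'))) (carrier (gmor \<bb>2 w C C'))"
    by (simp_all add: pullback_simps pullback_module_carrier)
qed

lemma proj1_cartesian: "cartesian R \<pp> \<bb>1 proj1"
  using pullback_objects(1) pullback_morphisms(1)
  unfolding cartesian_def graded_functor_def is_functor_def
  by (auto simp: proj1_def pullback_simps) (auto simp: pullback_module_def mod_hom_def)

lemma proj2_cartesian: "cartesian R \<pp> \<bb>2 proj2"
  using pullback_objects(2) pullback_morphisms(2)
  unfolding cartesian_def graded_functor_def is_functor_def
  by (auto simp: proj2_def pullback_simps) (auto simp: pullback_module_def mod_hom_def)

end

section \<open>Products and equalizers of \<open>B\<^sub>\<infinity>\<close>-algebras\<close>

lemma map_word_comp: "map_word g (map_word f w) = map_word (\<lambda>n x. g n (f n x)) w"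
  by (simp add: map_word_def comp_def case_prod_unfold)

lemma map_word_cong:
  "(\<And>n x. (n, x) \<in> set w \<Longrightarrow> f n x = g n x) \<Longrightarrow> map_word f w = map_word g w"
  by (auto simp: map_word_def)

lemma words_mem: "\<lbrakk>w \<in> words V; (n, x) \<in> set w\<rbrakk> \<Longrightarrow> x \<in> carrier (grd V n)"
  by (auto simp: words_def)

lemma map_word_words:
  assumes "\<And>n x. x \<in> carrier (grd V n) \<Longrightarrow> f n x \<in> carrier (grd W n)" "w \<in> words V"
  shows "map_word f w \<in> words W"
  using assms by (auto simp: words_def map_word_def)

lemma
  assumes "binf_hom R V W f"
  shows binf_hom_mod_hom: "mod_hom R (grd V n) (grd W n) (f n)"
    and binf_hom_bop: "w \<in> words V \<Longrightarrow> f (bdeg w) (bop V w) = bop W (map_word f w)"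
    and binf_hom_mop: "\<lbrakk>v \<in> words V; w \<in> words V\<rbrakk> \<Longrightarrow>
      f (mdeg v w) (mop V v w) = mop W (map_word f v) (map_word f w)"
    and binf_hom_words: "w \<in> words V \<Longrightarrow> map_word f w \<in> words W"
  using assms by (auto simp: binf_hom_def intro: map_word_words mod_hom_closed)

lemma binf_hom_comp:
  assumes f: "binf_hom R V W f" and g: "binf_hom R W Z g"
  shows "binf_hom R V Z (\<lambda>n x. g n (f n x))"
  unfolding binf_hom_def
proof (intro conjI allI ballI)
  show "mod_hom R (grd V n) (grd Z n) (\<lambda>x. g n (f n x))" for n
    by (rule mod_hom_comp[OF binf_hom_mod_hom[OF f] binf_hom_mod_hom[OF g]])
  show "g (bdeg w) (f (bdeg w) (bop V w)) = bop Z (map_word (\<lambda>n x. g n (f n x)) w)" if "w \<in> words V" for w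
    using binf_hom_bop[OF g binf_hom_words[OF f that]]
    by (simp add: binf_hom_bop[OF f that] map_word_degrees map_word_comp)
  show "g (mdeg v w) (f (mdeg v w) (mop V v w)) =
      mop Z (map_word (\<lambda>n x. g n (f n x)) v) (map_word (\<lambda>n x. g n (f n x)) w)"
    if "v \<in> words V" "w \<in> words V" for v w
    using binf_hom_mop[OF g binf_hom_words[OF f that(1)] binf_hom_words[OF f that(2)]]
    by (simp add: binf_hom_mop[OF f that] map_word_degrees map_word_comp)
qed

lemma grd_binf_prod_carrier: "carrier (grd (binf_prod I V) n) = (\<Pi>\<^sub>E i\<in>I. carrier (grd (V i) n))"
  by (simp add: binf_prod_def)

lemma binf_prod_proj:
  assumes "i \<in> I"
  shows "binf_hom R (binf_prod I V) (V i) (\<lambda>n x. x i)"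
  using assms by (auto simp: binf_hom_def binf_prod_def mod_hom_def)

lemma binf_prod_tuple:
  assumes f: "\<And>i. i \<in> I \<Longrightarrow> binf_hom R T (V i) (f i)"
  shows "binf_hom R T (binf_prod I V) (\<lambda>n x. \<lambda>i\<in>I. f i n x)"
  unfolding binf_hom_def
proof (intro conjI allI ballI)
  fix n
  note h = binf_hom_mod_hom[OF f, of _ n]
  show "mod_hom R (grd T n) (grd (binf_prod I V) n) (\<lambda>x. \<lambda>i\<in>I. f i n x)"
    using mod_hom_closed[OF h] mod_hom_add[OF h] mod_hom_smult[OF h]
    by (intro mod_homI) (auto simp: binf_prod_def intro!: restrict_ext)
next
  have pr: "map_word (\<lambda>_ x. x i) (map_word (\<lambda>n x. \<lambda>i\<in>I. f i n x) w) = map_word (f i) w" if "i \<in> I" for i w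
    using that by (simp add: map_word_comp)
  show "(\<lambda>i\<in>I. f i (bdeg w) (bop T w)) = bop (binf_prod I V) (map_word (\<lambda>n x. \<lambda>i\<in>I. f i n x) w)"
    if "w \<in> words T" for w
    using binf_hom_bop[OF f that] by (auto simp: binf_prod_def pr intro!: restrict_ext)
  show "(\<lambda>i\<in>I. f i (mdeg v w) (mop T v w)) =
      mop (binf_prod I V) (map_word (\<lambda>n x. \<lambda>i\<in>I. f i n x) v) (map_word (\<lambda>n x. \<lambda>i\<in>I. f i n x) w)"
    if "v \<in> words T" "w \<in> words T" for v w
    using binf_hom_mop[OF f that] by (auto simp: binf_prod_def pr intro!: restrict_ext)
qed

text \<open>
  Words are zipped pairs of degrees and elements, which is the form in which the operations of a
  \<open>B\<^sub>\<infinity>\<close>-algebra are required to be multilinear.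
\<close>

lemma binf_algebra_bop_closed:
  assumes "binf_algebra R V" "w \<in> words V"
  shows "bop V w \<in> carrier (grd V (bdeg w))"
proof -
  let ?ds = "map fst w" and ?xs = "map snd w"
  have "?xs \<in> tuples (map (grd V) ?ds)"
    using assms(2) by (induction w) (auto simp: words_def tuples_def)
  from multilinear_closed[OF binf_algebra.bop_multilinear[OF assms(1)] this]
  have "bop V (zip ?ds ?xs) \<in> carrier (grd V (sum_list ?ds - int (length ?ds) + 2))" .
  moreover have "sum_list ?ds - int (length ?ds) + 2 = bdeg w"
    by (induction w) (auto simp: bdeg_def sdeg_def)
  ultimately show ?thesis by (simp add: zip_map_fst_snd)
qed

lemma binf_algebra_mop_closed:
  assumes "binf_algebra R V" "v \<in> words V" "w \<in> words V"
  shows "mop V v w \<in> carrier (grd V (mdeg v w))"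
proof -
  let ?ds = "map fst v" and ?xs = "map snd v" and ?es = "map fst w" and ?ys = "map snd w"
  have "?xs @ ?ys \<in> tuples (map (grd V) (?ds @ ?es))"
    using assms(2,3) by (induction v; induction w) (auto simp: words_def tuples_def)
  from multilinear_closed[OF binf_algebra.mop_multilinear[OF assms(1)] this]
  have "mop V (zip ?ds ?xs) (zip ?es ?ys) \<in> carrier (grd V (sum_list (?ds @ ?es) - int (length (?ds @ ?es)) + 1))"
    by simp
  moreover have "sum_list (map fst u) - int (length u) = sdeg u" for u :: "(int \<times> 'b) list"
    by (induction u) (auto simp: sdeg_def)
  from this[of v] this[of w] have "sum_list (?ds @ ?es) - int (length (?ds @ ?es)) + 1 = mdeg v w"
    by (simp add: mdeg_def)
  ultimately show ?thesis by (simp add: zip_map_fst_snd)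
qed

text \<open>
  As a map of graded modules, a homomorphism into the subset where \<open>f\<close> and \<open>g\<close> agree lifts uniquely
  along the bijection \<open>e\<close>.  The lift respects the operations because \<open>e\<close> is an injective
  homomorphism.
\<close>

lemma binf_equalizerI:
  fixes R :: "'k ring"
  assumes e: "binf_hom R E P e" and f: "binf_hom R P Q f" and g: "binf_hom R P Q g"
    and bij: "\<And>n. bij_betw (e n) (carrier (grd E n)) {y \<in> carrier (grd P n). f n y = g n y}"
    and add: "\<And>n x y. \<lbrakk>x \<in> carrier (grd E n); y \<in> carrier (grd E n)\<rbrakk> \<Longrightarrow> x \<oplus>\<^bsub>grd E n\<^esub> y \<in> carrier (grd E n)"
    and smult: "\<And>n c x. \<lbrakk>c \<in> carrier R; x \<in> carrier (grd E n)\<rbrakk> \<Longrightarrow> c \<odot>\<^bsub>grd E n\<^esub> x \<in> carrier (grd E n)"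
    and bop: "\<And>w. w \<in> words E \<Longrightarrow> bop E w \<in> carrier (grd E (bdeg w))"
    and mop: "\<And>v w. \<lbrakk>v \<in> words E; w \<in> words E\<rbrakk> \<Longrightarrow> mop E v w \<in> carrier (grd E (mdeg v w))"
  shows "binf_equalizer TYPE('t) R E P Q e f g"
  unfolding binf_equalizer_def
proof (intro conjI allI impI e f g)
  have inj: "x = y" if "e n x = e n y" "x \<in> carrier (grd E n)" "y \<in> carrier (grd E n)" for n x y
    using bij[of n] that by (auto simp: bij_betw_def inj_on_def)
  show "\<forall>x\<in>carrier (grd E n). f n (e n x) = g n (e n x)" for n
    using bij[of n] by (auto simp: bij_betw_def)
  fix T :: "('k, 't) binf" and h
  assume "binf_algebra R T \<and> binf_hom R T P h \<and> (\<forall>n. \<forall>x\<in>carrier (grd T n). f n (h n x) = g n (h n x))"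
  then have T: "binf_algebra R T" and h: "binf_hom R T P h"
    and eq: "\<And>n x. x \<in> carrier (grd T n) \<Longrightarrow> f n (h n x) = g n (h n x)" by auto
  define t where "t = (\<lambda>n x. inv_into (carrier (grd E n)) (e n) (h n x))"
  have t: "t n x \<in> carrier (grd E n) \<and> e n (t n x) = h n x" if "x \<in> carrier (grd T n)" for n x
  proof -
    have "h n x \<in> e n ` carrier (grd E n)"
      using bij[of n] eq[OF that] mod_hom_closed[OF binf_hom_mod_hom[OF h] that] by (auto simp: bij_betw_def)
    then show ?thesis by (simp add: t_def inv_into_into f_inv_into_f)
  qed
  have tw: "map_word t w \<in> words E \<and> map_word e (map_word t w) = map_word h w" if "w \<in> words T" for w
    using that t unfolding map_word_comp by (auto intro!: map_word_words map_word_cong dest: words_mem)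
  have "binf_hom R T E t"
    unfolding binf_hom_def
  proof (intro conjI allI ballI)
    fix n
    interpret T: module R "grd T n" using T by (rule binf_algebra.grd_module)
    note e' = binf_hom_mod_hom[OF e, of n] and h' = binf_hom_mod_hom[OF h, of n]
    show "mod_hom R (grd T n) (grd E n) (t n)"
      by (intro mod_homI inj[of n]) (simp_all add: t add smult mod_hom_add[OF e'] mod_hom_add[OF h']
          mod_hom_smult[OF e'] mod_hom_smult[OF h'])
  next
    fix w assume w: "w \<in> words T"
    show "t (bdeg w) (bop T w) = bop E (map_word t w)"
      using t[OF binf_algebra_bop_closed[OF T w]] tw[OF w] bop[of "map_word t w"]
        binf_hom_bop[OF e, of "map_word t w"] binf_hom_bop[OF h w]
      by (intro inj) (auto simp: map_word_degrees)
  next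
    fix v w assume v: "v \<in> words T" and w: "w \<in> words T"
    show "t (mdeg v w) (mop T v w) = mop E (map_word t v) (map_word t w)"
      using t[OF binf_algebra_mop_closed[OF T v w]] tw[OF v] tw[OF w] mop[of "map_word t v" "map_word t w"]
        binf_hom_mop[OF e, of "map_word t v" "map_word t w"] binf_hom_mop[OF h v w]
      by (intro inj) (auto simp: map_word_degrees)
  qed
  moreover have "t' n x = t n x"
    if "binf_hom R T E t'" "\<forall>n. \<forall>x\<in>carrier (grd T n). e n (t' n x) = h n x" "x \<in> carrier (grd T n)" for t' n x
  proof (rule inj[of n])
    show "e n (t' n x) = e n (t n x)" using that(2,3) t by simp
    show "t' n x \<in> carrier (grd E n)" by (rule mod_hom_closed[OF binf_hom_mod_hom[OF that(1)] that(3)])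
    show "t n x \<in> carrier (grd E n)" using t that(3) by blast
  qed
  moreover have "\<forall>n. \<forall>x\<in>carrier (grd T n). e n (t n x) = h n x" using t by blast
  ultimately show "\<exists>t. binf_hom R T E t \<and> (\<forall>n. \<forall>x\<in>carrier (grd T n). e n (t n x) = h n x) \<and>
      (\<forall>t'. binf_hom R T E t' \<and> (\<forall>n. \<forall>x\<in>carrier (grd T n). e n (t' n x) = h n x) \<longrightarrow>
        (\<forall>n. \<forall>x\<in>carrier (grd T n). t' n x = t n x))"
    by (intro exI[of _ t] conjI allI impI ballI) blast+
qed

section \<open>Cochains on a fibre product\<close>

lemma proj_simps:
  "fob proj1 = fst" "farr proj1 = fst" "fobj proj1 V = fst" "fmor proj1 v B B' = fst"
  "fob proj2 = snd" "farr proj2 = snd" "fobj proj2 V = snd" "fmor proj2 v B B' = snd"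
  by (simp_all add: proj1_def proj2_def)

lemma on_target_proj:
  "on_target \<pp> proj1 \<sigma> = fst" "on_target \<pp> proj2 \<sigma> = snd"
  by (cases \<sigma>; simp add: on_target_def whole_def proj1_def proj2_def)+

context cartesian_cospan
begin

sublocale proj1: cartesian_functor R \<pp> \<bb>1 proj1
  by (intro cartesian_functor.intro cartesian_functor_axioms.intro pullback_map_graded left.src.map_graded_axioms
      proj1_cartesian)

sublocale proj2: cartesian_functor R \<pp> \<bb>2 proj2
  by (intro cartesian_functor.intro cartesian_functor_axioms.intro pullback_map_graded right.src.map_graded_axioms
      proj2_cartesian)

text \<open>
  The type of the projections is fixed here because \<^const>\<open>map_simplex\<close> involves only the parts of
  a graded functor in which the element types of the modules do not occur.
\<close>

abbreviation \<pi>1 :: "('o1 \<times> 'o2, 'm1 \<times> 'm2, 'a1 \<times> 'a2, 'x1 \<times> 'x2, 'o1, 'm1, 'a1, 'x1) gfun" where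
  "\<pi>1 \<equiv> proj1"

abbreviation \<pi>2 :: "('o1 \<times> 'o2, 'm1 \<times> 'm2, 'a1 \<times> 'a2, 'x1 \<times> 'x2, 'o2, 'm2, 'a2, 'x2) gfun" where
  "\<pi>2 \<equiv> proj2"

lemma square_simplex:
  assumes "\<sigma> \<in> simplices \<pp> n"
  shows "map_simplex F1 (map_simplex \<pi>1 \<sigma>) = map_simplex F2 (map_simplex \<pi>2 \<sigma>)"
proof -
  obtain Us us As where \<sigma>: "\<sigma> = (Us, us, As)" by (cases \<sigma>)
  have "length As = length Us"
    and ob: "\<And>i. i < length Us \<Longrightarrow> Us ! i \<in> Ob (base \<pp>)"
    and ar: "\<And>i. i < length us \<Longrightarrow> us ! i \<in> Arr (base \<pp>)"
    and gob: "\<And>i. i < length Us \<Longrightarrow> As ! i \<in> gobj \<pp> (Us ! i)"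
    using assms by (auto simp: \<sigma> simplices_iff nerve_iff)
  moreover have "fob F1 (fst (Us ! i)) = fob F2 (snd (Us ! i))" if "i < length Us" for i
    using ob[OF that] by (cases "Us ! i") (simp add: pullback_simps)
  moreover have "farr F1 (fst (us ! i)) = farr F2 (snd (us ! i))" if "i < length us" for i
    using ar[OF that] by (cases "us ! i") (simp add: pullback_simps)
  moreover have "fobj F1 (fst (Us ! i)) (fst (As ! i)) = fobj F2 (snd (Us ! i)) (snd (As ! i))" if "i < length Us" for i
    using gob[OF that] by (cases "Us ! i"; cases "As ! i") (simp add: pullback_simps)
  ultimately have "map (fob F1) (map fst Us) = map (fob F2) (map snd Us)"
    "map (farr F1) (map fst us) = map (farr F2) (map snd us)"
    "map2 (fobj F1) (map fst Us) (map2 (\<lambda>_. fst) Us As) = map2 (fobj F2) (map snd Us) (map2 (\<lambda>_. snd) Us As)"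
    by (intro nth_equalityI; simp)+
  then show ?thesis
    by (simp add: \<sigma> map_simplex_def proj_simps)
qed

lemma square_target:
  assumes "\<sigma> \<in> simplices \<pp> n" "x \<in> carrier (target \<pp> \<sigma>)"
  shows "left.target_map (map_simplex \<pi>1 \<sigma>) (fst x) = right.target_map (map_simplex \<pi>2 \<sigma>) (snd x)"
proof -
  obtain m where n: "n = int m" using simplex_nat[OF assms(1)] by blast
  note \<sigma> = assms(1)[unfolded n]
  obtain v w B C B' C' where eq: "path (base \<pp>) \<sigma> = (v, w)" "vert \<sigma> m = (B, C)" "vert \<sigma> 0 = (B', C')"
    by (cases "path (base \<pp>) \<sigma>"; cases "vert \<sigma> m"; cases "vert \<sigma> 0")
  have "target \<pp> \<sigma> = pullback_module (gmor \<bb>1 v B B') (gmor \<bb>2 w C C') (fmor F1 v B B') (fmor F2 w C C')"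
    by (simp add: target_whole proj1.src.whole_simplex[OF \<sigma>] eq pullback_simps)
  then have "fmor F1 v B B' (fst x) = fmor F2 w C C' (snd x)"
    using assms(2) by (auto simp: pullback_module_carrier)
  moreover have "left.target_map (map_simplex \<pi>1 \<sigma>) = fmor F1 v B B'"
    using proj1.map_simplex_vert[OF \<sigma>, of 0 m] proj1.path_map_simplex[OF \<sigma>] eq
    by (simp add: on_target_def left.src.whole_simplex[OF proj1.map_simplex_closed[OF \<sigma>]] proj_simps)
  moreover have "right.target_map (map_simplex \<pi>2 \<sigma>) = fmor F2 w C C'"
    using proj2.map_simplex_vert[OF \<sigma>, of 0 m] proj2.path_map_simplex[OF \<sigma>] eq
    by (simp add: on_target_def right.src.whole_simplex[OF proj2.map_simplex_closed[OF \<sigma>]] proj_simps)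
  ultimately show ?thesis by simp
qed

lemma square_args:
  assumes "\<sigma> \<in> simplices \<pp> n" and fs: "fs \<in> tuples (sources \<pp> \<sigma>)"
  shows "left.args_map (map_simplex \<pi>1 \<sigma>) (on_args \<pi>1 \<sigma> fs) = right.args_map (map_simplex \<pi>2 \<sigma>) (on_args \<pi>2 \<sigma> fs)"
proof -
  obtain m where n: "n = int m" using simplex_nat[OF assms(1)] by blast
  note \<sigma> = assms(1)[unfolded n]
  note \<sigma>1 = proj1.map_simplex_closed[OF \<sigma>] and \<sigma>2 = proj2.map_simplex_closed[OF \<sigma>]
  note fs1 = proj1.args_map_closed[OF \<sigma> fs] and fs2 = proj2.args_map_closed[OF \<sigma> fs]
  show ?thesis
  proof (rule nth_equalityI)
    show "length (left.args_map (map_simplex \<pi>1 \<sigma>) (on_args \<pi>1 \<sigma> fs)) =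
        length (right.args_map (map_simplex \<pi>2 \<sigma>) (on_args \<pi>2 \<sigma> fs))"
      using tuples_length[OF left.args_map_closed[OF \<sigma>1 fs1]] tuples_length[OF right.args_map_closed[OF \<sigma>2 fs2]]
        square_simplex[OF \<sigma>] by simp
    fix i assume "i < length (left.args_map (map_simplex \<pi>1 \<sigma>) (on_args \<pi>1 \<sigma> fs))"
    then have i: "i < m"
      using tuples_length[OF left.args_map_closed[OF \<sigma>1 fs1]]
        left.tgt.length_sources[OF left.map_simplex_closed[OF \<sigma>1]] by simp
    have s: "seg i (Suc i) \<sigma> \<in> simplices \<pp> (int 1)" using seg_simplex[OF \<sigma>, of i "Suc i"] i by simp
    have "fs ! i \<in> carrier (target \<pp> (seg i (Suc i) \<sigma>))"
      using tuples_nth[OF fs, of i] i proj1.src.edge_target[OF \<sigma> i] proj1.src.length_sources[OF \<sigma>] by simp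
    from square_target[OF s this]
    show "left.args_map (map_simplex \<pi>1 \<sigma>) (on_args \<pi>1 \<sigma> fs) ! i =
        right.args_map (map_simplex \<pi>2 \<sigma>) (on_args \<pi>2 \<sigma> fs) ! i"
      by (simp add: left.args_map_nth[OF \<sigma>1 fs1 i] right.args_map_nth[OF \<sigma>2 fs2 i]
          proj1.args_map_nth[OF \<sigma> fs i] proj2.args_map_nth[OF \<sigma> fs i] map_simplex_seg on_target_proj)
  qed
qed

text \<open>
  Both composites re-index a cochain along the same map of simplices.
\<close>

lemma hpull_square:
  assumes \<phi>: "\<phi> \<in> carrier (cochains R \<aa> n)"
  shows "hpull \<pp> \<pi>1 n (hpull \<bb>1 F1 n \<phi>) = hpull \<pp> \<pi>2 n (hpull \<bb>2 F2 n \<phi>)"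
proof (rule proj1.hpull_eqI[OF proj2.hpull_closed[OF right.hpull_closed[OF \<phi>]]])
  fix \<sigma> fs assume \<sigma>: "\<sigma> \<in> simplices \<pp> n" and fs: "fs \<in> tuples (sources \<pp> \<sigma>)"
  let ?x = "hpull \<pp> \<pi>2 n (hpull \<bb>2 F2 n \<phi>) \<sigma> fs"
  note \<sigma>1 = proj1.map_simplex_closed[OF \<sigma>] and \<sigma>2 = proj2.map_simplex_closed[OF \<sigma>]
  note fs1 = proj1.args_map_closed[OF \<sigma> fs] and fs2 = proj2.args_map_closed[OF \<sigma> fs]
  note x = proj2.hpull_apply[OF right.hpull_closed[OF \<phi>] \<sigma> fs]
  have "left.target_map (map_simplex \<pi>1 \<sigma>) (fst ?x) =
      left.target_map (map_simplex \<pi>1 \<sigma>) (hpull \<bb>1 F1 n \<phi> (map_simplex \<pi>1 \<sigma>) (on_args \<pi>1 \<sigma> fs))"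
    using square_target[OF \<sigma> x(1)] x(2) left.hpull_apply(2)[OF \<phi> \<sigma>1 fs1] right.hpull_apply(2)[OF \<phi> \<sigma>2 fs2]
    by (simp add: on_target_proj square_simplex[OF \<sigma>] square_args[OF \<sigma> fs])
  moreover have "fst ?x \<in> carrier (target \<bb>1 (map_simplex \<pi>1 \<sigma>))"
    using mod_hom_closed[OF proj1.target_map_hom[OF \<sigma>] x(1)] by (simp add: on_target_proj)
  ultimately show "on_target \<pp> \<pi>1 \<sigma> ?x = hpull \<bb>1 F1 n \<phi> (map_simplex \<pi>1 \<sigma>) (on_args \<pi>1 \<sigma> fs)"
    using left.target_map_bij[OF \<sigma>1] left.hpull_apply(1)[OF \<phi> \<sigma>1 fs1]
    by (simp add: on_target_proj bij_betw_def inj_on_def)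
qed

lemma pair_simplex:
  assumes "\<sigma>1 \<in> simplices \<bb>1 n" "\<sigma>2 \<in> simplices \<bb>2 n" and eq: "map_simplex F1 \<sigma>1 = map_simplex F2 \<sigma>2"
  obtains \<sigma> where "\<sigma> \<in> simplices \<pp> n" "map_simplex \<pi>1 \<sigma> = \<sigma>1" "map_simplex \<pi>2 \<sigma> = \<sigma>2"
proof -
  obtain Us us As Vs vs Bs where \<sigma>: "\<sigma>1 = (Us, us, As)" "\<sigma>2 = (Vs, vs, Bs)" by (cases \<sigma>1; cases \<sigma>2)
  obtain m where n: "n = int m" using simplex_nat[OF assms(1)] by blast
  have len: "length Us = Suc m" "length us = m" "length As = Suc m" "length Vs = Suc m" "length vs = m" "length Bs = Suc m"
    using assms(1,2) by (auto simp: \<sigma> n simplices_iff nerve_iff)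
  have eqs: "map (fob F1) Us = map (fob F2) Vs" "map (farr F1) us = map (farr F2) vs"
    "map2 (fobj F1) Us As = map2 (fobj F2) Vs Bs"
    using eq by (simp_all add: \<sigma> map_simplex_def)
  have "fob F1 (Us ! i) = fob F2 (Vs ! i)" "fobj F1 (Us ! i) (As ! i) = fobj F2 (Vs ! i) (Bs ! i)" if "i \<le> m" for i
    using arg_cong[OF eqs(1), of "\<lambda>l. l ! i"] arg_cong[OF eqs(3), of "\<lambda>l. l ! i"] that len by simp_all
  moreover have "farr F1 (us ! i) = farr F2 (vs ! i)" if "i < m" for i
    using arg_cong[OF eqs(2), of "\<lambda>l. l ! i"] that len by simp
  ultimately have "(zip Us Vs, zip us vs, zip As Bs) \<in> simplices \<pp> n"
    using assms(1,2) len by (auto simp: \<sigma> n simplices_iff nerve_iff pullback_simps less_Suc_eq_le)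
  moreover have "map_simplex \<pi>1 (zip Us Vs, zip us vs, zip As Bs) = \<sigma>1"
    "map_simplex \<pi>2 (zip Us Vs, zip us vs, zip As Bs) = \<sigma>2"
    using len by (auto simp: \<sigma> map_simplex_def proj_simps intro!: nth_equalityI)
  ultimately show thesis by (rule that)
qed

text \<open>
  Two lifts of a simplex, together with lifts of its arguments, are the projections of one simplex
  and arguments over the pullback, where the two restrictions agree by assumption.  This makes
  gluing independent of choices.
\<close>

lemma compatible_values:
  assumes \<phi>: "\<phi>1 \<in> carrier (cochains R \<bb>1 n)" "\<phi>2 \<in> carrier (cochains R \<bb>2 n)"
    and comp: "hpull \<pp> \<pi>1 n \<phi>1 = hpull \<pp> \<pi>2 n \<phi>2"
    and \<sigma>: "\<sigma>1 \<in> simplices \<bb>1 n" "\<sigma>2 \<in> simplices \<bb>2 n" "map_simplex F1 \<sigma>1 = map_simplex F2 \<sigma>2"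
    and fs: "fs1 \<in> tuples (sources \<bb>1 \<sigma>1)" "fs2 \<in> tuples (sources \<bb>2 \<sigma>2)"
      "left.args_map \<sigma>1 fs1 = right.args_map \<sigma>2 fs2"
  shows "left.target_map \<sigma>1 (\<phi>1 \<sigma>1 fs1) = right.target_map \<sigma>2 (\<phi>2 \<sigma>2 fs2)"
proof -
  obtain \<sigma> where s: "\<sigma> \<in> simplices \<pp> n" "map_simplex \<pi>1 \<sigma> = \<sigma>1" "map_simplex \<pi>2 \<sigma> = \<sigma>2"
    by (rule pair_simplex[OF \<sigma>])
  obtain gs where gs: "gs \<in> tuples (sources \<pp> \<sigma>)" "on_args \<pi>1 \<sigma> gs = fs1"
  proof -
    have "fs1 \<in> on_args \<pi>1 \<sigma> ` tuples (sources \<pp> \<sigma>)"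
      unfolding bij_betw_imp_surj_on[OF proj1.args_map_bij[OF s(1)]] s(2) by (rule fs(1))
    then show thesis using that by blast
  qed
  have "right.args_map \<sigma>2 (on_args \<pi>2 \<sigma> gs) = right.args_map \<sigma>2 fs2"
    using square_args[OF s(1) gs(1)] gs(2) s fs(3) by simp
  then have gs2: "on_args \<pi>2 \<sigma> gs = fs2"
    using right.args_map_bij[OF \<sigma>(2)] proj2.args_map_closed[OF s(1) gs(1)] fs(2) s(3)
    by (auto simp: bij_betw_def inj_on_def)
  show ?thesis
    using square_target[OF s(1) proj1.hpull_apply(1)[OF \<phi>(1) s(1) gs(1)]]
      proj1.hpull_apply(2)[OF \<phi>(1) s(1) gs(1)] proj2.hpull_apply(2)[OF \<phi>(2) s(1) gs(1)] comp s gs(2) gs2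
    by (simp add: on_target_proj)
qed

end

section \<open>Descent along an \<open>\<infinity>\<close>-cover\<close>

locale infinity_covering =
  fixes R :: "'k ring" and \<aa> :: "('k, 'o, 'm, 'a, 'x) mgcat" and I :: "'i set"
    and \<bb> :: "'i \<Rightarrow> ('k, 'o', 'm', 'a', 'x') mgcat"
    and F :: "'i \<Rightarrow> ('o', 'm', 'a', 'x', 'o, 'm, 'a, 'x) gfun"
  assumes base_graded: "map_graded R \<aa>"
    and cover_graded: "i \<in> I \<Longrightarrow> map_graded R (\<bb> i)"
    and cover: "infinity_cover R I \<bb> \<aa> F"
begin

sublocale base: map_graded R \<aa>
  by (rule base_graded)

abbreviation \<qq> where "\<qq> i j \<equiv> pullback (\<bb> i) (F i) (\<bb> j) (F j)"

lemma member_cartesian: "i \<in> I \<Longrightarrow> cartesian_functor R (\<bb> i) \<aa> (F i)"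
  using cover
  by (intro cartesian_functor.intro cartesian_functor_axioms.intro base_graded cover_graded)
    (auto simp: infinity_cover_def)

lemma cospan: "\<lbrakk>i \<in> I; j \<in> I\<rbrakk> \<Longrightarrow> cartesian_cospan R (\<bb> i) (\<bb> j) \<aa> (F i) (F j)"
  by (intro cartesian_cospan.intro member_cartesian)

text \<open>
  The cover condition concerns simplices of the nerve only; the objects of the fibres lift because
  the functors are bijective on them.
\<close>

lemma lift_simplex:
  assumes "\<tau> \<in> simplices \<aa> n"
  obtains i \<sigma> where "i \<in> I" "\<sigma> \<in> simplices (\<bb> i) n" "map_simplex (F i) \<sigma> = \<tau>"
proof -
  obtain Us us As where \<tau>: "\<tau> = (Us, us, As)" by (cases \<tau>)
  have Uu: "(Us, us) \<in> nerve (base \<aa>) (length us)" "n = int (length us)" "length As = length Us"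
    and As: "\<And>k. k < length Us \<Longrightarrow> As ! k \<in> gobj \<aa> (Us ! k)"
    using assms by (auto simp: \<tau> simplices_iff)
  have "(Us, us) \<in> (\<Union>i\<in>I. nerve_map (fob (F i)) (farr (F i)) ` nerve (base (\<bb> i)) (length us))"
    using cover Uu(1) by (simp add: infinity_cover_def)
  then obtain i Vs vs where i: "i \<in> I" and V: "(Vs, vs) \<in> nerve (base (\<bb> i)) (length us)"
    and eq: "map (fob (F i)) Vs = Us" "map (farr (F i)) vs = us"
    by (auto simp: nerve_map_def)
  interpret cartesian_functor R "\<bb> i" \<aa> "F i" by (rule member_cartesian[OF i])
  have len: "length Vs = length Us" "length vs = length us" using eq by auto
  have "\<exists>B \<in> gobj (\<bb> i) (Vs ! k). fobj (F i) (Vs ! k) B = As ! k" if k: "k < length Us" for k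
  proof -
    have "Vs ! k \<in> Ob (base (\<bb> i))" using V k len by (auto simp: nerve_def)
    then have "fobj (F i) (Vs ! k) ` gobj (\<bb> i) (Vs ! k) = gobj \<aa> (fob (F i) (Vs ! k))"
      using cart by (simp add: cartesian_def bij_betw_def)
    moreover have "fob (F i) (Vs ! k) = Us ! k" using eq(1) k len by (metis nth_map)
    ultimately have "As ! k \<in> fobj (F i) (Vs ! k) ` gobj (\<bb> i) (Vs ! k)" using As[OF k] by simp
    then show ?thesis by force
  qed
  then obtain B where B: "\<And>k. k < length Us \<Longrightarrow> B k \<in> gobj (\<bb> i) (Vs ! k) \<and> fobj (F i) (Vs ! k) (B k) = As ! k"
    by metis
  let ?\<sigma> = "(Vs, vs, map B [0..<length Us])"
  have "?\<sigma> \<in> simplices (\<bb> i) n"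
    using V B Uu len by (simp add: simplices_iff)
  moreover have "map2 (fobj (F i)) Vs (map B [0..<length Us]) = As"
    using B Uu len by (intro nth_equalityI) auto
  then have "map_simplex (F i) ?\<sigma> = \<tau>"
    by (simp add: map_simplex_def \<tau> eq)
  ultimately show thesis using i by (rule that[rotated])
qed

text \<open>
  A cochain is determined by its values, and every simplex together with its arguments comes from
  some member of the cover.
\<close>

lemma restrictions_injective:
  assumes \<phi>: "\<phi> \<in> carrier (cochains R \<aa> n)" and \<psi>: "\<psi> \<in> carrier (cochains R \<aa> n)"
    and eq: "\<And>i. i \<in> I \<Longrightarrow> hpull (\<bb> i) (F i) n \<phi> = hpull (\<bb> i) (F i) n \<psi>"
  shows "\<phi> = \<psi>"
proof (rule cochain_eqI[OF \<phi> \<psi>])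
  fix \<tau> gs assume \<tau>: "\<tau> \<in> simplices \<aa> n" and gs: "gs \<in> tuples (sources \<aa> \<tau>)"
  obtain i \<sigma> where i: "i \<in> I" and \<sigma>: "\<sigma> \<in> simplices (\<bb> i) n" "map_simplex (F i) \<sigma> = \<tau>"
    using lift_simplex[OF \<tau>] .
  interpret cartesian_functor R "\<bb> i" \<aa> "F i" by (rule member_cartesian[OF i])
  obtain fs where fs: "fs \<in> tuples (sources (\<bb> i) \<sigma>)" "args_map \<sigma> fs = gs"
    using args_map_bij[OF \<sigma>(1)] gs \<sigma>(2) by (metis bij_betw_imp_surj_on imageE)
  show "\<phi> \<tau> gs = \<psi> \<tau> gs"
    using hpull_apply(2)[OF \<phi> \<sigma>(1) fs(1)] hpull_apply(2)[OF \<psi> \<sigma>(1) fs(1)] eq[OF i] \<sigma>(2) fs(2) by simp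
qed

text \<open>
  The values which the family prescribes at a simplex of \<open>\<aa>\<close>, one for each lift; for a compatible
  family they all coincide.
\<close>

definition local_value :: "int \<Rightarrow> ('i \<Rightarrow> ('o', 'm', 'a', 'x') cochain) \<Rightarrow> ('o, 'm, 'a) simplex \<Rightarrow> 'x list \<Rightarrow> 'x \<Rightarrow> bool" where
  "local_value n \<phi> \<tau> gs y \<longleftrightarrow> (\<exists>i\<in>I. \<exists>\<sigma>\<in>simplices (\<bb> i) n. \<exists>fs\<in>tuples (sources (\<bb> i) \<sigma>).
     map_simplex (F i) \<sigma> = \<tau> \<and> on_args (F i) \<sigma> fs = gs \<and> y = on_target (\<bb> i) (F i) \<sigma> (\<phi> i \<sigma> fs))"

definition glue :: "int \<Rightarrow> ('i \<Rightarrow> ('o', 'm', 'a', 'x') cochain) \<Rightarrow> ('o, 'm, 'a, 'x) cochain" where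
  "glue n \<phi> = (\<lambda>\<tau>\<in>simplices \<aa> n. \<lambda>gs\<in>tuples (sources \<aa> \<tau>). SOME y. local_value n \<phi> \<tau> gs y)"

context
  fixes n :: int and \<phi> :: "'i \<Rightarrow> ('o', 'm', 'a', 'x') cochain"
  assumes \<phi>: "\<And>i. i \<in> I \<Longrightarrow> \<phi> i \<in> carrier (cochains R (\<bb> i) n)"
    and compatible: "\<And>i j. \<lbrakk>i \<in> I; j \<in> I\<rbrakk> \<Longrightarrow>
      hpull (\<qq> i j) proj1 n (\<phi> i) = hpull (\<qq> i j) proj2 n (\<phi> j)"
begin

lemma glue_apply:
  assumes i: "i \<in> I" and \<sigma>: "\<sigma> \<in> simplices (\<bb> i) n" and fs: "fs \<in> tuples (sources (\<bb> i) \<sigma>)"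
  shows "glue n \<phi> (map_simplex (F i) \<sigma>) (on_args (F i) \<sigma> fs) = on_target (\<bb> i) (F i) \<sigma> (\<phi> i \<sigma> fs)"
proof -
  interpret i: cartesian_functor R "\<bb> i" \<aa> "F i" by (rule member_cartesian[OF i])
  let ?y = "on_target (\<bb> i) (F i) \<sigma> (\<phi> i \<sigma> fs)"
  have "local_value n \<phi> (map_simplex (F i) \<sigma>) (on_args (F i) \<sigma> fs) ?y"
    unfolding local_value_def using i \<sigma> fs by blast
  moreover have "y = ?y" if y: "local_value n \<phi> (map_simplex (F i) \<sigma>) (on_args (F i) \<sigma> fs) y" for y
  proof -
    obtain j \<sigma>' fs' where j: "j \<in> I" "\<sigma>' \<in> simplices (\<bb> j) n" "fs' \<in> tuples (sources (\<bb> j) \<sigma>')"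
      "map_simplex (F j) \<sigma>' = map_simplex (F i) \<sigma>" "on_args (F j) \<sigma>' fs' = on_args (F i) \<sigma> fs"
      "y = on_target (\<bb> j) (F j) \<sigma>' (\<phi> j \<sigma>' fs')"
      using y unfolding local_value_def by blast
    show ?thesis
      using cartesian_cospan.compatible_values[OF cospan[OF j(1) i] \<phi>[OF j(1)] \<phi>[OF i] compatible[OF j(1) i] j(2) \<sigma> j(4) j(3) fs j(5)]
        j(6) by simp
  qed
  ultimately have "(SOME y. local_value n \<phi> (map_simplex (F i) \<sigma>) (on_args (F i) \<sigma> fs) y) = ?y"
    by (rule some_equality)
  then show ?thesis
    using i.map_simplex_closed[OF \<sigma>] i.args_map_closed[OF \<sigma> fs] by (simp add: glue_def)
qed

text \<open>
  The choice of a lift is made for each simplex and each list of arguments separately, but one lift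
  of the simplex serves for all arguments, so that multilinearity is inherited from the cover.
\<close>

lemma glue_closed: "glue n \<phi> \<in> carrier (cochains R \<aa> n)"
proof -
  have "multilinear R (sources \<aa> \<tau>) (target \<aa> \<tau>) (glue n \<phi> \<tau>)" if \<tau>: "\<tau> \<in> simplices \<aa> n" for \<tau>
  proof -
    obtain i \<sigma> where i: "i \<in> I" and \<sigma>: "\<sigma> \<in> simplices (\<bb> i) n" "map_simplex (F i) \<sigma> = \<tau>"
      using lift_simplex[OF \<tau>] .
    interpret cartesian_functor R "\<bb> i" \<aa> "F i" by (rule member_cartesian[OF i])
    show ?thesis
      using multilinear_push[OF sources_iso[OF \<sigma>(1)] src.source_module[OF \<sigma>(1)] target_map_hom[OF \<sigma>(1)] _
          cochain_multilinear[OF \<phi>[OF i] \<sigma>(1)]] glue_apply[OF i \<sigma>(1)]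
      by (simp add: on_args_def \<sigma>(2))
  qed
  then show ?thesis by (auto simp: cochains_iff glue_def)
qed

lemma glue_restrict: "i \<in> I \<Longrightarrow> hpull (\<bb> i) (F i) n (glue n \<phi>) = \<phi> i"
  using glue_apply by (intro cartesian_functor.hpull_eqI[OF member_cartesian] \<phi>) auto

end

lemma grd_prod: "carrier (grd (binf_prod I (\<lambda>i. hoch R (\<bb> i))) n) = (\<Pi>\<^sub>E i\<in>I. carrier (cochains R (\<bb> i) n))"
  by (simp add: grd_binf_prod_carrier hoch_def)

lemma overlap_res_eq_iff:
  "overlap_res1 I \<bb> F n \<phi> = overlap_res2 I \<bb> F n \<phi> \<longleftrightarrow> (\<forall>i\<in>I. \<forall>j\<in>I.
      hpull (\<qq> i j) proj1 n (\<phi> i) = hpull (\<qq> i j) proj2 n (\<phi> j))"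
proof
  assume eq: "overlap_res1 I \<bb> F n \<phi> = overlap_res2 I \<bb> F n \<phi>"
  show "\<forall>i\<in>I. \<forall>j\<in>I. hpull (\<qq> i j) proj1 n (\<phi> i) =
      hpull (\<qq> i j) proj2 n (\<phi> j)"
  proof (intro ballI)
    fix i j assume "i \<in> I" "j \<in> I"
    then show "hpull (\<qq> i j) proj1 n (\<phi> i) =
        hpull (\<qq> i j) proj2 n (\<phi> j)"
      using fun_cong[OF eq, of "(i, j)"] by (simp add: overlap_res1_def overlap_res2_def overlap_def)
  qed
next
  assume "\<forall>i\<in>I. \<forall>j\<in>I. hpull (\<qq> i j) proj1 n (\<phi> i) =
      hpull (\<qq> i j) proj2 n (\<phi> j)"
  then show "overlap_res1 I \<bb> F n \<phi> = overlap_res2 I \<bb> F n \<phi>"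
    by (auto simp: overlap_res1_def overlap_res2_def overlap_def intro!: restrict_ext)
qed

text \<open>
  Gluing is inverse to restriction.
\<close>

theorem cover_res_bij:
  "bij_betw (cover_res I \<bb> F n) (carrier (cochains R \<aa> n))
     {\<phi> \<in> carrier (grd (binf_prod I (\<lambda>i. hoch R (\<bb> i))) n). overlap_res1 I \<bb> F n \<phi> = overlap_res2 I \<bb> F n \<phi>}"
    (is "bij_betw _ _ ?E")
  unfolding bij_betw_def
proof
  show "inj_on (cover_res I \<bb> F n) (carrier (cochains R \<aa> n))"
  proof (rule inj_onI, rule restrictions_injective)
    fix \<phi> \<psi> i assume eq: "cover_res I \<bb> F n \<phi> = cover_res I \<bb> F n \<psi>" and i: "i \<in> I"
    show "hpull (\<bb> i) (F i) n \<phi> = hpull (\<bb> i) (F i) n \<psi>"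
      using fun_cong[OF eq, of i] i by (simp add: cover_res_def)
  qed
  show "cover_res I \<bb> F n ` carrier (cochains R \<aa> n) = ?E"
  proof (intro equalityI subsetI)
    fix \<psi> assume "\<psi> \<in> cover_res I \<bb> F n ` carrier (cochains R \<aa> n)"
    then obtain \<phi> where \<phi>: "\<phi> \<in> carrier (cochains R \<aa> n)" "\<psi> = cover_res I \<bb> F n \<phi>" by blast
    have "cover_res I \<bb> F n \<phi> i = hpull (\<bb> i) (F i) n \<phi>" if "i \<in> I" for i
      using that by (simp add: cover_res_def)
    then show "\<psi> \<in> ?E"
      using cartesian_functor.hpull_closed[OF member_cartesian \<phi>(1)] cartesian_cospan.hpull_square[OF cospan \<phi>(1)]
      by (simp add: \<phi>(2) grd_prod overlap_res_eq_iff PiE_iff) (simp add: cover_res_def)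
  next
    fix \<psi> assume "\<psi> \<in> ?E"
    then have \<psi>: "\<And>i. i \<in> I \<Longrightarrow> \<psi> i \<in> carrier (cochains R (\<bb> i) n)" "\<psi> \<in> extensional I"
      and comp: "\<And>i j. \<lbrakk>i \<in> I; j \<in> I\<rbrakk> \<Longrightarrow> hpull (\<qq> i j) proj1 n (\<psi> i) =
        hpull (\<qq> i j) proj2 n (\<psi> j)"
      by (auto simp: grd_prod overlap_res_eq_iff PiE_iff)
    have "cover_res I \<bb> F n (glue n \<psi>) = \<psi>"
      using \<psi>(2) glue_restrict[OF \<psi>(1) comp] by (auto simp: cover_res_def intro!: extensionalityI[of _ I])
    then show "\<psi> \<in> cover_res I \<bb> F n ` carrier (cochains R \<aa> n)"
      using glue_closed[OF \<psi>(1) comp] by (metis imageI)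
  qed
qed

lemma cover_res_hom: "binf_hom R (hoch R \<aa>) (binf_prod I (\<lambda>i. hoch R (\<bb> i))) (cover_res I \<bb> F)"
proof -
  have "cover_res I \<bb> F = (\<lambda>n \<phi>. \<lambda>i\<in>I. hpull (\<bb> i) (F i) n \<phi>)"
    by (simp add: cover_res_def fun_eq_iff)
  then show ?thesis
    using binf_prod_tuple[OF cartesian_functor.hpull_binf_hom[OF member_cartesian]] by simp
qed

lemma overlap_res_hom:
  shows "binf_hom R (binf_prod I (\<lambda>i. hoch R (\<bb> i))) (binf_prod (I \<times> I) (\<lambda>ij. hoch R (overlap \<bb> F ij))) (overlap_res1 I \<bb> F)"
    and "binf_hom R (binf_prod I (\<lambda>i. hoch R (\<bb> i))) (binf_prod (I \<times> I) (\<lambda>ij. hoch R (overlap \<bb> F ij))) (overlap_res2 I \<bb> F)"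
proof -
  let ?P = "binf_prod I (\<lambda>i. hoch R (\<bb> i))"
  have "binf_hom R ?P (hoch R (overlap \<bb> F ij)) (\<lambda>n \<phi>. hpull (overlap \<bb> F ij) proj1 n (\<phi> (fst ij)))"
    "binf_hom R ?P (hoch R (overlap \<bb> F ij)) (\<lambda>n \<phi>. hpull (overlap \<bb> F ij) proj2 n (\<phi> (snd ij)))"
    if ij: "ij \<in> I \<times> I" for ij
  proof -
    interpret cartesian_cospan R "\<bb> (fst ij)" "\<bb> (snd ij)" \<aa> "F (fst ij)" "F (snd ij)"
      using ij by (intro cospan) auto
    have ov: "overlap \<bb> F ij = pullback (\<bb> (fst ij)) (F (fst ij)) (\<bb> (snd ij)) (F (snd ij))"
      by (simp add: overlap_def case_prod_unfold)
    show "binf_hom R ?P (hoch R (overlap \<bb> F ij)) (\<lambda>n \<phi>. hpull (overlap \<bb> F ij) proj1 n (\<phi> (fst ij)))"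
      "binf_hom R ?P (hoch R (overlap \<bb> F ij)) (\<lambda>n \<phi>. hpull (overlap \<bb> F ij) proj2 n (\<phi> (snd ij)))"
      using ij binf_hom_comp[OF binf_prod_proj[of "fst ij" I R "\<lambda>i. hoch R (\<bb> i)"] proj1.hpull_binf_hom]
        binf_hom_comp[OF binf_prod_proj[of "snd ij" I R "\<lambda>i. hoch R (\<bb> i)"] proj2.hpull_binf_hom]
      unfolding ov by auto
  qed
  note h = this
  have "overlap_res1 I \<bb> F = (\<lambda>n \<phi>. \<lambda>ij\<in>I \<times> I. hpull (overlap \<bb> F ij) proj1 n (\<phi> (fst ij)))"
    "overlap_res2 I \<bb> F = (\<lambda>n \<phi>. \<lambda>ij\<in>I \<times> I. hpull (overlap \<bb> F ij) proj2 n (\<phi> (snd ij)))"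
    by (auto simp: overlap_res1_def overlap_res2_def fun_eq_iff restrict_def)
  then show "binf_hom R ?P (binf_prod (I \<times> I) (\<lambda>ij. hoch R (overlap \<bb> F ij))) (overlap_res1 I \<bb> F)"
    "binf_hom R ?P (binf_prod (I \<times> I) (\<lambda>ij. hoch R (overlap \<bb> F ij))) (overlap_res2 I \<bb> F)"
    using binf_prod_tuple[OF h(1)] binf_prod_tuple[OF h(2)] by simp_all
qed

end

theorem theorem1p1:
  fixes R :: "'k ring"
    and \<aa> :: "('k, 'o, 'm, 'a, 'x) mgcat"
    and I :: "'i set"
    and \<bb> :: "'i \<Rightarrow> ('k, 'o', 'm', 'a', 'x') mgcat"
    and F :: "'i \<Rightarrow> ('o', 'm', 'a', 'x', 'o, 'm, 'a, 'x) gfun"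
  assumes "map_graded R \<aa>"
    and "\<And>i. i \<in> I \<Longrightarrow> map_graded R (\<bb> i)"
    and "infinity_cover R I \<bb> \<aa> F"
  shows "binf_equalizer TYPE('t) R
           (hoch R \<aa>)
           (binf_prod I (\<lambda>i. hoch R (\<bb> i)))
           (binf_prod (I \<times> I) (\<lambda>ij. hoch R (overlap \<bb> F ij)))
           (cover_res I \<bb> F) (overlap_res1 I \<bb> F) (overlap_res2 I \<bb> F) \<and>
         (\<forall>n. bij_betw (cover_res I \<bb> F n)
           (carrier (grd (hoch R \<aa>) n))
           {\<phi> \<in> carrier (grd (binf_prod I (\<lambda>i. hoch R (\<bb> i))) n).
              overlap_res1 I \<bb> F n \<phi> = overlap_res2 I \<bb> F n \<phi>})"
proof -
  interpret infinity_covering R \<aa> I \<bb> F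
    using assms by (rule infinity_covering.intro)
  have grd: "grd (hoch R \<aa>) n = cochains R \<aa> n" for n
    by (simp add: hoch_def)
  have "binf_equalizer TYPE('t) R (hoch R \<aa>) (binf_prod I (\<lambda>i. hoch R (\<bb> i)))
      (binf_prod (I \<times> I) (\<lambda>ij. hoch R (overlap \<bb> F ij)))
      (cover_res I \<bb> F) (overlap_res1 I \<bb> F) (overlap_res2 I \<bb> F)"
    by (rule binf_equalizerI[OF cover_res_hom overlap_res_hom])
      (simp_all add: grd cover_res_bij base.cochain_add_closed base.cochain_smult_closed
        base.hoch_bop_closed base.hoch_mop_closed)
  then show ?thesis
    using cover_res_bij by (simp add: grd)
qed

end
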